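(* Let $d,m,n\geq 1$ be integers with $d=m+n$, and let $c>0$. Then for every $\epsilon>0$ and for $\nu$-almost every affine unimodular lattice $\Lambda+\xi\in Y_d$, there exist a constant $C=C(c,\Lambda,\xi,d,\epsilon)>0$ and $T_0>1$ such that for all $T>T_0$, \[ \left|\frac{\#((\Lambda+\xi)\cap R_{T,c})}{\log T}-cB_mC_n\right| < C\,(\log T)^{-\frac12}(\log\log T)^{\frac32}(\log\log\log T)^{\frac12+\epsilon}. \]
   Context: $Y_d$ is the space of affine unimodular lattices $\Lambda+\xi$ ($\Lambda$ a unimodular lattice in $\mathbb{R}^d$, $\xi\in\mathbb{R}^d/\Lambda$), identified with $(\mathrm{SL}_d(\mathbb{R})\ltimes\mathbb{R}^d)/(\mathrm{SL}_d(\mathbb{Z})\ltimes\mathbb{Z}^d)$ and equipped with its invariant Haar probability measure $\nu$. With $\|\cdot\|$ the Euclidean norm, $R_{T,c}=\{(\mathbf{x},\mathbf{y})\in\mathbb{R}^m\times\mathbb{R}^n : \|\mathbf{x}\|^m\|\mathbf{y}\|^n\leq c,\ 1\leq\|\mathbf{y}\|<T\}\subset\mathbb{R}^d$, whose volume is $cB_mC_n\log T$, where $B_m$ is the volume of the unit ball in $\mathbb{R}^m$ and $C_n$ is the surface area of the unit sphere $\mathbb{S}^{n-1}\subset\mathbb{R}^n$. *)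

theory Defs
  imports "HOL-Probability.Probability"
begin

text \<open>
  The group \<open>SL\<^sub>d(\<real>) \<ltimes> \<real>\<^sup>d\<close>; the pair \<open>(A, b)\<close> stands for the affine map \<open>x \<mapsto> A x + b\<close>.
\<close>

definition aff_map :: "(real^'n^'n) \<times> (real^'n) \<Rightarrow> real^'n \<Rightarrow> real^'n"
  where "aff_map g x = fst g *v x + snd g"

definition ASL :: "((real^'n^'n) \<times> (real^'n)) set"
  where "ASL = {g. det (fst g) = 1}"

definition ASL_mult ::
    "(real^'n^'n) \<times> (real^'n) \<Rightarrow> (real^'n^'n) \<times> (real^'n) \<Rightarrow> (real^'n^'n) \<times> (real^'n)"
  where "ASL_mult g h = (fst g ** fst h, fst g *v snd h + snd g)"

definition ASL_int :: "((real^'n^'n) \<times> (real^'n)) set"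
  where "ASL_int = {g \<in> ASL. (\<forall>i j. fst g $ i $ j \<in> \<int>) \<and> (\<forall>i. snd g $ i \<in> \<int>)}"

definition int_lattice :: "(real^'n) set"
  where "int_lattice = {k. \<forall>i. k $ i \<in> \<int>}"

definition affine_lattice :: "(real^'n^'n) \<times> (real^'n) \<Rightarrow> (real^'n) set"
  where "affine_lattice g = aff_map g ` int_lattice"

definition affine_lattices :: "(real^'n) set set"
  where "affine_lattices = affine_lattice ` ASL"

text \<open>
  The open sets of \<open>affine_lattices\<close> are those of the quotient topology of
  \<open>(SL\<^sub>d(\<real>) \<ltimes> \<real>\<^sup>d) / (SL\<^sub>d(\<int>) \<ltimes> \<int>\<^sup>d)\<close>. Lemma \<open>affine_lattice_eq_iff\<close> below shows that the fibres
  of \<^const>\<open>affine_lattice\<close> are exactly the cosets of \<open>SL\<^sub>d(\<int>) \<ltimes> \<int>\<^sup>d\<close>.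
\<close>

definition open_affine_lattices :: "(real^'n) set set set"
  where "open_affine_lattices =
    {U. U \<subseteq> affine_lattices \<and> openin (top_of_set ASL) {g \<in> ASL. affine_lattice g \<in> U}}"

text \<open>
  The Haar probability measure on the quotient is the unique Borel probability measure invariant
  under the left action of \<open>SL\<^sub>d(\<real>) \<ltimes> \<real>\<^sup>d\<close>, which sends an affine lattice to its image under the
  affine map.
\<close>

definition haar_probability :: "(real^'n) set measure \<Rightarrow> bool"
  where "haar_probability \<nu> \<longleftrightarrow>
    prob_space \<nu> \<and>
    space \<nu> = affine_lattices \<and>
    sets \<nu> = sigma_sets affine_lattices open_affine_lattices \<and>
    (\<forall>g\<in>ASL. \<forall>E\<in>sets \<nu>. emeasure \<nu> ((\<lambda>L. aff_map g ` L) ` E) = emeasure \<nu> E)"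


text \<open>
  \<open>\<real>\<^sup>d = \<real>\<^sup>m \<times> \<real>\<^sup>n\<close> is \<^typ>\<open>real^('m+'n)\<close>, with coordinates indexed by a disjoint sum.
\<close>

definition xpart :: "real^('m::finite+'n::finite) \<Rightarrow> real^'m"
  where "xpart v = (\<chi> i. v $ Inl i)"

definition ypart :: "real^('m::finite+'n::finite) \<Rightarrow> real^'n"
  where "ypart v = (\<chi> j. v $ Inr j)"

definition region :: "real \<Rightarrow> real \<Rightarrow> (real^('m::finite+'n::finite)) set"
  where "region T c =
    {v. norm (xpart v) ^ CARD('m) * norm (ypart v) ^ CARD('n) \<le> c \<and>
        1 \<le> norm (ypart v) \<and> norm (ypart v) < T}"

text \<open>
  Surface area is taken as codimension-one Minkowski content. Lemma
  \<open>surface_area_unit_sphere\<close> below gives the value for the unit sphere; for \<open>n = 1\<close> the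
  sphere consists of two points and has area \<open>2\<close>.
\<close>

definition surface_area :: "'a::euclidean_space set \<Rightarrow> real"
  where "surface_area S =
    Lim (at_right 0) (\<lambda>\<epsilon>. measure lborel {x. infdist x S \<le> \<epsilon>} / (2 * \<epsilon>))"


lemma aff_map_ASL_mult: "aff_map (ASL_mult g h) x = aff_map g (aff_map h x)"
  by (simp add: aff_map_def ASL_mult_def matrix_vector_mul_assoc[symmetric]
      matrix_vector_right_distrib)

lemma int_matrix_vector:
  fixes M :: "real^'n^'n"
  assumes "\<forall>i j. M $ i $ j \<in> \<int>" "x \<in> int_lattice"
  shows "M *v x \<in> int_lattice"
  using assms by (auto simp: int_lattice_def matrix_vector_mult_def intro!: Ints_sum Ints_mult)

lemma int_det:
  fixes M :: "real^'n^'n"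
  assumes "\<forall>i j. M $ i $ j \<in> \<int>"
  shows "det M \<in> \<int>"
  using assms by (auto simp: det_def intro!: Ints_sum Ints_mult Ints_prod)

lemma ASL_int_image:
  fixes \<gamma> :: "(real^'n^'n) \<times> (real^'n)"
  assumes "\<gamma> \<in> ASL_int"
  shows "aff_map \<gamma> ` int_lattice = int_lattice"
proof
  let ?M = "fst \<gamma>" and ?b = "snd \<gamma>"
  have M: "\<forall>i j. ?M $ i $ j \<in> \<int>" and b: "?b \<in> int_lattice" and det: "det ?M = 1"
    using assms by (auto simp: ASL_int_def ASL_def int_lattice_def)
  have add: "x + y \<in> int_lattice" "x - y \<in> int_lattice"
    if "x \<in> int_lattice" "y \<in> int_lattice" for x y :: "real^'n"
    using that by (auto simp: int_lattice_def)
  show "aff_map \<gamma> ` int_lattice \<subseteq> int_lattice"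
    using add(1)[OF int_matrix_vector[OF M] b] by (auto simp: aff_map_def)
  show "int_lattice \<subseteq> aff_map \<gamma> ` int_lattice"
  proof
    fix k :: "real^'n" assume k: "k \<in> int_lattice"
    define x :: "real^'n" where
      "x = (\<chi> l. det (\<chi> i j. if j = l then (k - ?b) $ i else ?M $ i $ j) / det ?M)"
    have "?M *v x = k - ?b"
      using cramer[of ?M x "k - ?b"] det by (simp add: x_def)
    then have "k = aff_map \<gamma> x"
      by (simp add: aff_map_def)
    moreover have "det (\<chi> i j. if j = l then (k - ?b) $ i else ?M $ i $ j) \<in> \<int>" for l
      using add(2)[OF k b] M by (intro int_det) (auto simp: int_lattice_def)
    then have "x \<in> int_lattice"
      by (simp add: int_lattice_def x_def det)
    ultimately show "k \<in> aff_map \<gamma> ` int_lattice"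
      by blast
  qed
qed

lemma affine_lattice_eq_iff:
  fixes g h :: "(real^'n^'n) \<times> (real^'n)"
  assumes g: "g \<in> ASL" and h: "h \<in> ASL"
  shows "affine_lattice g = affine_lattice h \<longleftrightarrow> (\<exists>\<gamma>\<in>ASL_int. h = ASL_mult g \<gamma>)"
proof
  assume "\<exists>\<gamma>\<in>ASL_int. h = ASL_mult g \<gamma>"
  then obtain \<gamma> where \<gamma>: "\<gamma> \<in> ASL_int" "h = ASL_mult g \<gamma>" by blast
  have "affine_lattice h = aff_map g ` aff_map \<gamma> ` int_lattice"
    by (simp add: affine_lattice_def \<gamma>(2) aff_map_ASL_mult image_image)
  then show "affine_lattice g = affine_lattice h"
    by (simp add: affine_lattice_def ASL_int_image[OF \<gamma>(1)])
next
  assume eq: "affine_lattice g = affine_lattice h"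
  have detg: "det (fst g) = 1" and deth: "det (fst h) = 1"
    using g h by (auto simp: ASL_def)
  then obtain B where B: "fst g ** B = mat 1" "B ** fst g = mat 1"
    using invertible_det_nz[of "fst g"] by (auto simp: invertible_def)
  define M where "M = B ** fst h"
  define v where "v = B *v (snd h - snd g)"
  have key: "M *v k + v \<in> int_lattice" if "k \<in> int_lattice" for k
  proof -
    have "aff_map h k \<in> affine_lattice g"
      using that eq by (auto simp: affine_lattice_def)
    then obtain l where l: "l \<in> int_lattice" "fst h *v k + snd h = fst g *v l + snd g"
      by (auto simp: affine_lattice_def aff_map_def)
    have "M *v k + v = B *v (fst h *v k + snd h - snd g)"
      by (simp add: M_def v_def matrix_vector_mul_assoc[symmetric] matrix_vector_right_distrib
          matrix_vector_mult_diff_distrib)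
    also have "\<dots> = B *v (fst g *v l)" using l(2) by simp
    also have "\<dots> = l" by (simp add: matrix_vector_mul_assoc B(2))
    finally show ?thesis using l(1) by simp
  qed
  have v: "v \<in> int_lattice"
    using key[of 0] by (simp add: int_lattice_def)
  have "M $ i $ j \<in> \<int>" for i j
  proof -
    have "M *v axis j 1 + v \<in> int_lattice"
      by (rule key) (auto simp: int_lattice_def axis_def)
    then have "(M *v axis j 1) $ i + v $ i \<in> \<int>" by (simp add: int_lattice_def)
    then have "(M *v axis j 1) $ i + v $ i - v $ i \<in> \<int>"
      using v by (intro Ints_diff) (auto simp: int_lattice_def)
    then show ?thesis by (simp add: matrix_vector_mult_basis column_def)
  qed
  moreover have "det M = 1"
    using B(1) detg deth by (metis M_def det_I det_mul mult_1)
  ultimately have "(M, v) \<in> ASL_int"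
    using v by (auto simp: ASL_int_def ASL_def int_lattice_def)
  moreover have "h = ASL_mult g (M, v)"
    by (simp add: ASL_mult_def M_def v_def matrix_mul_assoc matrix_vector_mul_assoc B(1)
        prod_eq_iff)
  ultimately show "\<exists>\<gamma>\<in>ASL_int. h = ASL_mult g \<gamma>" by blast
qed

lemma infdist_unit_sphere:
  fixes x :: "'a::euclidean_space"
  shows "infdist x (sphere 0 1) = \<bar>norm x - 1\<bar>"
proof -
  obtain u :: 'a where u: "norm u = 1" using vector_choose_size[of 1] by auto
  define y where "y = (if x = 0 then u else x /\<^sub>R norm x)"
  have y: "y \<in> sphere 0 1" "dist x y = \<bar>norm x - 1\<bar>"
  proof -
    show "y \<in> sphere 0 1" by (auto simp: y_def u)
    show "dist x y = \<bar>norm x - 1\<bar>"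
    proof (cases "x = 0")
      case False
      have "x - x /\<^sub>R norm x = (1 - 1 / norm x) *\<^sub>R x"
        by (simp add: scaleR_left_diff_distrib divide_inverse)
      then have "dist x y = \<bar>1 - 1 / norm x\<bar> * norm x"
        using False by (simp add: y_def dist_norm)
      also have "\<dots> = \<bar>(1 - 1 / norm x) * norm x\<bar>" by (simp add: abs_mult)
      also have "\<dots> = \<bar>norm x - 1\<bar>" using False by (simp add: left_diff_distrib)
      finally show ?thesis .
    qed (simp add: y_def u)
  qed
  show ?thesis
  proof (rule antisym)
    show "infdist x (sphere 0 1) \<le> \<bar>norm x - 1\<bar>" using infdist_le[OF y(1), of x] y(2) by simp
    have "\<bar>norm x - 1\<bar> \<le> dist x z" if "z \<in> sphere 0 1" for z
      using that norm_triangle_ineq3[of x z] by (simp add: dist_norm)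
    then show "\<bar>norm x - 1\<bar> \<le> infdist x (sphere 0 1)"
      using y(1) by (auto simp: infdist_def intro!: cINF_greatest)
  qed
qed

lemma surface_area_unit_sphere:
  "surface_area (sphere (0::'a::euclidean_space) 1) = DIM('a) * unit_ball_vol (DIM('a))"
proof -
  let ?n = "DIM('a)" and ?B = "unit_ball_vol (DIM('a))"
  have "((\<lambda>t::real. (1 + t) ^ ?n - (1 - t) ^ ?n) has_real_derivative 2 * ?n) (at 0)"
    by (auto intro!: derivative_eq_intros)
  then have "((\<lambda>t::real. ((1 + t) ^ ?n - (1 - t) ^ ?n) / t) \<longlongrightarrow> 2 * ?n) (at 0)"
    by (simp add: DERIV_def)
  then have "((\<lambda>t::real. ((1 + t) ^ ?n - (1 - t) ^ ?n) / t) \<longlongrightarrow> 2 * ?n) (at_right 0)"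
    by (rule Lim_at_imp_Lim_at_within)
  then have "((\<lambda>t::real. ((1 + t) ^ ?n - (1 - t) ^ ?n) / t * (?B / 2)) \<longlongrightarrow> 2 * ?n * (?B / 2))
      (at_right 0)"
    by (rule tendsto_mult_right)
  moreover have "eventually (\<lambda>t::real. ((1 + t) ^ ?n - (1 - t) ^ ?n) / t * (?B / 2) =
      measure lborel {x::'a. infdist x (sphere 0 1) \<le> t} / (2 * t)) (at_right 0)"
    using eventually_at_right_real[OF zero_less_one]
  proof eventually_elim
    case (elim t)
    have "{x::'a. infdist x (sphere 0 1) \<le> t} = cball 0 (1 + t) - ball 0 (1 - t)"
      by (auto simp: infdist_unit_sphere abs_le_iff)
    moreover have "measure lborel (cball 0 (1 + t) - ball (0::'a) (1 - t)) =
        measure lborel (cball (0::'a) (1 + t)) - measure lborel (ball (0::'a) (1 - t))"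
      using elim emeasure_lborel_cball_finite[of "0::'a" "1 + t"] by (intro measure_Diff) auto
    ultimately show ?case
      using elim by (simp add: content_cball content_ball field_simps)
  qed
  ultimately have "((\<lambda>t. measure lborel {x::'a. infdist x (sphere 0 1) \<le> t} / (2 * t))
      \<longlongrightarrow> ?n * ?B) (at_right 0)"
    by (auto elim: Lim_transform_eventually)
  then show ?thesis
    unfolding surface_area_def by (intro tendsto_Lim) auto
qed

end

theory Submission
  imports Defs "HOL-Library.Log_Nat" "HOL-Real_Asymp.Real_Asymp"
begin

text \<open>
  The proof is a second moment estimate followed by the Gal--Koksma (Rademacher--Menshov) argument.
  Write \<open>N(A)\<close> for the number of points of a random affine lattice in a bounded set \<open>A\<close>. By invariance,
  the integral of a truncated function of the lattice is at most the integral of the truncation of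
  its averages over elements of the group, so pointwise limits of averages for a fixed lattice
  suffice and no reduction theory is needed. Averaging over translations in large balls gives
  \<open>E N(A) \<ge> vol A\<close>. Averaging \<open>N(A)\<^sup>2\<close> over translations leaves the sum over lattice differences
  \<open>k\<close> of \<open>vol (A \<inter> (A - k))\<close>; averaging further over shears composed with an expanding diagonal map,
  each fixed \<open>k \<noteq> 0\<close> is expelled, while the sum over the remaining \<open>k\<close> is compared with an integral by
  moving \<open>k\<close> inside its lattice cell. This is an upper bound in Siegel's mean value theorem and
  gives \<open>E N(A)\<^sup>2 \<le> vol A + (vol A)\<^sup>2\<close>, so the variance of \<open>N(A)\<close> is at most \<open>vol A\<close>. The volume of
  \<open>region T c\<close> is linear in \<open>ln T\<close>, so the discrepancies at \<open>T = exp n\<close> have increments of linear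
  variance over every block of indices, and a dyadic decomposition with Borel--Cantelli gives the rate.
\<close>

section \<open>Linear changes of variables\<close>

text \<open>The exponents in the rate come from three factors of \<open>s\<close>, roughly the
  logarithm of the index, in the bound for the squared discrepancy: Cauchy-Schwarz over the dyadic
  levels, the number of levels in the expected sum of squares, and the weight
  \<open>s * (1 + ln s) powr (1 + 2 * \<epsilon>)\<close> that makes the normalised expectations
  summable. The square root halves them, and the index is of size \<open>ln T\<close>.

  One inequality per moment suffices because of the signs in \<open>E N^2 - 2 v E N + v^2\<close>:
  an upper bound for the second moment and a lower bound for the first.

  The delicate point is the comparison of the sheared lattice sum with an integral. A genuine shear
  with distinguished coordinate \<open>m\<close> leaves that coordinate of a vector alone, so it
  cannot compensate a displacement in direction \<open>m\<close>. An auxiliary parameter, confined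
  to an interval of length \<theta>, restores this freedom at the price of thickening the set by a
  multiple of \<theta>; letting \<theta> tend to 0 leaves the volume of the closure, whence the care
  about boundaries. Shears need a second coordinate, which is where \<open>d \<ge> 2\<close>
  enters.\<close>

lemma prod_Basis_cart: "(\<Prod>b\<in>Basis. f b) = (\<Prod>i\<in>UNIV. f (axis i 1 :: real^'k))"
proof -
  have B: "(Basis :: (real^'k) set) = (\<lambda>i. axis i 1) ` UNIV" by (auto simp: Basis_vec_def)
  have inj: "inj (\<lambda>i::'k. axis i (1::real))" by (auto simp: inj_on_def axis_eq_axis)
  show ?thesis unfolding B by (simp add: prod.reindex[OF inj])
qed

lemma measure_shear_cbox:
  fixes a b :: "real^'k"
  assumes mn: "m \<noteq> n"
  shows "measure lebesgue ((\<lambda>x::real^'k. \<chi> i. if i = m then x$m + x$n else x$i) ` cbox a b)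
    = measure lebesgue (cbox a b)" (is "measure lebesgue (?f ` _) = _")
proof (cases "cbox a b = {}")
  case False
  \<comment> \<open>\<open>measure_shear_interval\<close> asks for a nonnegative lower end in
    coordinate \<open>n\<close>; translating by \<open>v\<close> moves that end to
    \<open>0\<close>.\<close>
  define v :: "real^'k" where "v = (\<chi> i. if i = n then - (a $ n) else 0)"
  have add: "?f (x + y) = ?f x + ?f y" for x y by (auto simp: vec_eq_iff)
  have "(+) (?f v) ` ?f ` cbox a b = ?f ` (+) v ` cbox a b"
    unfolding image_image add ..
  then have "measure lebesgue (?f ` cbox a b) = measure lebesgue (?f ` (+) v ` cbox a b)"
    using measure_translation[of "?f v" "?f ` cbox a b"] by simp
  also have "\<dots> = measure lebesgue (?f ` cbox (v + a) (v + b))"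
    by (simp only: cbox_translation)
  also have "\<dots> = measure lebesgue (cbox (v + a) (v + b))"
  proof (rule measure_shear_interval[OF mn])
    show "cbox (v + a) (v + b) \<noteq> {}" using False by (simp add: cbox_translation)
    show "0 \<le> (v + a) $ n" by (simp add: v_def)
  qed
  also have "\<dots> = measure lebesgue ((+) v ` cbox a b)" by (simp only: cbox_translation)
  also have "\<dots> = measure lebesgue (cbox a b)" by (rule measure_translation)
  finally show ?thesis .
qed simp

lemma lborel_shear:
  fixes m n :: "'k::finite"
  assumes mn: "m \<noteq> n"
  shows "lborel = distr lborel borel (\<lambda>x::real^'k. \<chi> i. if i = m then x$m - x$n else x$i)"
    (is "_ = distr _ _ ?g")
proof (rule lborel_eqI)
  fix l u :: "real^'k" assume le: "\<And>b. b \<in> Basis \<Longrightarrow> l \<bullet> b \<le> u \<bullet> b"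
  let ?f = "\<lambda>x::real^'k. \<chi> i. if i = m then x$m + x$n else x$i"
  have lin: "linear ?f" by (rule linearI) (auto simp: vec_eq_iff algebra_simps)
  have "linear ?g" by (rule linearI) (auto simp: vec_eq_iff algebra_simps)
  then have g[measurable]: "?g \<in> borel_measurable borel"
    by (intro borel_measurable_continuous_onI linear_continuous_on) (simp add: linear_conv_bounded_linear)
  have inv: "?f (?g x) = x" "?g (?f x) = x" for x
    by (simp_all add: vec_eq_iff mn[symmetric])
  have vim: "?g -` S = ?f ` S" for S
  proof
    show "?g -` S \<subseteq> ?f ` S"
    proof
      fix x assume "x \<in> ?g -` S"
      then have "?f (?g x) \<in> ?f ` S" by blast
      then show "x \<in> ?f ` S" unfolding inv .
    qed
    show "?f ` S \<subseteq> ?g -` S" unfolding image_subset_iff vimage_def mem_Collect_eq inv by simp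
  qed
  have meas: "?f ` box l u \<in> sets borel"
    using measurable_sets[OF g, of "box l u"] by (simp add: vim)
  \<comment> \<open>\<open>lborel_eqI\<close> tests open boxes while
    \<open>measure_shear_cbox\<close> treats closed ones. They differ by a null set, and a linear
    map sends null sets to null sets.\<close>
  have ne: "negligible (?f ` (cbox l u - box l u))"
    by (intro negligible_differentiable_image_negligible negligible_frontier_interval linear_imp_differentiable_on lin) simp
  have "?f ` cbox l u = ?f ` box l u \<union> ?f ` (cbox l u - box l u)"
    using box_subset_cbox[of l u] by blast
  moreover have "?f ` box l u \<in> sets lebesgue" using meas by simp
  ultimately have "measure lebesgue (?f ` box l u) = measure lebesgue (?f ` cbox l u)"
    using measure_Un_null_set[of "?f ` box l u" lebesgue] ne by (simp add: negligible_iff_null_sets)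
  also have "\<dots> = measure lebesgue (cbox l u)" by (rule measure_shear_cbox[OF mn])
  finally have eq: "measure lborel (?f ` box l u) = (\<Prod>b\<in>Basis. (u - l) \<bullet> b)"
    using le meas by (simp add: measure_completion measure_lborel_cbox_eq)
  have "bounded (?f ` box l u)" by (intro bounded_linear_image bounded_box) (use lin in \<open>simp add: linear_conv_bounded_linear\<close>)
  then have "emeasure lborel (?f ` box l u) < \<infinity>" by (rule emeasure_bounded_finite)
  then have "emeasure lborel (?f ` box l u) = ennreal (\<Prod>b\<in>Basis. (u - l) \<bullet> b)"
    by (subst emeasure_eq_ennreal_measure) (auto simp: eq)
  then show "emeasure (distr lborel borel ?g) (box l u) = ennreal (\<Prod>b\<in>Basis. (u - l) \<bullet> b)"
    by (simp add: emeasure_distr vim)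
qed simp

lemma lborel_permute:
  fixes \<tau> :: "'k::finite \<Rightarrow> 'k"
  assumes \<tau>: "bij \<tau>"
  shows "lborel = distr lborel borel (\<lambda>x::real^'k. \<chi> i. x $ \<tau> i)" (is "_ = distr _ _ ?g")
proof (rule lborel_eqI)
  fix l u :: "real^'k" assume le: "\<And>b. b \<in> Basis \<Longrightarrow> l \<bullet> b \<le> u \<bullet> b"
  then have le': "l $ i \<le> u $ i" for i using axis_in_Basis_iff[of i "1::real"] by (auto simp: cart_eq_inner_axis)
  have "linear ?g" by (rule linearI) (auto simp: vec_eq_iff algebra_simps)
  then have g[measurable]: "?g \<in> borel_measurable borel"
    by (intro borel_measurable_continuous_onI linear_continuous_on) (simp add: linear_conv_bounded_linear)
  let ?i = "inv \<tau>"
  have \<tau>1: "\<tau> (?i i) = i" "?i (\<tau> i) = i" for i using \<tau> by (auto simp: bij_is_surj surj_f_inv_f bij_is_inj)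
  have "?g -` box l u = box (\<chi> i. l $ ?i i) (\<chi> i. u $ ?i i)"
    using \<tau>1 by (auto simp: mem_box_cart dest: spec[of _ "\<tau> _"]) (metis \<tau>1)+
  moreover have "emeasure lborel (box (\<chi> i. l $ ?i i) (\<chi> i. u $ ?i i)) = ennreal (\<Prod>i\<in>UNIV. u $ ?i i - l $ ?i i)"
    proof (subst emeasure_lborel_box)
    show "(\<chi> i. l $ ?i i) \<bullet> b \<le> (\<chi> i. u $ ?i i) \<bullet> b" if "b \<in> Basis" for b
      using that le' by (auto simp: Basis_vec_def inner_axis)
  qed (simp add: prod_Basis_cart inner_axis)
  moreover have "(\<Prod>i\<in>UNIV. u $ ?i i - l $ ?i i) = (\<Prod>i\<in>UNIV. u $ i - l $ i)"
    using prod.reindex_bij_betw[of ?i UNIV UNIV "\<lambda>i. u $ i - l $ i"] \<tau> by (simp add: bij_imp_bij_inv)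
  moreover have "(\<Prod>b\<in>Basis. (u - l) \<bullet> b) = (\<Prod>i\<in>UNIV. u $ i - l $ i)"
    by (simp add: prod_Basis_cart inner_axis)
  ultimately show "emeasure (distr lborel borel ?g) (box l u) = ennreal (\<Prod>b\<in>Basis. (u - l) \<bullet> b)"
    by (simp add: emeasure_distr)
qed simp

lemma borel_measurable_matrix_vector [measurable]:
  fixes M :: "real^'k^'l"
  shows "(\<lambda>x. M *v x) \<in> borel_measurable borel"
  by (intro borel_measurable_continuous_onI) (rule matrix_vector_mult_linear_continuous_on)

text \<open>The formula is multiplicative in \<open>M\<close>, so it is enough to check it on
  diagonal matrices, transpositions and elementary shears. Guarding it by
  \<open>det M \<noteq> 0\<close> makes the remaining generators, those with a zero row,
  vacuous.\<close>

lemma nn_integral_lborel_matrix: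
  fixes M :: "real^'k^'k"
  assumes "det M \<noteq> 0" and "f \<in> borel_measurable borel"
  shows "(\<integral>\<^sup>+x. f x \<partial>lborel) = ennreal \<bar>det M\<bar> * (\<integral>\<^sup>+x. f (M *v x) \<partial>lborel)"
proof -
  define P where "P M \<longleftrightarrow> (det M \<noteq> 0 \<longrightarrow> (\<forall>f\<in>borel_measurable borel.
    (\<integral>\<^sup>+x. f x \<partial>lborel) = ennreal \<bar>det M\<bar> * (\<integral>\<^sup>+x. f (M *v x) \<partial>lborel)))" for M :: "real^'k^'k"
  have "P M"
  proof (rule induct_matrix_elementary_alt[of P], goal_cases)
    case (1 A B)
    show ?case unfolding P_def
    proof (intro impI ballI)
      fix f :: "real^'k \<Rightarrow> ennreal" assume d: "det (A ** B) \<noteq> 0" and [measurable]: "f \<in> borel_measurable borel"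
      have "(\<integral>\<^sup>+x. f x \<partial>lborel) = ennreal \<bar>det A\<bar> * (\<integral>\<^sup>+x. f (A *v x) \<partial>lborel)"
        by (rule 1(1)[unfolded P_def, rule_format]) (use d in \<open>auto simp: det_mul\<close>)
      also have "(\<integral>\<^sup>+x. f (A *v x) \<partial>lborel) = ennreal \<bar>det B\<bar> * (\<integral>\<^sup>+x. f (A *v (B *v x)) \<partial>lborel)"
        by (rule 1(2)[unfolded P_def, rule_format]) (use d in \<open>auto simp: det_mul\<close>)
      finally show "(\<integral>\<^sup>+x. f x \<partial>lborel) = ennreal \<bar>det (A ** B)\<bar> * (\<integral>\<^sup>+x. f ((A ** B) *v x) \<partial>lborel)"
        by (simp add: det_mul abs_mult ennreal_mult mult.assoc matrix_vector_mul_assoc)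
    qed
  next
    case (2 A i)
    then show ?case by (simp add: P_def det_zero_row)
  next
    case (3 A)
    show ?case unfolding P_def
    proof (intro impI ballI)
      fix f :: "real^'k \<Rightarrow> ennreal" assume d: "det A \<noteq> 0" and [measurable]: "f \<in> borel_measurable borel"
      define c where "c j = (A *v j) \<bullet> j" for j :: "real^'k"
      have c: "c (axis i 1) = A $ i $ i" for i by (simp add: c_def inner_axis matrix_vector_mult_basis column_def)
      have det: "det A = (\<Prod>i\<in>UNIV. A $ i $ i)" using 3 by (intro det_diagonal) auto
      have B: "(Basis :: (real^'k) set) = (\<lambda>i. axis i 1) ` UNIV" by (auto simp: Basis_vec_def)
      have inj: "inj (\<lambda>i::'k. axis i (1::real))" by (auto simp: inj_on_def axis_eq_axis)
      have T: "0 + (\<Sum>j\<in>Basis. (c j * (x \<bullet> j)) *\<^sub>R j) = A *v x" for x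
      proof -
        have "A *v x = (\<chi> i. A $ i $ i * x $ i)"
        proof (subst vec_eq_iff, intro allI)
          fix i
          have "(A *v x) $ i = (\<Sum>j\<in>UNIV. A $ i $ j * x $ j)" by (simp add: matrix_vector_mult_def)
          also have "\<dots> = (\<Sum>j\<in>{i}. A $ i $ j * x $ j)" by (rule sum.mono_neutral_right) (auto simp: 3)
          finally show "(A *v x) $ i = (\<chi> i. A $ i $ i * x $ i) $ i" by simp
        qed
        also have "\<dots> = (\<Sum>i\<in>UNIV. (A $ i $ i * x $ i) *\<^sub>R axis i 1)"
          by (simp add: vec_eq_iff axis_def if_distrib cong: if_cong)
        finally show ?thesis unfolding B by (simp add: sum.reindex[OF inj] c inner_axis)
      qed
      have nz: "c j \<noteq> 0" if "j \<in> Basis" for j using that d by (auto simp: B c det)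
      have pr: "(\<Prod>j\<in>Basis. \<bar>c j\<bar>) = \<bar>det A\<bar>" unfolding B by (simp add: prod.reindex[OF inj] c det abs_prod)
      have "(\<integral>\<^sup>+x. f x \<partial>lborel) = (\<integral>\<^sup>+x. f x \<partial>density (distr lborel borel (\<lambda>x. A *v x)) (\<lambda>_. ennreal \<bar>det A\<bar>))"
        using arg_cong[OF lborel_affine_euclidean[of c 0, OF nz], of "\<lambda>M. nn_integral M f"] unfolding T pr .
      then show "(\<integral>\<^sup>+x. f x \<partial>lborel) = ennreal \<bar>det A\<bar> * (\<integral>\<^sup>+x. f (A *v x) \<partial>lborel)"
        by (simp add: nn_integral_density nn_integral_distr nn_integral_cmult)
    qed
  next
    case (4 m n)
    let ?A = "(\<chi> i j. mat 1 $ i $ Transposition.transpose m n j) :: real^'k^'k"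
    have 1: "?A *v x = (\<chi> i. x $ Transposition.transpose m n i)" for x
    proof (subst vec_eq_iff, intro allI)
      fix i
      have "(?A *v x) $ i = (\<Sum>j\<in>UNIV. (if j = Transposition.transpose m n i then x $ j else 0))"
        unfolding matrix_vector_mult_def mat_def vec_lambda_beta
        by (intro sum.cong refl) (auto simp: transpose_eq_iff)
      then show "(?A *v x) $ i = (\<chi> i. x $ Transposition.transpose m n i) $ i" by simp
    qed
    have "det ?A = of_int (sign (Transposition.transpose m n)) * det (mat 1 :: real^'k^'k)"
      by (rule det_permute_columns) (simp add: permutes_swap_id)
    then have "\<bar>det ?A\<bar> = 1" by (simp add: abs_mult sign_def)
    moreover have "(\<integral>\<^sup>+x. f x \<partial>lborel) = (\<integral>\<^sup>+x. f (\<chi> i. x $ Transposition.transpose m n i) \<partial>lborel)"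
      if [measurable]: "f \<in> borel_measurable borel" for f :: "real^'k \<Rightarrow> ennreal"
    proof -
      have [measurable]: "(\<lambda>x::real^'k. \<chi> i. x $ Transposition.transpose m n i) \<in> borel_measurable borel"
        by (intro borel_measurable_continuous_onI continuous_intros)
      have "(\<integral>\<^sup>+x. f x \<partial>lborel) = (\<integral>\<^sup>+x. f x \<partial>distr lborel borel (\<lambda>x::real^'k. \<chi> i. x $ Transposition.transpose m n i))"
        by (rule arg_cong[OF lborel_permute]) simp
      then show ?thesis by (simp add: nn_integral_distr)
    qed
    ultimately show ?case unfolding P_def 1 by simp
  next
    case (5 m n)
    let ?A = "(\<chi> i j. of_bool (i = m \<and> j = n \<or> i = j)) :: real^'k^'k"
    let ?f = "\<lambda>x::real^'k. \<chi> i. if i = m then x$m + x$n else x$i"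
    let ?g = "\<lambda>x::real^'k. \<chi> i. if i = m then x$m - x$n else x$i"
    have 1: "?A *v x = ?f x" for x
    proof (subst vec_eq_iff, intro allI)
      fix i
      have "(?A *v x) $ i = (\<Sum>j\<in>UNIV. (if j = i then x $ j else 0) + (if i = m \<and> j = n then x $ j else 0))"
        unfolding matrix_vector_mult_def using 5 by (auto intro!: sum.cong)
      then show "(?A *v x) $ i = ?f x $ i" by (auto simp: sum.distrib)
    qed
    have "?A = (\<chi> k. if k = m then row m (mat 1) + 1 *s row n (mat 1) else row k (mat 1))"
      using 5 by (auto simp: vec_eq_iff row_def mat_def)
    then have "det ?A = 1" using det_row_operation[OF 5, of "mat 1 :: real^'k^'k" 1] by simp
    moreover have "(\<integral>\<^sup>+x. f x \<partial>lborel) = (\<integral>\<^sup>+x. f (?f x) \<partial>lborel)" if [measurable]: "f \<in> borel_measurable borel" for f :: "real^'k \<Rightarrow> ennreal"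
    proof -
      have "linear ?g" "linear ?f" by (auto intro!: linearI simp: vec_eq_iff algebra_simps)
      then have [measurable]: "?g \<in> borel_measurable borel" "?f \<in> borel_measurable borel"
        by (auto intro!: borel_measurable_continuous_onI linear_continuous_on simp: linear_conv_bounded_linear)
      have fg: "?f (?g x) = x" for x by (simp add: vec_eq_iff 5[symmetric])
      have "(\<integral>\<^sup>+x. f (?f x) \<partial>lborel) = (\<integral>\<^sup>+x. f (?f x) \<partial>distr lborel borel ?g)"
        by (rule arg_cong[OF lborel_shear[OF 5]])
      also have "\<dots> = (\<integral>\<^sup>+x. f (?f (?g x)) \<partial>lborel)" by (rule nn_integral_distr) measurable
      finally show ?thesis by (simp only: fg)
    qed
    ultimately show ?case unfolding P_def 1 by simp
  qed
  then show ?thesis unfolding P_def using assms by blast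
qed

section \<open>Lattice cells\<close>

lemma nn_integral_lborel_affine:
  fixes f :: "'a::euclidean_space \<Rightarrow> ennreal"
  assumes "c \<noteq> 0" and [measurable]: "f \<in> borel_measurable borel"
  shows "(\<integral>\<^sup>+x. f x \<partial>lborel) = ennreal (\<bar>c\<bar> ^ DIM('a)) * (\<integral>\<^sup>+x. f (t + c *\<^sub>R x) \<partial>lborel)"
  by (subst lborel_affine[OF assms(1), of t]) (simp add: nn_integral_density nn_integral_distr nn_integral_cmult)

text \<open>Half-open, so that the integer translates tile the space with every point covered
  exactly once.\<close>

definition unit_cell :: "(real^'k) set"
  where "unit_cell = {x. \<forall>i. 0 \<le> x $ i \<and> x $ i < 1}"

lemma unit_cell_measurable [measurable]: "unit_cell \<in> sets borel"
  unfolding unit_cell_def by measurable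

lemma countable_int_lattice: "countable (int_lattice :: (real^'k) set)"
proof -
  have "inj_on (\<lambda>v::real^'k. vec_nth v) int_lattice" by (auto simp: inj_on_def vec_eq_iff)
  moreover have "countable (vec_nth ` (int_lattice :: (real^'k) set))"
  proof (rule countable_subset)
    show "vec_nth ` (int_lattice :: (real^'k) set) \<subseteq> PiE UNIV (\<lambda>_. \<int>)"
      by (auto simp: int_lattice_def)
    show "countable (PiE (UNIV::'k set) (\<lambda>_. \<int>::real set))"
      by (intro countable_PiE) (auto simp: Ints_def)
  qed
  ultimately show ?thesis by (metis countable_image_inj_on)
qed

lemma emeasure_unit_cell: "emeasure lborel (unit_cell :: (real^'k) set) = 1"
proof (rule antisym)
  have One_nth: "(\<Sum>x\<in>(Basis :: (real^'k) set). x $ i) = 1" for i :: 'k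
  proof -
    have "(\<Sum>x\<in>(Basis :: (real^'k) set). x $ i) = (\<Sum>Basis) \<bullet> (axis i 1 :: real^'k)"
      by (simp only: cart_eq_inner_axis inner_sum_left)
    also have "\<dots> = 1" by (rule inner_sum_Basis) simp
    finally show ?thesis .
  qed
  have "emeasure lborel (unit_cell :: (real^'k) set) \<le> emeasure lborel (cbox (0::real^'k) (\<Sum>Basis))"
    by (rule emeasure_mono) (auto simp: unit_cell_def mem_box_cart One_nth less_imp_le)
  also have "\<dots> = 1" by simp
  finally show "emeasure lborel (unit_cell :: (real^'k) set) \<le> 1" .
  have "1 = emeasure lborel (box (0::real^'k) (\<Sum>Basis))" by simp
  also have "\<dots> \<le> emeasure lborel (unit_cell :: (real^'k) set)"
    by (rule emeasure_mono) (auto simp: unit_cell_def mem_box_cart One_nth less_imp_le)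
  finally show "1 \<le> emeasure lborel (unit_cell :: (real^'k) set)" .
qed

lemma int_lattice_unit_cell:
  fixes z :: "real^'k"
  shows "{k \<in> int_lattice. z - k \<in> unit_cell} = {\<chi> i. of_int \<lfloor>z $ i\<rfloor>}"
proof -
  have "k = (\<chi> i. of_int \<lfloor>z $ i\<rfloor>)" if "k \<in> int_lattice" "z - k \<in> unit_cell" for k
  proof (subst vec_eq_iff, intro allI)
    fix i
    have "k $ i \<in> \<int>" using that(1) by (simp add: int_lattice_def)
    then obtain n where n: "k $ i = of_int n" by (rule Ints_cases)
    have "0 \<le> z $ i - k $ i" "z $ i - k $ i < 1" using that(2) by (auto simp: unit_cell_def)
    then have "\<lfloor>z $ i\<rfloor> = n" unfolding n by linarith
    then show "k $ i = (\<chi> i. of_int \<lfloor>z $ i\<rfloor>) $ i" by (simp add: n)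
  qed
  moreover have "(\<chi> i. of_int \<lfloor>z $ i\<rfloor>) \<in> int_lattice" by (simp add: int_lattice_def)
  moreover have "z - (\<chi> i. of_int \<lfloor>z $ i\<rfloor>) \<in> unit_cell"
    by (simp add: unit_cell_def frac_lt_1[unfolded frac_def])
  ultimately show ?thesis by (intro set_eqI iffI) blast+
qed

text \<open>The indicators of the cells at all integer points add up to \<open>1\<close>. Inserting
  this sum, exchanging it with the integral and moving each cell back to the origin gives the
  decomposition.\<close>

lemma nn_integral_unit_cells:
  fixes f :: "real^'k \<Rightarrow> ennreal"
  assumes [measurable]: "f \<in> borel_measurable borel"
  shows "(\<integral>\<^sup>+z. f z \<partial>lborel) =
    (\<integral>\<^sup>+k. (\<integral>\<^sup>+q. f (k + q) * indicator unit_cell q \<partial>lborel) \<partial>count_space int_lattice)"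
proof -
  have 1: "(\<integral>\<^sup>+k. indicator unit_cell (z - k) \<partial>count_space int_lattice) = (1::ennreal)" for z :: "real^'k"
  proof -
    have "(\<integral>\<^sup>+k. indicator unit_cell (z - k) \<partial>count_space int_lattice)
        = (\<integral>\<^sup>+k. indicator {k \<in> int_lattice. z - k \<in> unit_cell} k \<partial>count_space int_lattice)"
      by (intro nn_integral_cong) (auto simp: indicator_def)
    also have "\<dots> = emeasure (count_space int_lattice) {k \<in> int_lattice. z - k \<in> unit_cell}"
      by (subst nn_integral_indicator) auto
    also have "\<dots> = 1"
      unfolding int_lattice_unit_cell by (subst emeasure_count_space) (auto simp: int_lattice_def)
    finally show ?thesis .
  qed
  have "(\<integral>\<^sup>+z. f z \<partial>lborel) =
      (\<integral>\<^sup>+z. (\<integral>\<^sup>+k. f z * indicator unit_cell (z - k) \<partial>count_space int_lattice) \<partial>lborel)"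
    by (simp add: nn_integral_cmult 1)
  also have "\<dots> = (\<integral>\<^sup>+k. (\<integral>\<^sup>+z. f z * indicator unit_cell (z - k) \<partial>lborel) \<partial>count_space int_lattice)"
    by (rule nn_integral_count_space_nn_integral[OF countable_int_lattice]) measurable
  also have "\<dots> = (\<integral>\<^sup>+k. (\<integral>\<^sup>+q. f (k + q) * indicator unit_cell q \<partial>lborel) \<partial>count_space int_lattice)"
  proof (rule nn_integral_cong)
    fix k :: "real^'k"
    show "(\<integral>\<^sup>+z. f z * indicator unit_cell (z - k) \<partial>lborel) = (\<integral>\<^sup>+q. f (k + q) * indicator unit_cell q \<partial>lborel)"
      by (subst nn_integral_lborel_affine[where c=1 and t=k]) simp_all
  qed
  finally show ?thesis .
qed

lemma nn_integral_lattice_cells: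
  fixes f :: "real^'k \<Rightarrow> ennreal"
  assumes det: "det h = 1" and [measurable]: "f \<in> borel_measurable borel"
  shows "(\<integral>\<^sup>+z. f z \<partial>lborel) =
    (\<integral>\<^sup>+k. (\<integral>\<^sup>+q. f (h *v k + b + h *v q) * indicator unit_cell q \<partial>lborel) \<partial>count_space int_lattice)"
proof -
  have "(\<integral>\<^sup>+z. f z \<partial>lborel) = (\<integral>\<^sup>+z. f (b + z) \<partial>lborel)"
    by (subst nn_integral_lborel_affine[where c=1 and t=b]) auto
  also have "\<dots> = (\<integral>\<^sup>+z. f (b + h *v z) \<partial>lborel)"
    by (subst nn_integral_lborel_matrix[of h]) (auto simp: det)
  also have "\<dots> = (\<integral>\<^sup>+k. (\<integral>\<^sup>+q. f (b + h *v (k + q)) * indicator unit_cell q \<partial>lborel) \<partial>count_space int_lattice)"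
    by (rule nn_integral_unit_cells) measurable
  finally show ?thesis by (simp add: matrix_vector_right_distrib ac_simps)
qed

text \<open>A lattice cell has volume \<open>1\<close>, so \<open>\<phi> k\<close> is its own mean
  over the cell attached to \<open>k\<close>. Comparing sum and integral thus becomes a pointwise
  matter, in which the lattice point may be displaced by any \<open>h *v q\<close>.\<close>

lemma lattice_sum_le:
  fixes f :: "real^'k \<Rightarrow> ennreal"
  assumes "det h = 1" and "f \<in> borel_measurable borel"
    and le: "\<And>k q. k \<in> int_lattice \<Longrightarrow> q \<in> unit_cell \<Longrightarrow> \<phi> k \<le> f (h *v k + b + h *v q)"
  shows "(\<integral>\<^sup>+k. \<phi> k \<partial>count_space int_lattice) \<le> (\<integral>\<^sup>+z. f z \<partial>lborel)"
  unfolding nn_integral_lattice_cells[OF assms(1,2), of b]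
proof (rule nn_integral_mono)
  fix k :: "real^'k" assume "k \<in> space (count_space int_lattice)"
  then have k: "k \<in> int_lattice" by simp
  have "\<phi> k = (\<integral>\<^sup>+q. \<phi> k * indicator unit_cell (q::real^'k) \<partial>lborel)"
    by (simp add: nn_integral_cmult emeasure_unit_cell)
  also have "\<dots> \<le> (\<integral>\<^sup>+q. f (h *v k + b + h *v q) * indicator unit_cell q \<partial>lborel)"
    using le[OF k] by (intro nn_integral_mono) (auto simp: indicator_def)
  finally show "\<phi> k \<le> \<dots>" .
qed

lemma lattice_sum_ge:
  fixes f :: "real^'k \<Rightarrow> ennreal"
  assumes "det h = 1" and "f \<in> borel_measurable borel"
    and ge: "\<And>k q. k \<in> int_lattice \<Longrightarrow> q \<in> unit_cell \<Longrightarrow> f (h *v k + b + h *v q) \<le> \<phi> k"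
  shows "(\<integral>\<^sup>+z. f z \<partial>lborel) \<le> (\<integral>\<^sup>+k. \<phi> k \<partial>count_space int_lattice)"
  unfolding nn_integral_lattice_cells[OF assms(1,2), of b]
proof (rule nn_integral_mono)
  fix k :: "real^'k" assume "k \<in> space (count_space int_lattice)"
  then have k: "k \<in> int_lattice" by simp
  have "(\<integral>\<^sup>+q. f (h *v k + b + h *v q) * indicator unit_cell q \<partial>lborel)
      \<le> (\<integral>\<^sup>+q. \<phi> k * indicator unit_cell (q::real^'k) \<partial>lborel)"
    using ge[OF k] by (intro nn_integral_mono) (auto simp: indicator_def)
  also have "\<dots> = \<phi> k"
    by (simp add: nn_integral_cmult emeasure_unit_cell)
  finally show "(\<integral>\<^sup>+q. f (h *v k + b + h *v q) * indicator unit_cell q \<partial>lborel) \<le> \<phi> k" .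
qed

lemma norm_unit_cell:
  fixes h :: "real^'k^'k"
  shows "\<exists>D>0. \<forall>q\<in>unit_cell. norm (h *v q) \<le> D"
proof -
  have "bounded (cbox (0::real^'k) 1)" by (rule bounded_cbox)
  then have "bounded (unit_cell :: (real^'k) set)"
    by (rule bounded_subset) (auto simp: unit_cell_def mem_box_cart less_imp_le)
  then have "bounded ((\<lambda>q. h *v q) ` unit_cell)"
    by (rule bounded_linear_image) simp
  then show ?thesis by (auto simp: bounded_pos)
qed

text \<open>Discreteness by volume: the cells attached to the points in \<open>S\<close> are
  disjoint, have volume \<open>1\<close> and lie in a ball of radius \<open>R + D\<close>, where
  \<open>D\<close> bounds the size of a cell.\<close>

lemma finite_lattice_points:
  fixes h :: "real^'k^'k"
  assumes det: "det h = 1" and "bounded S"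
  shows "finite {k \<in> int_lattice. h *v k + b \<in> S}"
proof (rule ccontr)
  assume inf: "infinite {k \<in> int_lattice. h *v k + b \<in> S}"
  obtain R where R: "\<And>x. x \<in> S \<Longrightarrow> norm x \<le> R" using \<open>bounded S\<close> by (auto simp: bounded_iff)
  obtain D where D: "\<And>q. q \<in> unit_cell \<Longrightarrow> norm (h *v q) \<le> D" using norm_unit_cell[of h] by auto
  have "emeasure (count_space int_lattice) {k \<in> int_lattice. h *v k + b \<in> S}
      = (\<integral>\<^sup>+k. indicator {k \<in> int_lattice. h *v k + b \<in> S} k \<partial>count_space int_lattice)"
    by (subst nn_integral_indicator) auto
  also have "\<dots> \<le> (\<integral>\<^sup>+z. indicator (cball (0::real^'k) (R + D)) z \<partial>lborel)"
  proof (rule lattice_sum_le[OF det, where b=b])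
    fix k q :: "real^'k" assume q: "q \<in> unit_cell"
    have "norm (h *v k + b + h *v q) \<le> R + D" if "h *v k + b \<in> S"
      using norm_triangle_ineq[of "h *v k + b" "h *v q"] R[OF that] D[OF q] by linarith
    then show "indicator {k \<in> int_lattice. h *v k + b \<in> S} k
        \<le> (indicator (cball 0 (R + D)) (h *v k + b + h *v q) :: ennreal)"
      by (auto simp: indicator_def)
  qed (auto intro!: borel_measurable_indicator borel_closed)
  also have "\<dots> < \<infinity>" using emeasure_lborel_cball_finite[of "0::real^'k" "R + D"] by simp
  finally show False using inf by (simp add: emeasure_count_space)
qed

section \<open>Measurability and invariance on the space of affine lattices\<close>

lemma continuous_on_matrix_vector:
  fixes M :: "'a::topological_space \<Rightarrow> real^'k^'l"
  assumes "continuous_on S M" "continuous_on S x"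
  shows "continuous_on S (\<lambda>p. M p *v x p)"
  unfolding matrix_vector_mult_def using assms by (intro continuous_intros) auto

lemma ASL_mult_in_ASL: "g \<in> ASL \<Longrightarrow> h \<in> ASL \<Longrightarrow> ASL_mult g h \<in> ASL"
  by (simp add: ASL_def ASL_mult_def det_mul)

lemma affine_lattice_ASL_mult: "aff_map g ` affine_lattice h = affine_lattice (ASL_mult g h)"
  by (simp add: affine_lattice_def image_image aff_map_ASL_mult)

lemma ASL_inverse:
  assumes "g \<in> ASL"
  obtains g' where "g' \<in> ASL" "\<And>x. aff_map g' (aff_map g x) = x" "\<And>x. aff_map g (aff_map g' x) = x"
proof -
  have det: "det (fst g) = 1" using assms by (simp add: ASL_def)
  then obtain B where B: "fst g ** B = mat 1" "B ** fst g = mat 1"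
    using invertible_det_nz[of "fst g"] by (auto simp: invertible_def)
  have "det B = 1" using B(2) det by (metis det_I det_mul mult.right_neutral)
  then have "(B, - (B *v snd g)) \<in> ASL" by (simp add: ASL_def)
  moreover have "aff_map (B, - (B *v snd g)) (aff_map g x) = x"
    "aff_map g (aff_map (B, - (B *v snd g)) x) = x" for x
    by (simp_all add: aff_map_def matrix_vector_right_distrib matrix_vector_mul_assoc B
        matrix_vector_mult_diff_distrib del: add_uminus_conv_diff flip: diff_conv_add_uminus)
  ultimately show ?thesis using that by blast
qed

lemma inj_aff_map: "g \<in> ASL \<Longrightarrow> inj (aff_map g)"
  by (metis ASL_inverse injI)

section \<open>Counting points through the open sets that they hit\<close>

lemma separate_finite_set:
  fixes F :: "'a::metric_space set"
  assumes "finite F"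
  shows "\<exists>r>0. \<forall>x\<in>F. \<forall>y\<in>F. x \<noteq> y \<longrightarrow> ball x r \<inter> ball y r = {}"
proof -
  \<comment> \<open>Inserting \<open>1\<close> keeps \<open>D\<close> nonempty, hence
    \<open>Min D\<close> meaningful, when \<open>F\<close> has at most one point.\<close>
  define D where "D = insert 1 ((\<lambda>(x, y). dist x y) ` {p \<in> F \<times> F. fst p \<noteq> snd p})"
  have fin: "finite D" using assms by (auto simp: D_def)
  have pos: "Min D > 0" using fin by (subst Min_gr_iff) (auto simp: D_def)
  have "ball x (Min D / 2) \<inter> ball y (Min D / 2) = {}" if "x \<in> F" "y \<in> F" "x \<noteq> y" for x y
  proof -
    have "dist x y \<in> D" using that by (force simp: D_def)
    then have "Min D \<le> dist x y" using fin by simp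
    then have "dist x z + dist y z \<ge> Min D" for z
      using dist_triangle2[of x y z] by linarith
    note tri = this
    show ?thesis
    proof (rule equals0I)
      fix z assume "z \<in> ball x (Min D / 2) \<inter> ball y (Min D / 2)"
      then show False using tri[of z] by simp
    qed
  qed
  then show ?thesis using pos by (intro exI[of _ "Min D / 2"]) auto
qed

text \<open>Topologically only the events that a lattice hits an open set are accessible. Disjoint
  sets that are hit contain distinct points, and finitely many points can be separated by disjoint
  basic sets, so the number of points is recovered from such events. With a countable basis the
  supremum is a countable one and preserves measurability.\<close>

lemma point_count_eq_SUP:
  fixes X :: "'a::metric_space set"
  assumes basis: "topological_basis \<B>"
  shows "emeasure (count_space UNIV) X =
    (SUP I\<in>{I. finite I \<and> I \<subseteq> \<B> \<and> disjoint I}. \<Sum>B\<in>I. of_bool (X \<inter> B \<noteq> {}) :: ennreal)"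
    (is "_ = ?S")
proof (rule antisym)
  have key: "of_nat (card F) \<le> ?S" if F: "finite F" "F \<subseteq> X" for F
  proof -
    obtain r where r: "r > 0" "\<And>x y. x \<in> F \<Longrightarrow> y \<in> F \<Longrightarrow> x \<noteq> y \<Longrightarrow> ball x r \<inter> ball y r = {}"
      using separate_finite_set[OF F(1)] by blast
    have "\<exists>B. B \<in> \<B> \<and> x \<in> B \<and> B \<subseteq> ball x r" for x
    proof -
      have "x \<in> ball x r" using r(1) by simp
      from topological_basisE[OF basis open_ball this] show ?thesis by blast
    qed
    then obtain b where b: "\<And>x. b x \<in> \<B>" "\<And>x. x \<in> b x" "\<And>x. b x \<subseteq> ball x r" by metis
    have dis: "b x \<inter> b y = {}" if "x \<in> F" "y \<in> F" "x \<noteq> y" for x y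
      using r(2)[OF that] b(3)[of x] b(3)[of y] by blast
    have inj: "inj_on b F" using dis b(2) by (fastforce simp: inj_on_def)
    have "of_nat (card F) = (\<Sum>B\<in>b ` F. of_bool (X \<inter> B \<noteq> {}) :: ennreal)"
    proof -
      have "of_bool (X \<inter> b x \<noteq> {}) = (1::ennreal)" if "x \<in> F" for x using that b(2) F by auto
      then show ?thesis using inj by (simp add: sum.reindex)
    qed
    also have "\<dots> \<le> ?S"
      using dis F b(1) by (intro SUP_upper) (auto simp: disjoint_def)
    finally show ?thesis .
  qed
  show "emeasure (count_space UNIV) X \<le> ?S"
  proof (cases "finite X")
    case True
    then show ?thesis using key[of X] by (simp add: emeasure_count_space)
  next
    case False
    have "of_nat n \<le> ?S" for n
    proof -
      obtain F where "F \<subseteq> X" "finite F" "card F = n" using False by (metis infinite_arbitrarily_large)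
      then show ?thesis using key by blast
    qed
    then have "?S = \<top>"
      using ennreal_Ex_less_of_nat[of ?S] by (auto simp: less_top[symmetric] not_less[symmetric])
    then show ?thesis by (simp only: top_greatest)
  qed
  show "?S \<le> emeasure (count_space UNIV) X"
  proof (rule SUP_least, clarify)
    fix I assume I: "finite I" "I \<subseteq> \<B>" "disjoint I"
    have "(\<Sum>B\<in>I. of_bool (X \<inter> B \<noteq> {})) \<le> (\<Sum>B\<in>I. emeasure (count_space UNIV) (X \<inter> B))"
    proof (rule sum_mono)
      fix B show "of_bool (X \<inter> B \<noteq> {}) \<le> emeasure (count_space UNIV) (X \<inter> B)"
      proof (cases "X \<inter> B = {}")
        case False
        then obtain x where "x \<in> X \<inter> B" by blast
        then have "emeasure (count_space UNIV) {x} \<le> emeasure (count_space UNIV) (X \<inter> B)"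
          by (intro emeasure_mono) auto
        then show ?thesis using False by simp
      qed simp
    qed
    also have "\<dots> = emeasure (count_space UNIV) (\<Union>B\<in>I. X \<inter> B)"
      using I by (intro sum_emeasure) (auto simp: disjoint_family_on_def disjoint_def)
    also have "\<dots> \<le> emeasure (count_space UNIV) X" by (intro emeasure_mono) auto
    finally show "(\<Sum>B\<in>I. of_bool (X \<inter> B \<noteq> {})) \<le> emeasure (count_space UNIV) X" .
  qed
qed

lemma nn_integral_count_space_Collect:
  "(\<integral>\<^sup>+v. indicator A (\<phi> v) \<partial>count_space L) = emeasure (count_space UNIV) {v \<in> L. \<phi> v \<in> A}"
proof -
  have "(\<integral>\<^sup>+v. indicator A (\<phi> v) \<partial>count_space L) = (\<integral>\<^sup>+v. indicator {v \<in> L. \<phi> v \<in> A} v \<partial>count_space L)"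
    by (intro nn_integral_cong) (auto simp: indicator_def)
  also have "\<dots> = emeasure (count_space L) {v \<in> L. \<phi> v \<in> A}" by (subst nn_integral_indicator) auto
  also have "\<dots> = emeasure (count_space UNIV) {v \<in> L. \<phi> v \<in> A}"
    by (cases "finite {v \<in> L. \<phi> v \<in> A}") (auto simp: emeasure_count_space)
  finally show ?thesis .
qed

section \<open>Measurability and invariance for the Haar measure\<close>

locale haar_affine_lattices =
  fixes \<nu> :: "(real^'k) set measure"
  assumes haar: "haar_probability \<nu>"
begin

lemma space_nu: "space \<nu> = affine_lattices"
  and sets_nu: "sets \<nu> = sigma_sets affine_lattices open_affine_lattices"
  using haar by (auto simp: haar_probability_def)

sublocale prob_space \<nu> using haar by (simp add: haar_probability_def)

text \<open>For each integer vector \<open>k\<close>, the group elements moving \<open>k\<close>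
  into \<open>U\<close> form an open set; the union over \<open>k\<close> is the preimage of the
  event, which is therefore open in the quotient topology. The measurability of all counts rests on
  these events.\<close>

lemma hit_open_measurable:
  assumes "open U"
  shows "{L \<in> space \<nu>. L \<inter> U \<noteq> {}} \<in> sets \<nu>"
proof -
  have "open (\<Union>k\<in>int_lattice. (\<lambda>g. aff_map g k) -` U)"
    unfolding aff_map_def using assms
    by (intro open_UN ballI open_vimage continuous_intros continuous_on_matrix_vector) auto
  then have "openin (top_of_set ASL) (ASL \<inter> (\<Union>k\<in>int_lattice. (\<lambda>g. aff_map g k) -` U))"
    by (simp add: openin_open_Int)
  also have "ASL \<inter> (\<Union>k\<in>int_lattice. (\<lambda>g. aff_map g k) -` U) =
      {g \<in> ASL. affine_lattice g \<in> {L \<in> space \<nu>. L \<inter> U \<noteq> {}}}"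
    by (auto simp: space_nu affine_lattices_def affine_lattice_def)
  finally show ?thesis
    unfolding sets_nu by (intro sigma_sets.Basic) (auto simp: open_affine_lattices_def space_nu)
qed

text \<open>Joint measurability in lattice and parameter is what Fubini will require. Second
  countability of both factors writes an open condition on \<open>(p, v)\<close> as a countable
  union of basic rectangles, so each hit event becomes a countable union of products of measurable
  sets.\<close>

lemma point_count_open_measurable:
  fixes W :: "('p::second_countable_topology \<times> (real^'k)) set"
  assumes "open W"
  shows "(\<lambda>(L, p). emeasure (count_space UNIV) {v \<in> L. (p, v) \<in> W}) \<in> borel_measurable (\<nu> \<Otimes>\<^sub>M borel)"
proof -
  obtain \<B> :: "(real^'k) set set" where \<B>: "countable \<B>" "topological_basis \<B>"
    using ex_countable_basis by blast
  obtain \<C> :: "'p set set" where \<C>: "countable \<C>" "topological_basis \<C>"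
    using ex_countable_basis by blast
  have op: "open B" if "B \<in> \<B>" for B using \<B>(2) that by (rule topological_basis_open)
  have opC: "open B" if "B \<in> \<C>" for B using \<C>(2) that by (rule topological_basis_open)
  have [measurable]: "{x \<in> space (\<nu> \<Otimes>\<^sub>M borel). {v \<in> fst x. (snd x, v) \<in> W} \<inter> B \<noteq> {}} \<in> sets (\<nu> \<Otimes>\<^sub>M borel)"
    if B: "B \<in> \<B>" for B
  proof -
    let ?R = "{(P, V). P \<in> \<C> \<and> V \<in> \<B> \<and> P \<times> V \<subseteq> W \<inter> UNIV \<times> B}"
    have "{x \<in> space (\<nu> \<Otimes>\<^sub>M borel). {v \<in> fst x. (snd x, v) \<in> W} \<inter> B \<noteq> {}} =
        (\<Union>(P, V)\<in>?R. {L \<in> space \<nu>. L \<inter> V \<noteq> {}} \<times> P)" (is "?l = ?r")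
    proof
      show "?r \<subseteq> ?l" by (auto simp: space_pair_measure) blast
      show "?l \<subseteq> ?r"
      proof
        fix x assume "x \<in> ?l"
        then obtain v where "v \<in> fst x" "v \<in> B" "(snd x, v) \<in> W" "fst x \<in> space \<nu>"
          by (auto simp: space_pair_measure)
        then obtain L p where x: "x = (L, p)" "L \<in> space \<nu>" "v \<in> L" "v \<in> B" "(p, v) \<in> W"
          by (cases x) simp
        have "open (W \<inter> UNIV \<times> B)" using assms op[OF B] by (intro open_Int open_Times) auto
        then obtain P V where PV: "open P" "open V" "p \<in> P" "v \<in> V" "P \<times> V \<subseteq> W \<inter> UNIV \<times> B"
          using x by (auto elim!: open_prod_elim[of _ "(p, v)"])
        obtain P' where P': "P' \<in> \<C>" "p \<in> P'" "P' \<subseteq> P" using topological_basisE[OF \<C>(2) PV(1,3)] by blast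
        obtain V' where V': "V' \<in> \<B>" "v \<in> V'" "V' \<subseteq> V" using topological_basisE[OF \<B>(2) PV(2,4)] by blast
        have "P' \<times> V' \<subseteq> W \<inter> UNIV \<times> B" using P'(3) V'(3) PV(5) by blast
        then have "(P', V') \<in> ?R" using P'(1) V'(1) by simp
        moreover have "x \<in> {L \<in> space \<nu>. L \<inter> V' \<noteq> {}} \<times> P'" using x P' V' by auto
        ultimately show "x \<in> ?r" by blast
      qed
    qed
    also have "\<dots> \<in> sets (\<nu> \<Otimes>\<^sub>M borel)"
    proof (rule sets.countable_UN'')
      show "countable ?R" by (rule countable_subset[OF _ countable_SIGMA[OF \<C>(1) \<B>(1)]]) auto
    qed (auto intro!: pair_measureI hit_open_measurable borel_open op opC)
    finally show ?thesis .
  qed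
  have c: "countable {I. finite I \<and> I \<subseteq> \<B> \<and> disjoint I}"
    by (rule countable_subset[OF _ countable_Collect_finite_subset[OF \<B>(1)]]) auto
  have "(\<lambda>x. emeasure (count_space UNIV) {v \<in> fst x. (snd x, v) \<in> W}) \<in> borel_measurable (\<nu> \<Otimes>\<^sub>M borel)"
    unfolding point_count_eq_SUP[OF \<B>(2)]
  proof (rule borel_measurable_SUP[OF c])
    fix I assume I: "I \<in> {I. finite I \<and> I \<subseteq> \<B> \<and> disjoint I}"
    show "(\<lambda>x. \<Sum>B\<in>I. of_bool ({v \<in> fst x. (snd x, v) \<in> W} \<inter> B \<noteq> {}) :: ennreal) \<in> borel_measurable (\<nu> \<Otimes>\<^sub>M borel)"
    proof (rule borel_measurable_sum)
      fix B assume "B \<in> I"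
      then have [measurable]: "B \<in> \<B>" using I by auto
      show "(\<lambda>x. of_bool ({v \<in> fst x. (snd x, v) \<in> W} \<inter> B \<noteq> {}) :: ennreal) \<in> borel_measurable (\<nu> \<Otimes>\<^sub>M borel)"
        by measurable
    qed
  qed
  then show ?thesis by (simp add: case_prod_unfold)
qed

lemma act_measurable:
  assumes g: "g \<in> ASL"
  shows "(\<lambda>L. aff_map g ` L) \<in> measurable \<nu> \<nu>"
proof (rule measurable_sigma_sets[OF sets_nu])
  show "open_affine_lattices \<subseteq> Pow affine_lattices" by (auto simp: open_affine_lattices_def)
  show "(\<lambda>L. aff_map g ` L) \<in> space \<nu> \<rightarrow> affine_lattices"
    by (auto simp: space_nu affine_lattices_def affine_lattice_ASL_mult ASL_mult_in_ASL[OF g])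
  fix U :: "(real^'k) set set" assume U: "U \<in> open_affine_lattices"
  have "continuous_on ASL (ASL_mult g)"
    unfolding ASL_mult_def matrix_matrix_mult_def by (intro continuous_intros continuous_on_matrix_vector)
  then have "openin (top_of_set ASL) (ASL \<inter> ASL_mult g -` {h \<in> ASL. affine_lattice h \<in> U})"
    using U ASL_mult_in_ASL[OF g]
    by (intro continuous_openin_preimage[where T=ASL]) (auto simp: open_affine_lattices_def)
  also have "ASL \<inter> ASL_mult g -` {h \<in> ASL. affine_lattice h \<in> U} =
      {h \<in> ASL. affine_lattice h \<in> (\<lambda>L. aff_map g ` L) -` U \<inter> space \<nu>}"
    by (auto simp: space_nu affine_lattices_def affine_lattice_ASL_mult ASL_mult_in_ASL[OF g])
  finally show "(\<lambda>L. aff_map g ` L) -` U \<inter> space \<nu> \<in> sets \<nu>"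
    unfolding sets_nu by (intro sigma_sets.Basic) (auto simp: open_affine_lattices_def space_nu)
qed

lemma nn_integral_act:
  assumes g: "g \<in> ASL" and f: "f \<in> borel_measurable \<nu>"
  shows "(\<integral>\<^sup>+L. f (aff_map g ` L) \<partial>\<nu>) = (\<integral>\<^sup>+L. f L \<partial>\<nu>)"
proof -
  obtain g' where g': "g' \<in> ASL" "\<And>x. aff_map g' (aff_map g x) = x" "\<And>x. aff_map g (aff_map g' x) = x"
    by (rule ASL_inverse[OF g]) (rule that)
  note m = act_measurable[OF g]
  have "distr \<nu> \<nu> (\<lambda>L. aff_map g ` L) = \<nu>"
  proof (rule measure_eqI)
    fix E assume "E \<in> sets (distr \<nu> \<nu> (\<lambda>L. aff_map g ` L))"
    then have E: "E \<in> sets \<nu>" by simp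
    \<comment> \<open>\<open>haar_probability\<close> speaks of images of events, a push-forward of
      preimages; the preimage under \<open>g\<close> is the image under its inverse
      \<open>g'\<close>.\<close>
    have "(\<lambda>L. aff_map g ` L) -` E \<inter> space \<nu> = (\<lambda>L. aff_map g' ` L) ` E"
    proof
      have "L = aff_map g' ` aff_map g ` L" for L by (simp add: image_image g')
      then show "(\<lambda>L. aff_map g ` L) -` E \<inter> space \<nu> \<subseteq> (\<lambda>L. aff_map g' ` L) ` E" by blast
      show "(\<lambda>L. aff_map g' ` L) ` E \<subseteq> (\<lambda>L. aff_map g ` L) -` E \<inter> space \<nu>"
        using measurable_space[OF act_measurable[OF g'(1)]] sets.sets_into_space[OF E]
        by (auto simp: image_image g')
    qed
    moreover have "emeasure \<nu> ((\<lambda>L. aff_map g' ` L) ` E) = emeasure \<nu> E"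
      using haar E g'(1) by (simp add: haar_probability_def)
    ultimately show "emeasure (distr \<nu> \<nu> (\<lambda>L. aff_map g ` L)) E = emeasure \<nu> E"
      by (simp add: emeasure_distr[OF m E])
  qed simp
  then have "(\<integral>\<^sup>+L. f L \<partial>\<nu>) = (\<integral>\<^sup>+L. f L \<partial>distr \<nu> \<nu> (\<lambda>L. aff_map g ` L))" by simp
  also have "\<dots> = (\<integral>\<^sup>+L. f (aff_map g ` L) \<partial>\<nu>)" by (rule nn_integral_distr[OF m]) (use f in simp)
  finally show ?thesis by simp
qed

end

section \<open>Averaging lattice-point counts\<close>

text \<open>Counting measure with values in \<open>ennreal\<close> rather than \<open>card\<close>:
  an infinite intersection counts as infinity and not as \<open>0\<close>, and limit theorems for
  nonnegative integrals apply directly.\<close>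

definition num_points :: "'a set \<Rightarrow> 'a set \<Rightarrow> ennreal"
  where "num_points L A = emeasure (count_space UNIV) (L \<inter> A)"

lemma num_points_affine_image:
  assumes "g \<in> ASL"
  shows "num_points (aff_map g ` L) A = emeasure (count_space UNIV) {v \<in> L. aff_map g v \<in> A}"
proof -
  have "aff_map g ` L \<inter> A = aff_map g ` {v \<in> L. aff_map g v \<in> A}" by auto
  moreover have "inj_on (aff_map g) {v \<in> L. aff_map g v \<in> A}"
    using inj_aff_map[OF assms] by (rule inj_on_subset) simp
  ultimately show ?thesis
    by (simp add: num_points_def emeasure_count_space finite_image_iff card_image)
qed

lemma num_points_affine_lattice:
  assumes "g \<in> ASL"
  shows "num_points (affine_lattice g) A = (\<integral>\<^sup>+k. indicator A (fst g *v k + snd g) \<partial>count_space int_lattice)"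
  using nn_integral_count_space_Collect[where A=A and \<phi>="aff_map g" and L=int_lattice] num_points_affine_image[OF assms]
  by (simp add: affine_lattice_def aff_map_def)

lemma finite_affine_lattice_Int:
  assumes "L \<in> affine_lattices" "bounded S"
  shows "finite (L \<inter> S)"
proof -
  obtain g where g: "g \<in> ASL" "L = affine_lattice g" using assms by (auto simp: affine_lattices_def)
  have "L \<inter> S = aff_map g ` {k \<in> int_lattice. fst g *v k + snd g \<in> S}"
    by (auto simp: g affine_lattice_def aff_map_def)
  moreover have "finite {k \<in> int_lattice. fst g *v k + snd g \<in> S}"
    using g assms by (intro finite_lattice_points) (auto simp: ASL_def)
  ultimately show ?thesis by simp
qed

lemma image_in_affine_lattices: "g \<in> ASL \<Longrightarrow> L \<in> affine_lattices \<Longrightarrow> aff_map g ` L \<in> affine_lattices"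
  by (auto simp: affine_lattices_def affine_lattice_ASL_mult intro!: imageI ASL_mult_in_ASL)

lemma num_points_Diff:
  assumes "finite (L \<inter> U)"
  shows "num_points L (U - U') = num_points L U - num_points L (U \<inter> U')"
proof -
  have "L \<inter> (U - U') = (L \<inter> U) - (L \<inter> (U \<inter> U'))" by auto
  moreover have "emeasure (count_space UNIV) (L \<inter> (U \<inter> U')) \<noteq> \<infinity>"
    using finite_subset[OF _ assms, of "L \<inter> (U \<inter> U')"] by (auto simp: emeasure_count_space)
  ultimately show ?thesis unfolding num_points_def by (simp only:) (rule emeasure_Diff; auto)
qed

context haar_affine_lattices
begin

text \<open>The regions to be counted are half-open, hence treated as differences of open sets. The
  counts in \<open>U\<close> and \<open>U \<inter> U'\<close> fall under the open case, and
  boundedness of \<open>U\<close> keeps them finite, so that subtraction in \<open>ennreal\<close>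
  is faithful.\<close>

lemma num_points_measurable:
  fixes \<Gamma> :: "'p::second_countable_topology \<Rightarrow> (real^'k^'k) \<times> (real^'k)"
  assumes \<Gamma>: "continuous_on UNIV \<Gamma>" "\<And>p. \<Gamma> p \<in> ASL"
    and U: "open U" "bounded U" "open U'"
  shows "(\<lambda>(L, p). num_points (aff_map (\<Gamma> p) ` L) (U - U')) \<in> borel_measurable (\<nu> \<Otimes>\<^sub>M borel)"
proof -
  have m: "(\<lambda>(L, p). num_points (aff_map (\<Gamma> p) ` L) V) \<in> borel_measurable (\<nu> \<Otimes>\<^sub>M borel)"
    if V: "open V" for V
  proof -
    let ?W = "(\<lambda>(p, v). aff_map (\<Gamma> p) v) -` V"
    have "continuous_on UNIV (\<lambda>x. aff_map (\<Gamma> (fst x)) (snd x))"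
      unfolding aff_map_def
      by (intro continuous_intros continuous_on_matrix_vector continuous_on_compose2[OF \<Gamma>(1)]) auto
    then have "open ?W" using V by (simp add: case_prod_unfold open_vimage)
    from point_count_open_measurable[OF this] show ?thesis
      by (simp add: num_points_affine_image[OF \<Gamma>(2)])
  qed
  have "(\<lambda>x. num_points (aff_map (\<Gamma> (snd x)) ` fst x) U - num_points (aff_map (\<Gamma> (snd x)) ` fst x) (U \<inter> U'))
      \<in> borel_measurable (\<nu> \<Otimes>\<^sub>M borel)"
    using m[OF U(1)] m[of "U \<inter> U'"] U by (intro borel_measurable_minus_ennreal) (auto simp: case_prod_unfold)
  then show ?thesis
    unfolding case_prod_unfold
  proof (rule measurable_cong[THEN iffD1, rotated])
    fix x assume "x \<in> space (\<nu> \<Otimes>\<^sub>M (borel :: 'p measure))"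
    then have "finite (aff_map (\<Gamma> (snd x)) ` fst x \<inter> U)"
      using U by (intro finite_affine_lattice_Int image_in_affine_lattices \<Gamma>) (auto simp: space_pair_measure space_nu)
    then show "num_points (aff_map (\<Gamma> (snd x)) ` fst x) U - num_points (aff_map (\<Gamma> (snd x)) ` fst x) (U \<inter> U')
        = num_points (aff_map (\<Gamma> (snd x)) ` fst x) (U - U')"
      by (simp add: num_points_Diff)
  qed
qed

lemma num_points_measurable1:
  assumes U: "open U" "bounded U" "open U'"
  shows "(\<lambda>L. num_points L (U - U')) \<in> borel_measurable \<nu>"
proof -
  have id: "(mat 1, 0) \<in> (ASL :: ((real^'k^'k) \<times> (real^'k)) set)" "aff_map (mat 1, 0) = (id :: real^'k \<Rightarrow> _)"
    by (auto simp: ASL_def aff_map_def)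
  \<comment> \<open>A dummy real parameter with the constant identity map reduces the claim to the
    joint statement.\<close>
  have "(\<lambda>(L, p::real). num_points (aff_map (mat 1, 0) ` L) (U - U')) \<in> borel_measurable (\<nu> \<Otimes>\<^sub>M borel)"
    by (rule num_points_measurable[OF _ _ U]) (auto simp: id)
  then have "(\<lambda>(L, p::real). num_points L (U - U')) \<in> borel_measurable (\<nu> \<Otimes>\<^sub>M borel)"
    by (simp add: id)
  then have "(\<lambda>L. (\<lambda>(L, p::real). num_points L (U - U')) (L, 0)) \<in> borel_measurable \<nu>"
    by (rule measurable_compose[rotated]) simp
  then show ?thesis by simp
qed

text \<open>By invariance the integral of \<open>f\<close> after the action of
  \<open>\<Gamma> p\<close> is the same for every \<open>p\<close>, so averaging it over \<mu>
  changes nothing; Fubini then moves the average inside, to a fixed lattice.\<close>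

lemma nn_integral_average:
  fixes \<Gamma> :: "'p::second_countable_topology \<Rightarrow> (real^'k^'k) \<times> (real^'k)" and \<mu> :: "'p measure"
  assumes \<Gamma>: "\<And>p. \<Gamma> p \<in> ASL" and \<mu>: "prob_space \<mu>" "sets \<mu> = sets borel"
    and f: "f \<in> borel_measurable \<nu>"
    and f2: "(\<lambda>(L, p). f (aff_map (\<Gamma> p) ` L)) \<in> borel_measurable (\<nu> \<Otimes>\<^sub>M borel)"
  shows "(\<integral>\<^sup>+L. f L \<partial>\<nu>) = (\<integral>\<^sup>+L. (\<integral>\<^sup>+p. f (aff_map (\<Gamma> p) ` L) \<partial>\<mu>) \<partial>\<nu>)"
    and "(\<lambda>L. \<integral>\<^sup>+p. f (aff_map (\<Gamma> p) ` L) \<partial>\<mu>) \<in> borel_measurable \<nu>"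
proof -
  interpret \<mu>: prob_space \<mu> by fact
  interpret pair_sigma_finite \<nu> \<mu> ..
  have "sets (\<nu> \<Otimes>\<^sub>M \<mu>) = sets (\<nu> \<Otimes>\<^sub>M borel)" using \<mu>(2) by (intro sets_pair_measure_cong) auto
  then have m: "(\<lambda>(L, p). f (aff_map (\<Gamma> p) ` L)) \<in> borel_measurable (\<nu> \<Otimes>\<^sub>M \<mu>)"
    using f2 by (simp cong: measurable_cong_sets)
  have "(\<integral>\<^sup>+L. f L \<partial>\<nu>) = (\<integral>\<^sup>+p. (\<integral>\<^sup>+L. f L \<partial>\<nu>) \<partial>\<mu>)" by (simp add: \<mu>.emeasure_space_1)
  also have "\<dots> = (\<integral>\<^sup>+p. (\<integral>\<^sup>+L. f (aff_map (\<Gamma> p) ` L) \<partial>\<nu>) \<partial>\<mu>)"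
    by (simp add: nn_integral_act[OF \<Gamma> f])
  also have "\<dots> = (\<integral>\<^sup>+L. (\<integral>\<^sup>+p. f (aff_map (\<Gamma> p) ` L) \<partial>\<mu>) \<partial>\<nu>)"
    by (rule Fubini') (use m in simp)
  finally show "(\<integral>\<^sup>+L. f L \<partial>\<nu>) = (\<integral>\<^sup>+L. (\<integral>\<^sup>+p. f (aff_map (\<Gamma> p) ` L) \<partial>\<mu>) \<partial>\<nu>)" .
  show "(\<lambda>L. \<integral>\<^sup>+p. f (aff_map (\<Gamma> p) ` L) \<partial>\<mu>) \<in> borel_measurable \<nu>"
    using \<mu>.borel_measurable_nn_integral[OF m] by simp
qed

text \<open>Truncation at \<open>K\<close> makes the averages uniformly bounded, so that a pointwise bound on them
  passes to the integral without any prior integrability of \<open>f\<close>.\<close>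

lemma nn_integral_le_limsup_average:
  fixes \<Gamma> :: "nat \<Rightarrow> 'p::second_countable_topology \<Rightarrow> (real^'k^'k) \<times> (real^'k)" and \<mu> :: "nat \<Rightarrow> 'p measure"
  assumes \<Gamma>: "\<And>j p. \<Gamma> j p \<in> ASL" and \<mu>: "\<And>j. prob_space (\<mu> j)" "\<And>j. sets (\<mu> j) = sets borel"
    and f: "f \<in> borel_measurable \<nu>"
    and f2: "\<And>j. (\<lambda>(L, p). f (aff_map (\<Gamma> j p) ` L)) \<in> borel_measurable (\<nu> \<Otimes>\<^sub>M borel)"
    and bound: "\<And>L. L \<in> affine_lattices \<Longrightarrow>
      limsup (\<lambda>j. \<integral>\<^sup>+p. f (aff_map (\<Gamma> j p) ` L) \<partial>\<mu> j) \<le> B"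
  shows "(\<integral>\<^sup>+L. f L \<partial>\<nu>) \<le> B"
proof -
  have trunc: "(\<integral>\<^sup>+L. min (of_nat K) (f L) \<partial>\<nu>) \<le> B" for K :: nat
  proof -
    let ?a = "\<lambda>j L. \<integral>\<^sup>+p. f (aff_map (\<Gamma> j p) ` L) \<partial>\<mu> j"
    have meas: "?a j \<in> borel_measurable \<nu>" for j
      by (rule nn_integral_average(2)[OF \<Gamma> \<mu> f f2])
    have le: "(\<integral>\<^sup>+L. min (of_nat K) (f L) \<partial>\<nu>) \<le> (\<integral>\<^sup>+L. min (of_nat K) (?a j L) \<partial>\<nu>)" for j
    proof -
      interpret \<mu>: prob_space "\<mu> j" by (rule \<mu>)
      have "(\<integral>\<^sup>+L. min (of_nat K) (f L) \<partial>\<nu>) =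
          (\<integral>\<^sup>+L. (\<integral>\<^sup>+p. min (of_nat K) (f (aff_map (\<Gamma> j p) ` L)) \<partial>\<mu> j) \<partial>\<nu>)"
        using f f2[of j] by (intro nn_integral_average(1)[OF \<Gamma> \<mu>]) (auto simp: case_prod_unfold)
      also have "\<dots> \<le> (\<integral>\<^sup>+L. min (of_nat K) (?a j L) \<partial>\<nu>)"
      proof (rule nn_integral_mono, rule min.boundedI)
        fix L
        have "(\<integral>\<^sup>+p. min (of_nat K) (f (aff_map (\<Gamma> j p) ` L)) \<partial>\<mu> j) \<le> (\<integral>\<^sup>+p. of_nat K \<partial>\<mu> j)"
          by (rule nn_integral_mono) simp
        then show "(\<integral>\<^sup>+p. min (of_nat K) (f (aff_map (\<Gamma> j p) ` L)) \<partial>\<mu> j) \<le> of_nat K"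
          by (simp add: \<mu>.emeasure_space_1)
        show "(\<integral>\<^sup>+p. min (of_nat K) (f (aff_map (\<Gamma> j p) ` L)) \<partial>\<mu> j) \<le> ?a j L"
          by (rule nn_integral_mono) simp
      qed
      finally show ?thesis .
    qed
    have "(\<integral>\<^sup>+L. min (of_nat K) (f L) \<partial>\<nu>) \<le> limsup (\<lambda>j. \<integral>\<^sup>+L. min (of_nat K) (?a j L) \<partial>\<nu>)"
      using le by (intro le_Limsup) auto
    \<comment> \<open>The reverse Fatou lemma needs an integrable majorant; on a probability space
      the truncation level is one.\<close>
    also have "\<dots> \<le> (\<integral>\<^sup>+L. limsup (\<lambda>j. min (of_nat K) (?a j L)) \<partial>\<nu>)"
      using meas by (intro nn_integral_limsup[where w="\<lambda>_. of_nat K"]) (auto simp: emeasure_space_1 of_nat_less_top)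
    also have "\<dots> \<le> (\<integral>\<^sup>+L. B \<partial>\<nu>)"
    proof (rule nn_integral_mono)
      fix L assume "L \<in> space \<nu>"
      then have "limsup (\<lambda>j. ?a j L) \<le> B" using bound by (simp add: space_nu)
      moreover have "limsup (\<lambda>j. min (of_nat K) (?a j L)) \<le> limsup (\<lambda>j. ?a j L)"
        by (intro Limsup_mono) simp
      ultimately show "limsup (\<lambda>j. min (of_nat K) (?a j L)) \<le> B" by simp
    qed
    finally show ?thesis by (simp add: emeasure_space_1)
  qed
  have "f L = (SUP K. min (of_nat K) (f L))" for L
    unfolding inf_min[symmetric] inf_commute[of _ "f L"]
    by (subst inf_SUP[symmetric]) (simp add: ennreal_SUP_of_nat_eq_top)
  then have "(\<integral>\<^sup>+L. f L \<partial>\<nu>) = (\<integral>\<^sup>+L. (SUP K. min (of_nat K) (f L)) \<partial>\<nu>)" by simp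
  also have "\<dots> = (SUP K. \<integral>\<^sup>+L. min (of_nat K) (f L) \<partial>\<nu>)"
    using f by (intro nn_integral_monotone_convergence_SUP)
      (auto simp: incseq_def le_fun_def min_le_iff_disj intro: of_nat_mono)
  also have "\<dots> \<le> B" using trunc by (rule SUP_least)
  finally show ?thesis .
qed

text \<open>In this direction Fatou's lemma for nonnegative functions applies without a majorant, so
  the averages can be used untruncated.\<close>

lemma nn_integral_ge_liminf_average:
  fixes \<Gamma> :: "nat \<Rightarrow> 'p::second_countable_topology \<Rightarrow> (real^'k^'k) \<times> (real^'k)" and \<mu> :: "nat \<Rightarrow> 'p measure"
  assumes \<Gamma>: "\<And>j p. \<Gamma> j p \<in> ASL" and \<mu>: "\<And>j. prob_space (\<mu> j)" "\<And>j. sets (\<mu> j) = sets borel"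
    and f: "f \<in> borel_measurable \<nu>"
    and f2: "\<And>j. (\<lambda>(L, p). f (aff_map (\<Gamma> j p) ` L)) \<in> borel_measurable (\<nu> \<Otimes>\<^sub>M borel)"
    and bound: "\<And>L. L \<in> affine_lattices \<Longrightarrow>
      B \<le> liminf (\<lambda>j. \<integral>\<^sup>+p. f (aff_map (\<Gamma> j p) ` L) \<partial>\<mu> j)"
  shows "B \<le> (\<integral>\<^sup>+L. f L \<partial>\<nu>)"
proof -
  let ?a = "\<lambda>j L. \<integral>\<^sup>+p. f (aff_map (\<Gamma> j p) ` L) \<partial>\<mu> j"
  have "B = (\<integral>\<^sup>+L. B \<partial>\<nu>)" by (simp add: emeasure_space_1)
  also have "\<dots> \<le> (\<integral>\<^sup>+L. liminf (\<lambda>j. ?a j L) \<partial>\<nu>)"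
    using bound by (intro nn_integral_mono) (simp add: space_nu)
  also have "\<dots> \<le> liminf (\<lambda>j. \<integral>\<^sup>+L. ?a j L \<partial>\<nu>)"
    by (intro nn_integral_liminf nn_integral_average(2)[OF \<Gamma> \<mu> f f2])
  also have "\<dots> = (\<integral>\<^sup>+L. f L \<partial>\<nu>)"
    by (simp add: nn_integral_average(1)[OF \<Gamma> \<mu> f f2, symmetric] Liminf_const)
  finally show ?thesis .
qed

end

section \<open>Averages over translations\<close>

lemma borel_measurable_nn_integral_count_space:
  fixes f :: "'i \<Rightarrow> 'a \<Rightarrow> ennreal"
  assumes "countable I" and "\<And>i. i \<in> I \<Longrightarrow> f i \<in> borel_measurable M"
  shows "(\<lambda>x. \<integral>\<^sup>+i. f i x \<partial>count_space I) \<in> borel_measurable M"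
proof -
  interpret sigma_finite_measure "count_space I"
    using assms(1) by (rule sigma_finite_measure_count_space_countable)
  have "(\<lambda>p. f (fst p) (snd p)) \<in> borel_measurable (count_space I \<Otimes>\<^sub>M M)"
    by (rule measurable_pair_measure_countable1[OF assms(1)]) (simp add: assms(2))
  then have "(\<lambda>p. f (snd p) (fst p)) \<in> borel_measurable (M \<Otimes>\<^sub>M count_space I)"
    by (subst (asm) measurable_pair_swap_iff) (simp add: case_prod_unfold)
  then show ?thesis
    by (intro borel_measurable_nn_integral) (simp add: case_prod_unfold)
qed

lemma ball_borel [measurable]:
  "ball (x::'a::metric_space) r \<in> sets borel" "cball x r \<in> sets borel"
  by (auto intro: borel_open borel_closed)

lemma ASL_translation: "(mat 1, t) \<in> ASL"
  by (simp add: ASL_def)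

lemma emeasure_cball_pos:
  "0 \<le> r \<Longrightarrow> emeasure lborel (cball (c::'a::euclidean_space) r) = ennreal (unit_ball_vol DIM('a) * r ^ DIM('a))"
  using emeasure_cball by blast

lemma ratio_tendsto_1:
  fixes a :: real
  shows "(\<lambda>j. ((real (Suc j) + a) / real (Suc j)) ^ d) \<longlonglongrightarrow> 1"
proof -
  have "(\<lambda>j. (1 + a * inverse (real (Suc j))) ^ d) \<longlonglongrightarrow> (1 + a * 0) ^ d"
    by (intro tendsto_intros LIMSEQ_inverse_real_of_nat)
  moreover have "1 + a * inverse (real (Suc j)) = (real (Suc j) + a) / real (Suc j)" for j
    by (simp add: field_simps)
  ultimately show ?thesis by simp
qed

lemma emeasure_translate:
  fixes A :: "'a::euclidean_space set"
  assumes [measurable]: "A \<in> sets borel"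
  shows "emeasure lborel {t. z + t \<in> A} = emeasure lborel A"
proof -
  have "emeasure lborel {t. z + t \<in> A} = (\<integral>\<^sup>+t. indicator {t. z + t \<in> A} t \<partial>lborel)"
    by (subst nn_integral_indicator) auto
  also have "\<dots> = (\<integral>\<^sup>+t. indicator A (z + t) \<partial>lborel)"
    by (rule nn_integral_cong) (simp add: indicator_def)
  also have "\<dots> = (\<integral>\<^sup>+t. indicator A t \<partial>lborel)"
    by (subst (2) nn_integral_lborel_affine[where c=1 and t=z]) auto
  finally show ?thesis by simp
qed

lemma emeasure_ball_finite_pos:
  assumes "r > 0"
  shows "emeasure lborel (ball (c::'a::euclidean_space) r) \<noteq> 0" "emeasure lborel (ball c r) \<noteq> \<infinity>"
proof -
  have e: "emeasure lborel (ball c r) = ennreal (unit_ball_vol DIM('a) * r ^ DIM('a))"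
    using assms by (subst emeasure_ball) auto
  have "unit_ball_vol (real DIM('a)) * r ^ DIM('a) > 0" using assms by (intro mult_pos_pos) auto
  then show "emeasure lborel (ball c r) \<noteq> 0" unfolding e by (metis ennreal_eq_0_iff not_le)
  show "emeasure lborel (ball c r) \<noteq> \<infinity>" unfolding e by simp
qed

lemma emeasure_cball_div_ball:
  assumes R: "R > 0" "R' \<ge> 0"
  shows "emeasure lborel (cball (0::'a::euclidean_space) R') / emeasure lborel (ball (0::'a) R) = ennreal ((R' / R) ^ DIM('a))"
proof -
  have "unit_ball_vol (real DIM('a)) > 0" by simp
  then have u: "unit_ball_vol (real DIM('a)) \<noteq> 0" by linarith
  have "emeasure lborel (ball (0::'a) R) = ennreal (unit_ball_vol DIM('a) * R ^ DIM('a))"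
    using R by (subst emeasure_ball) auto
  then show ?thesis
    using R u by (subst emeasure_cball_pos) (auto simp: divide_ennreal power_divide)
qed

text \<open>A lattice point well inside the ball is carried into \<open>A\<close> by a set of
  translations whose volume is that of \<open>A\<close>. The number of such points is at least the
  volume of a slightly smaller ball, and the ratio of the two ball volumes tends to
  \<open>1\<close>.\<close>

lemma (in haar_affine_lattices) expected_num_points_ge:
  assumes U: "open U" "bounded U" "open U'"
  shows "emeasure lborel (U - U') \<le> (\<integral>\<^sup>+L. num_points L (U - U') \<partial>\<nu>)"
proof -
  define A where "A = U - U'"
  have A[measurable]: "A \<in> sets borel" using U by (auto simp: A_def)
  have "bounded A" unfolding A_def by (rule bounded_subset[OF U(2)]) auto
  then obtain \<rho> where \<rho>: "\<And>x. x \<in> A \<Longrightarrow> norm x \<le> \<rho>" by (auto simp: bounded_iff)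
  have \<rho>0: "A = {} \<or> \<rho> \<ge> 0" using \<rho> norm_ge_zero order_trans by blast
  let ?d = "CARD('k)"
  let ?B = "\<lambda>j. ball (0::real^'k) (real (Suc j))"
  have avg: "(\<integral>\<^sup>+t. num_points (aff_map (mat 1, t) ` L) A \<partial>uniform_measure lborel (?B j))
      = (\<integral>\<^sup>+k. emeasure lborel {t \<in> ?B j. h *v k + b + t \<in> A} \<partial>count_space int_lattice) / emeasure lborel (?B j)"
    if L: "L = affine_lattice (h, b)" "(h, b) \<in> ASL" for L h b j
  proof -
    have N: "num_points (aff_map (mat 1, t) ` L) A = (\<integral>\<^sup>+k. indicator A (h *v k + b + t) \<partial>count_space int_lattice)" for t
      unfolding L affine_lattice_ASL_mult
      using L(2) by (subst num_points_affine_lattice) (auto simp: ASL_def ASL_mult_def add.assoc)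
    have "(\<integral>\<^sup>+t. num_points (aff_map (mat 1, t) ` L) A \<partial>uniform_measure lborel (?B j))
      = (\<integral>\<^sup>+t. (\<integral>\<^sup>+k. indicator A (h *v k + b + t) \<partial>count_space int_lattice) * indicator (?B j) t \<partial>lborel) / emeasure lborel (?B j)"
      unfolding N by (rule nn_integral_uniform_measure)
        (auto intro!: borel_measurable_nn_integral_count_space countable_int_lattice)
    also have "(\<integral>\<^sup>+t. (\<integral>\<^sup>+k. indicator A (h *v k + b + t) \<partial>count_space int_lattice) * indicator (?B j) t \<partial>lborel)
      = (\<integral>\<^sup>+t. (\<integral>\<^sup>+k. indicator A (h *v k + b + t) * indicator (?B j) t \<partial>count_space int_lattice) \<partial>lborel)"
      by (simp add: nn_integral_multc)
    also have "\<dots> = (\<integral>\<^sup>+k. (\<integral>\<^sup>+t. indicator A (h *v k + b + t) * indicator (?B j) t \<partial>lborel) \<partial>count_space int_lattice)"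
      by (rule nn_integral_count_space_nn_integral[OF countable_int_lattice]) measurable
    also have "\<dots> = (\<integral>\<^sup>+k. emeasure lborel {t \<in> ?B j. h *v k + b + t \<in> A} \<partial>count_space int_lattice)"
    proof (rule nn_integral_cong)
      fix k
      have "(\<integral>\<^sup>+t. indicator A (h *v k + b + t) * indicator (?B j) t \<partial>lborel)
        = (\<integral>\<^sup>+t. indicator {t \<in> ?B j. h *v k + b + t \<in> A} t \<partial>lborel)"
        by (rule nn_integral_cong) (auto simp: indicator_def)
      also have "\<dots> = emeasure lborel {t \<in> ?B j. h *v k + b + t \<in> A}"
        by (subst nn_integral_indicator) auto
      finally show "(\<integral>\<^sup>+t. indicator A (h *v k + b + t) * indicator (?B j) t \<partial>lborel) = \<dots>" .
    qed
    finally show ?thesis .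
  qed
  have "emeasure lborel A \<le> (\<integral>\<^sup>+L. num_points L A \<partial>\<nu>)"
  proof (rule nn_integral_ge_liminf_average[where \<Gamma>="\<lambda>_ t. (mat 1, t)" and \<mu>="\<lambda>j. uniform_measure lborel (?B j)"])
    show "prob_space (uniform_measure lborel (?B j))" for j
      by (rule prob_space_uniform_measure; rule emeasure_ball_finite_pos) simp_all
    show "(\<lambda>L. num_points L A) \<in> borel_measurable \<nu>" unfolding A_def by (rule num_points_measurable1[OF U])
    show "(\<lambda>(L, p). num_points (aff_map (mat 1, p) ` L) A) \<in> borel_measurable (\<nu> \<Otimes>\<^sub>M borel)"
      unfolding A_def by (rule num_points_measurable[OF _ _ U]) (auto simp: ASL_translation intro!: continuous_intros)
    fix L :: "(real^'k) set" assume "L \<in> affine_lattices"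
    then obtain h b where L: "L = affine_lattice (h, b)" "(h, b) \<in> ASL"
      by (auto simp: affine_lattices_def)
    then have det: "det h = 1" by (simp add: ASL_def)
    obtain D where D: "D > 0" "\<And>q. q \<in> unit_cell \<Longrightarrow> norm (h *v q) \<le> D" using norm_unit_cell[of h] by auto
    \<comment> \<open>The loss of radius has three sources: \<open>\<rho>\<close> for the extent of
      \<open>A\<close>, \<open>D\<close> for the displacement within a cell, and \<open>1\<close>
      for the strict inequality in the open ball.\<close>
    define a where "a = - \<rho> - D - 1"
    let ?a = "\<lambda>j. \<integral>\<^sup>+t. num_points (aff_map (mat 1, t) ` L) A \<partial>uniform_measure lborel (?B j)"
    have ge: "ennreal (((real (Suc j) + a) / real (Suc j)) ^ ?d) * emeasure lborel A \<le> ?a j"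
      if j: "real (Suc j) + a \<ge> 0" for j
    proof -
      have "(\<integral>\<^sup>+z. emeasure lborel A * indicator (cball (0::real^'k) (real (Suc j) + a)) z \<partial>lborel)
          \<le> (\<integral>\<^sup>+k. emeasure lborel {t \<in> ?B j. h *v k + b + t \<in> A} \<partial>count_space int_lattice)"
      proof (rule lattice_sum_ge[OF det, where b=b])
        fix k q :: "real^'k" assume q: "q \<in> unit_cell"
        show "emeasure lborel A * indicator (cball 0 (real (Suc j) + a)) (h *v k + b + h *v q)
          \<le> emeasure lborel {t \<in> ?B j. h *v k + b + t \<in> A}"
        proof (cases "norm (h *v k + b + h *v q) \<le> real (Suc j) + a")
          case True
          have "norm (h *v k + b) \<le> real (Suc j) + a + D"
            using norm_triangle_ineq4[of "h *v k + b + h *v q" "h *v q"] True D(2)[OF q] by simp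
          then have "norm t < real (Suc j)" if "h *v k + b + t \<in> A" for t
            using norm_triangle_ineq4[of "h *v k + b + t" "h *v k + b"] \<rho>[OF that] by (simp add: a_def)
          then have "{t \<in> ?B j. h *v k + b + t \<in> A} = {t. (h *v k + b) + t \<in> A}" by auto
          then show ?thesis by (simp add: emeasure_translate[OF A] indicator_def)
        qed simp
      qed (auto intro!: borel_measurable_indicator borel_closed borel_measurable_times)
      then have "emeasure lborel A * emeasure lborel (cball (0::real^'k) (real (Suc j) + a)) / emeasure lborel (?B j) \<le> ?a j"
        unfolding avg[OF L] by (intro divide_right_mono_ennreal) (simp add: nn_integral_cmult)
      also have "emeasure lborel A * emeasure lborel (cball (0::real^'k) (real (Suc j) + a)) / emeasure lborel (?B j)
        = emeasure lborel A * (emeasure lborel (cball (0::real^'k) (real (Suc j) + a)) / emeasure lborel (?B j))"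
        by (simp add: ennreal_times_divide)
      also have "emeasure lborel (cball (0::real^'k) (real (Suc j) + a)) / emeasure lborel (?B j)
        = ennreal (((real (Suc j) + a) / real (Suc j)) ^ ?d)"
        using j by (subst emeasure_cball_div_ball) simp_all
      finally show ?thesis by (simp add: mult.commute)
    qed
    have "(\<lambda>j. ennreal (((real (Suc j) + a) / real (Suc j)) ^ ?d) * emeasure lborel A)
        \<longlonglongrightarrow> ennreal 1 * emeasure lborel A"
      using emeasure_bounded_finite[OF \<open>bounded A\<close>]
      by (intro tendsto_mult_ennreal tendsto_ennrealI ratio_tendsto_1 tendsto_const) (auto simp: less_top)
    then have "emeasure lborel A = liminf (\<lambda>j. ennreal (((real (Suc j) + a) / real (Suc j)) ^ ?d) * emeasure lborel A)"
      by (simp add: lim_imp_Liminf)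
    also have "\<dots> \<le> liminf ?a"
    proof (rule Liminf_mono)
      have "eventually (\<lambda>j. real (Suc j) \<ge> - a) sequentially"
        using eventually_ge_at_top[of "nat \<lceil>- a\<rceil>"] by eventually_elim linarith
      then show "eventually (\<lambda>j. ennreal (((real (Suc j) + a) / real (Suc j)) ^ ?d) * emeasure lborel A \<le> ?a j) sequentially"
        by eventually_elim (rule ge, linarith)
    qed
    finally show "emeasure lborel A \<le> liminf ?a" .
  qed (auto simp: ASL_translation)
  then show ?thesis by (simp add: A_def)
qed

text \<open>The correlation of two indicator functions. In the second moment it is the weight that a
  difference \<open>x\<close> of two lattice points receives after integration over
  translations.\<close>

definition overlap :: "'a::euclidean_space set \<Rightarrow> 'a set \<Rightarrow> 'a \<Rightarrow> ennreal"
  where "overlap A A' x = emeasure lborel {z \<in> A. z + x \<in> A'}"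

lemma overlap_eq_nn_integral:
  assumes "A \<in> sets borel" "A' \<in> sets borel"
  shows "overlap A A' x = (\<integral>\<^sup>+z. indicator A z * indicator A' (z + x) \<partial>lborel)"
proof -
  note [measurable] = assms
  have "overlap A A' x = (\<integral>\<^sup>+z. indicator {z \<in> A. z + x \<in> A'} z \<partial>lborel)"
    unfolding overlap_def by (subst nn_integral_indicator) auto
  also have "\<dots> = (\<integral>\<^sup>+z. indicator A z * indicator A' (z + x) \<partial>lborel)"
    by (rule nn_integral_cong) (auto simp: indicator_def)
  finally show ?thesis .
qed

lemma overlap_measurable:
  assumes "A \<in> sets borel" "A' \<in> sets borel"
  shows "overlap A A' \<in> borel_measurable borel"
proof -
  note [measurable] = assms
  have "(\<lambda>x. \<integral>\<^sup>+z. indicator A z * indicator A' (z + x) \<partial>lborel) \<in> borel_measurable borel"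
    by measurable
  then show ?thesis using overlap_eq_nn_integral[OF assms] by (simp cong: measurable_cong)
qed

lemma nn_integral_overlap:
  assumes "A \<in> sets borel" "A' \<in> sets borel"
  shows "(\<integral>\<^sup>+x. overlap A A' x \<partial>lborel) = emeasure lborel A * emeasure lborel A'"
proof -
  note [measurable] = assms
  have "(\<integral>\<^sup>+x. overlap A A' x \<partial>lborel) = (\<integral>\<^sup>+x. (\<integral>\<^sup>+z. indicator A z * indicator A' (z + x) \<partial>lborel) \<partial>lborel)"
    by (simp add: overlap_eq_nn_integral[OF assms])
  also have "\<dots> = (\<integral>\<^sup>+z. (\<integral>\<^sup>+x. indicator A z * indicator A' (z + x) \<partial>lborel) \<partial>lborel)"
    by (rule lborel_pair.Fubini') measurable
  also have "\<dots> = (\<integral>\<^sup>+z. indicator A z * emeasure lborel A' \<partial>lborel)"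
  proof (rule nn_integral_cong)
    fix z
    have "(\<integral>\<^sup>+x. indicator A' (z + x) \<partial>lborel) = (\<integral>\<^sup>+x. indicator A' x \<partial>lborel)"
      by (subst (2) nn_integral_lborel_affine[where c=1 and t=z]) auto
    then show "(\<integral>\<^sup>+x. indicator A z * indicator A' (z + x) \<partial>lborel) = indicator A z * emeasure lborel A'"
      by (simp add: nn_integral_cmult)
  qed
  also have "\<dots> = emeasure lborel A * emeasure lborel A'"
    by (simp add: nn_integral_multc)
  finally show ?thesis .
qed

lemma overlap_le: "A \<in> sets borel \<Longrightarrow> overlap A A' x \<le> emeasure lborel A"
  unfolding overlap_def by (rule emeasure_mono) auto

lemma overlap_zero: "A \<in> sets borel \<Longrightarrow> overlap A A 0 = emeasure lborel A"
  unfolding overlap_def by simp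

lemma overlap_eq_0:
  assumes "\<And>z. z \<in> A \<Longrightarrow> norm z \<le> \<rho>" "norm x > 2 * \<rho>"
  shows "overlap A A x = 0"
proof -
  have False if "z \<in> A" "z + x \<in> A" for z
    using assms(1)[OF that(1)] assms(1)[OF that(2)] assms(2) norm_triangle_ineq4[of "z + x" z] by simp
  then have "{z \<in> A. z + x \<in> A} = {}" by blast
  then show ?thesis by (simp only: overlap_def) simp
qed

text \<open>A displacement of the vector is paid for by thickening the second set. This one-sided
  estimate takes the place of continuity of the overlap in \<open>x\<close>.\<close>

lemma overlap_perturb:
  assumes A: "A \<in> sets borel" and u: "norm (y - x) \<le> s"
  shows "overlap A A x \<le> overlap A {z. infdist z A \<le> s} y"
  unfolding overlap_def
proof (rule emeasure_mono)
  have [measurable]: "A \<in> sets borel" "{z. infdist z A \<le> s} \<in> sets borel"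
    using A by (auto intro!: borel_closed closed_Collect_le continuous_intros)
  show "{z \<in> A. z + y \<in> {z. infdist z A \<le> s}} \<in> sets lborel" by measurable
  show "{z \<in> A. z + x \<in> A} \<subseteq> {z \<in> A. z + y \<in> {z. infdist z A \<le> s}}"
  proof clarify
    fix z assume "z \<in> A" "z + x \<in> A"
    then have "infdist (z + y) A \<le> dist (z + y) (z + x)" by (intro infdist_le)
    then show "infdist (z + y) A \<le> s" using u by (simp add: dist_norm)
  qed
qed

text \<open>The inner sum runs over differences \<open>h k\<close> of lattice points; the first factor counts the
  lattice points that a translate from the ball can move into \<open>A\<close>.\<close>

lemma translation_average_square_le:
  fixes h G :: "real^'k^'k"
  assumes hb: "(h, b) \<in> ASL" and G: "det G = 1" and A: "A \<in> sets borel"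
    and D: "\<And>q. q \<in> unit_cell \<Longrightarrow> norm (h *v q) \<le> D"
    and \<rho>: "\<And>x. G *v x \<in> A \<Longrightarrow> norm x \<le> \<rho>"
  shows "(\<integral>\<^sup>+t. (num_points (aff_map (G, G *v t) ` affine_lattice (h, b)) A)\<^sup>2 * indicator (ball 0 R) t \<partial>lborel)
    \<le> emeasure lborel (cball (0::real^'k) (R + \<rho> + D)) *
      (\<integral>\<^sup>+k. overlap A A (G *v (h *v k)) \<partial>count_space int_lattice)"
proof -
  note [measurable] = A
  let ?Z = "int_lattice :: (real^'k) set"
  let ?P = "\<lambda>k t. G *v (h *v k + b + t)"
  have det: "det h = 1" using hb by (simp add: ASL_def)
  have GASL: "(G, G *v t) \<in> ASL" for t using G by (simp add: ASL_def)
  have N: "num_points (aff_map (G, G *v t) ` affine_lattice (h, b)) A =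
      (\<integral>\<^sup>+k. indicator A (?P k t) \<partial>count_space ?Z)" for t
    unfolding affine_lattice_ASL_mult
    by (subst num_points_affine_lattice)
      (auto simp: ASL_def det G det_mul ASL_mult_def add.assoc matrix_vector_right_distrib matrix_vector_mul_assoc)
  \<comment> \<open>In the double sum for the square the second index is replaced by the difference
    \<open>l\<close> of the two, so that integrating over \<open>t\<close> will leave a quantity
    depending on \<open>l\<close> alone.\<close>
  have sq: "(\<integral>\<^sup>+k. indicator A (?P k t) \<partial>count_space ?Z)\<^sup>2 =
      (\<integral>\<^sup>+k. (\<integral>\<^sup>+l. indicator A (?P k t) * indicator A (?P k t + G *v (h *v l)) \<partial>count_space ?Z) \<partial>count_space ?Z)" for t
  proof -
    have "(\<integral>\<^sup>+l. indicator A (?P k t + G *v (h *v l)) \<partial>count_space ?Z) = (\<integral>\<^sup>+l. indicator A (?P l t) \<partial>count_space ?Z)"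
      if k: "k \<in> ?Z" for k
    proof -
      have "bij_betw (\<lambda>l. k + l) ?Z ?Z"
        by (rule bij_betw_byWitness[where f'="\<lambda>l. l - k"]) (use k in \<open>auto simp: int_lattice_def\<close>)
      then have "(\<integral>\<^sup>+l. indicator A (?P (k + l) t) \<partial>count_space ?Z) = (\<integral>\<^sup>+l. indicator A (?P l t) \<partial>count_space ?Z)"
        by (rule nn_integral_bij_count_space)
      then show ?thesis by (simp add: matrix_vector_right_distrib ac_simps)
    qed
    then have "(\<integral>\<^sup>+k. (\<integral>\<^sup>+l. indicator A (?P k t) * indicator A (?P k t + G *v (h *v l)) \<partial>count_space ?Z) \<partial>count_space ?Z)
       = (\<integral>\<^sup>+k. indicator A (?P k t) * (\<integral>\<^sup>+l. indicator A (?P l t) \<partial>count_space ?Z) \<partial>count_space ?Z)"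
      by (intro nn_integral_cong) (simp add: nn_integral_cmult)
    then show ?thesis by (simp add: nn_integral_multc power2_eq_square)
  qed
  have "(\<integral>\<^sup>+t. (num_points (aff_map (G, G *v t) ` affine_lattice (h, b)) A)\<^sup>2 * indicator (ball 0 R) t \<partial>lborel)
    = (\<integral>\<^sup>+t. (\<integral>\<^sup>+k. (\<integral>\<^sup>+l. indicator A (?P k t) * indicator A (?P k t + G *v (h *v l)) * indicator (ball 0 R) t
        \<partial>count_space ?Z) \<partial>count_space ?Z) \<partial>lborel)"
    unfolding N sq by (simp add: nn_integral_multc)
  also have "\<dots> = (\<integral>\<^sup>+k. (\<integral>\<^sup>+t. (\<integral>\<^sup>+l. indicator A (?P k t) * indicator A (?P k t + G *v (h *v l)) * indicator (ball 0 R) t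
        \<partial>count_space ?Z) \<partial>lborel) \<partial>count_space ?Z)"
    by (rule nn_integral_count_space_nn_integral[OF countable_int_lattice])
      (auto intro!: borel_measurable_nn_integral_count_space countable_int_lattice)
  also have "\<dots> = (\<integral>\<^sup>+k. (\<integral>\<^sup>+l. (\<integral>\<^sup>+t. indicator A (?P k t) * indicator A (?P k t + G *v (h *v l)) * indicator (ball 0 R) t
        \<partial>lborel) \<partial>count_space ?Z) \<partial>count_space ?Z)"
    by (intro nn_integral_cong nn_integral_count_space_nn_integral countable_int_lattice) measurable
  also have "\<dots> \<le> (\<integral>\<^sup>+k. (\<integral>\<^sup>+l. indicator (cball 0 (R + \<rho>)) (h *v k + b) * overlap A A (G *v (h *v l))
        \<partial>count_space ?Z) \<partial>count_space ?Z)"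
  proof (intro nn_integral_mono)
    fix k l :: "real^'k"
    let ?c = "h *v k + b" and ?w = "G *v (h *v l)"
    have "(\<integral>\<^sup>+t. indicator A (?P k t) * indicator A (?P k t + ?w) * indicator (ball 0 R) t \<partial>lborel)
      \<le> (\<integral>\<^sup>+t. indicator (cball 0 (R + \<rho>)) ?c * (indicator A (?P k t) * indicator A (?P k t + ?w)) \<partial>lborel)"
    proof (rule nn_integral_mono)
      fix t
      have "norm ?c \<le> R + \<rho>" if "?P k t \<in> A" "norm t < R"
        using norm_triangle_ineq4[of "?c + t" t] \<rho>[OF that(1)] that(2) by simp
      then show "indicator A (?P k t) * indicator A (?P k t + ?w) * indicator (ball 0 R) t
        \<le> (indicator (cball 0 (R + \<rho>)) ?c * (indicator A (?P k t) * indicator A (?P k t + ?w)) :: ennreal)"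
        by (auto simp: indicator_def)
    qed
    also have "\<dots> = indicator (cball 0 (R + \<rho>)) ?c * (\<integral>\<^sup>+t. indicator A (?P k t) * indicator A (?P k t + ?w) \<partial>lborel)"
      by (rule nn_integral_cmult) measurable
    \<comment> \<open>The cut-off by the ball has become a condition on \<open>k\<close>, so
      \<open>t\<close> ranges over the whole space; substituting \<open>h *v k + b\<close> away and
      then the volume-preserving \<open>G\<close> removes \<open>k\<close> from the
      integral.\<close>
    also have "(\<integral>\<^sup>+t. indicator A (?P k t) * indicator A (?P k t + ?w) \<partial>lborel)
        = (\<integral>\<^sup>+t. indicator A (G *v t) * indicator A (G *v t + ?w) \<partial>lborel)"
      by (subst (2) nn_integral_lborel_affine[where c=1 and t="?c"]) auto
    also have "\<dots> = overlap A A ?w"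
      unfolding overlap_eq_nn_integral[OF A A]
      by (subst (2) nn_integral_lborel_matrix[of G]) (auto simp: G)
    finally show "(\<integral>\<^sup>+t. indicator A (?P k t) * indicator A (?P k t + ?w) * indicator (ball 0 R) t \<partial>lborel)
      \<le> indicator (cball 0 (R + \<rho>)) ?c * overlap A A ?w" .
  qed
  also have "\<dots> = (\<integral>\<^sup>+k. indicator (cball 0 (R + \<rho>)) (h *v k + b) \<partial>count_space ?Z) *
      (\<integral>\<^sup>+l. overlap A A (G *v (h *v l)) \<partial>count_space ?Z)"
    by (simp add: nn_integral_cmult nn_integral_multc)
  also have "(\<integral>\<^sup>+k. indicator (cball 0 (R + \<rho>)) (h *v k + b) \<partial>count_space ?Z)
      \<le> (\<integral>\<^sup>+z. indicator (cball (0::real^'k) (R + \<rho> + D)) z \<partial>lborel)"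
  proof (rule lattice_sum_le[OF det, where b=b])
    fix k q :: "real^'k" assume q: "q \<in> unit_cell"
    have "norm (h *v k + b + h *v q) \<le> R + \<rho> + D" if "norm (h *v k + b) \<le> R + \<rho>"
      using norm_triangle_ineq[of "h *v k + b" "h *v q"] that D[OF q] by linarith
    then show "indicator (cball 0 (R + \<rho>)) (h *v k + b)
        \<le> (indicator (cball 0 (R + \<rho> + D)) (h *v k + b + h *v q) :: ennreal)"
      by (auto simp: indicator_def)
  qed (auto intro!: borel_measurable_indicator borel_closed)
  finally show ?thesis by (simp add: mult_right_mono)
qed

section \<open>Averages over expanding shears\<close>

text \<open>A genuine shear only when \<open>\<sigma> $ m = 1\<close>; in general the determinant is
  \<open>\<sigma> $ m\<close>. Leaving this entry free gives as many parameters as coordinates,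
  which is what allows a displacement of a vector to be undone by changing \<sigma>.\<close>

definition col_shear :: "'k \<Rightarrow> real^'k \<Rightarrow> real^'k^'k"
  where "col_shear m \<sigma> = (\<chi> i j. if j = m then \<sigma> $ i else mat 1 $ i $ j)"

text \<open>For \<epsilon> below 1 this contracts the coordinate that drives the shear and expands
  exactly the coordinates along which the shear spreads vectors; the power balances the determinant
  to \<open>1\<close>.\<close>

definition expand :: "'k::finite \<Rightarrow> real \<Rightarrow> real^'k^'k"
  where "expand m \<epsilon> = (\<chi> i j. if i = j then (if i = m then \<epsilon> ^ (CARD('k) - 1) else 1 / \<epsilon>) else 0)"

text \<open>Turns a parameter into a genuine shear while \<sigma> itself still ranges over the full
  space, so that Lebesgue measure on \<open>real^'k\<close> serves both kinds of average.\<close>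

definition set_one :: "'k \<Rightarrow> real^'k \<Rightarrow> real^'k"
  where "set_one m \<sigma> = (\<chi> i. if i = m then 1 else \<sigma> $ i)"

text \<open>\<open>\<theta>\<close> is the width granted to the auxiliary entry \<open>m\<close>,
  which starts at \<open>1\<close> so that a small \<theta> means almost genuine shears;
  \<open>r\<close> is the margin by which the box grows under the substitution in \<sigma>.\<close>

definition shear_box :: "'k \<Rightarrow> real \<Rightarrow> real \<Rightarrow> (real^'k) set"
  where "shear_box m \<theta> r = cbox (\<chi> i. if i = m then 1 - r else - 1 - r) (\<chi> i. if i = m then 1 + \<theta> + r else 1 + r)"

lemma det_col_shear: "det (col_shear m \<sigma> :: real^'k^'k) = \<sigma> $ m"
  using cramer_lemma[of m "mat 1 :: real^'k^'k" \<sigma>]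
  unfolding col_shear_def matrix_vector_mul_lid det_I by simp

lemma det_expand:
  assumes "\<epsilon> > 0"
  shows "det (expand m \<epsilon> :: real^'k^'k) = 1"
proof -
  have "det (expand m \<epsilon> :: real^'k^'k) = (\<Prod>i\<in>UNIV. if i = m then \<epsilon> ^ (CARD('k) - 1) else 1 / \<epsilon>)"
    by (subst det_diagonal) (auto simp: expand_def intro!: prod.cong)
  also have "\<dots> = \<epsilon> ^ (CARD('k) - 1) * (1 / \<epsilon>) ^ (CARD('k) - 1)"
    by (subst prod.remove[of _ m]) (auto simp: card_Diff_singleton)
  also have "\<dots> = 1" using assms by (simp add: power_divide)
  finally show ?thesis .
qed

lemma col_shear_nth: "(col_shear m \<sigma> *v p) $ i = (if i = m then \<sigma> $ m * p $ m else p $ i + \<sigma> $ i * p $ m)"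
proof -
  have "(col_shear m \<sigma> *v p) $ i = (\<Sum>j\<in>UNIV. (if j = m then \<sigma> $ i * p $ m else 0) + (if j = i \<and> i \<noteq> m then p $ i else 0))"
    unfolding matrix_vector_mult_def col_shear_def mat_def
    by (auto intro!: sum.cong)
  also have "\<dots> = \<sigma> $ i * p $ m + (if i \<noteq> m then p $ i else 0)"
    by (cases "i = m") (auto simp: sum.distrib)
  finally show ?thesis by auto
qed

lemma expand_nth: "(expand m \<epsilon> *v (p :: real^'k)) $ i = (if i = m then \<epsilon> ^ (CARD('k) - 1) * p $ i else p $ i / \<epsilon>)"
proof -
  have "(expand m \<epsilon> *v p) $ i = (\<Sum>j\<in>UNIV. if j = i then (if i = m then \<epsilon> ^ (CARD('k) - 1) * p $ i else p $ i / \<epsilon>) else 0)"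
    unfolding matrix_vector_mult_def expand_def vec_lambda_beta by (rule sum.cong) auto
  then show ?thesis by simp
qed

lemma det_set_one: "det (col_shear m (set_one m \<sigma>) :: real^'k^'k) = 1"
  by (simp add: det_col_shear set_one_def)

lemma continuous_on_col_shear [continuous_intros]:
  fixes f :: "'a::topological_space \<Rightarrow> real^'k"
  assumes "continuous_on S f" shows "continuous_on S (\<lambda>x. col_shear m (f x))"
  unfolding col_shear_def
proof (intro continuous_on_vec_lambda)
  fix i j :: 'k
  show "continuous_on S (\<lambda>x. if j = m then f x $ i else mat 1 $ i $ j)"
    using assms by (cases "j = m") (auto intro!: continuous_intros)
qed

lemma continuous_on_set_one [continuous_intros]:
  fixes f :: "'a::topological_space \<Rightarrow> real^'k"
  assumes "continuous_on S f" shows "continuous_on S (\<lambda>x. set_one m (f x))"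
  unfolding set_one_def
proof (intro continuous_on_vec_lambda)
  fix i :: 'k
  show "continuous_on S (\<lambda>x. if i = m then 1 else f x $ i)"
    using assms by (cases "i = m") (auto intro!: continuous_intros)
qed

lemma overlap_shear_measurable:
  fixes A A' :: "(real^'k) set"
  assumes A: "A \<in> sets borel" "A' \<in> sets borel"
  shows "(\<lambda>\<sigma>. overlap A A' (M *v (col_shear m (set_one m \<sigma>) *v p))) \<in> borel_measurable borel"
    and "(\<lambda>x. overlap A A' (M *v (col_shear m (fst x) *v snd x))) \<in> borel_measurable borel"
    and "(\<lambda>\<sigma>. overlap A A' (M *v (col_shear m \<sigma> *v p))) \<in> borel_measurable borel"
  by (rule measurable_compose[OF _ overlap_measurable[OF A]],
      intro borel_measurable_continuous_onI continuous_on_matrix_vector continuous_intros)+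

lemma shear_box_borel [measurable]: "shear_box m \<theta> r \<in> sets borel"
  by (simp add: shear_box_def)

lemma mem_shear_box:
  "\<sigma> \<in> shear_box m \<theta> r \<longleftrightarrow> 1 - r \<le> \<sigma> $ m \<and> \<sigma> $ m \<le> 1 + \<theta> + r \<and> (\<forall>i. i \<noteq> m \<longrightarrow> \<bar>\<sigma> $ i\<bar> \<le> 1 + r)"
  by (auto simp: shear_box_def mem_box_cart abs_le_iff split: if_splits) (metis add.commute minus_le_iff minus_diff_eq diff_minus_eq_add uminus_add_conv_diff)+

text \<open>For some coordinate \<open>i\<close> other than \<open>m\<close>, the value
  \<open>p $ i + \<sigma> $ i * p $ m\<close> vanishes for almost no \<sigma>. The expansion drives
  this coordinate past \<open>2 * \<rho>\<close>, where the overlap is zero, and dominated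
  convergence finishes. A second coordinate exists because the dimension is at least 2.\<close>

lemma shear_overlap_tendsto_0:
  fixes A :: "(real^'k) set"
  assumes A: "A \<in> sets borel" and \<rho>: "\<And>z. z \<in> A \<Longrightarrow> norm z \<le> \<rho>" and fin: "emeasure lborel A < \<infinity>"
    and p: "p \<noteq> 0" and card: "CARD('k) \<ge> 2"
  shows "(\<lambda>j. \<integral>\<^sup>+\<sigma>. indicator (shear_box m \<theta> r) \<sigma> *
      overlap A A (expand m (inverse (real (Suc j))) *v (col_shear m (set_one m \<sigma>) *v p)) \<partial>lborel) \<longlonglongrightarrow> 0"
proof -
  have "\<exists>i. i \<noteq> m \<and> (p $ m \<noteq> 0 \<or> p $ i \<noteq> 0)"
  proof (cases "p $ m = 0")
    case True
    then show ?thesis using p by (auto simp: vec_eq_iff)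
  next
    case False
    have "\<not> (UNIV :: 'k set) \<subseteq> {m}" using card card_mono[of "{m}" "UNIV :: 'k set"] by auto
    then show ?thesis using False by blast
  qed
  then obtain i where i: "i \<noteq> m" "p $ m \<noteq> 0 \<or> p $ i \<noteq> 0" by blast
  have AE: "AE \<sigma> in lborel. p $ i + \<sigma> $ i * p $ m \<noteq> 0"
  proof (cases "p $ m = 0")
    case False
    have "{\<sigma>::real^'k. \<sigma> $ i = - p $ i / p $ m} \<in> null_sets lborel"
    proof -
      have "negligible {\<sigma>::real^'k. \<sigma> $ i = - p $ i / p $ m}" using negligible_standard_hyperplane[of "axis i 1 :: real^'k" "- p $ i / p $ m"]
        by (simp add: cart_eq_inner_axis)
      moreover have "{\<sigma>::real^'k. \<sigma> $ i = - p $ i / p $ m} \<in> sets borel"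
        by (intro borel_closed closed_Collect_eq continuous_intros)
      ultimately show ?thesis by (simp add: negligible_iff_null_sets null_sets_completion_iff)
    qed
    then show ?thesis
    proof (rule AE_I')
      show "{\<sigma> \<in> space lborel. \<not> p $ i + \<sigma> $ i * p $ m \<noteq> 0} \<subseteq> {\<sigma>. \<sigma> $ i = - p $ i / p $ m}"
        using False by (auto simp: field_simps)
    qed
  qed (use i in auto)
  let ?u = "\<lambda>j \<sigma>. indicator (shear_box m \<theta> r) \<sigma> *
      overlap A A (expand m (inverse (real (Suc j))) *v (col_shear m (set_one m \<sigma>) *v p))"
  have "(\<lambda>j. \<integral>\<^sup>+\<sigma>. ?u j \<sigma> \<partial>lborel) \<longlonglongrightarrow> (\<integral>\<^sup>+\<sigma>. 0 \<partial>(lborel :: (real^'k) measure))"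
  proof (rule nn_integral_dominated_convergence[where w="\<lambda>\<sigma>. indicator (shear_box m \<theta> r) \<sigma> * emeasure lborel A"])
    show "?u j \<in> borel_measurable lborel" for j
      using overlap_shear_measurable(1)[OF A A] by (auto intro!: borel_measurable_times_ennreal)
    show "AE \<sigma> in lborel. ?u j \<sigma> \<le> indicator (shear_box m \<theta> r) \<sigma> * emeasure lborel A" for j
      by (intro AE_I2 mult_left_mono overlap_le A) auto
    have "emeasure lborel (shear_box m \<theta> r :: (real^'k) set) < \<infinity>"
      unfolding shear_box_def by (rule emeasure_lborel_cbox_finite)
    then show "(\<integral>\<^sup>+\<sigma>. indicator (shear_box m \<theta> r) \<sigma> * emeasure lborel A \<partial>(lborel :: (real^'k) measure)) < \<infinity>"
      using fin by (simp add: nn_integral_multc ennreal_mult_less_top)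
    show "AE \<sigma> in lborel. (\<lambda>j. ?u j \<sigma>) \<longlonglongrightarrow> 0"
      using AE
    proof eventually_elim
      case (elim \<sigma>)
      define a where "a = \<bar>p $ i + \<sigma> $ i * p $ m\<bar>"
      have a: "a > 0" using elim by (simp add: a_def)
      have "eventually (\<lambda>j. ?u j \<sigma> = 0) sequentially"
        using eventually_ge_at_top[of "nat \<lceil>2 * \<rho> / a\<rceil>"]
      proof eventually_elim
        case (elim j)
        then have "2 * \<rho> / a < real (Suc j)" by linarith
        then have "2 * \<rho> < a * real (Suc j)" using a by (simp add: field_simps)
        also have "a * real (Suc j) = \<bar>(expand m (inverse (real (Suc j))) *v (col_shear m (set_one m \<sigma>) *v p)) $ i\<bar>"
          using i(1) by (simp add: expand_nth col_shear_nth set_one_def a_def abs_mult divide_inverse)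
        also have "\<dots> \<le> norm (expand m (inverse (real (Suc j))) *v (col_shear m (set_one m \<sigma>) *v p))"
          by (rule component_le_norm_cart)
        finally show ?case using overlap_eq_0[OF \<rho>, of A] by simp
      qed
      then show ?case by (rule tendsto_eventually)
    qed
  qed auto
  then show ?thesis by simp
qed

text \<open>Moving \<open>p\<close> by \<open>q\<close> is absorbed by an affine substitution in the shear parameter \<open>\<sigma>\<close>, at the cost
  of a slightly larger box; the extra parameter \<open>\<sigma> $ m\<close>, absent on the left-hand side, is absorbed
  by thickening \<open>A\<close>.\<close>

lemma shear_average_le:
  fixes A :: "(real^'k) set" and p q :: "real^'k"
  assumes A: "A \<in> sets borel" and \<rho>: "\<And>z. z \<in> A \<Longrightarrow> norm z \<le> \<rho>" "\<rho> \<ge> 0"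
    and \<theta>: "0 < \<theta>" "\<theta> \<le> 1" and r: "0 < r" "r \<le> 1/2" and \<epsilon>: "0 < \<epsilon>" "\<epsilon> \<le> 1"
    and q: "norm q \<le> D" "D > 0" and p: "norm p \<ge> real CARD('k) * (2 * \<rho> + (D + 3 * D / r))"
  shows "(\<integral>\<^sup>+\<sigma>. indicator (shear_box m \<theta> 0) \<sigma> * overlap A A (expand m \<epsilon> *v (col_shear m (set_one m \<sigma>) *v p)) \<partial>lborel)
    \<le> ennreal ((1 + r) ^ CARD('k)) * (\<integral>\<^sup>+\<sigma>. indicator (shear_box m \<theta> r) \<sigma> *
        overlap A {z. infdist z A \<le> \<theta> * (2 * \<rho>)} (expand m \<epsilon> *v (col_shear m \<sigma> *v (p + q))) \<partial>lborel)"
    (is "?lhs \<le> _")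
proof -
  let ?E = "expand m \<epsilon> :: real^'k^'k" and ?A' = "{z. infdist z A \<le> \<theta> * (2 * \<rho>)}"
  \<comment> \<open>The first \<open>D\<close> absorbs \<open>q $ m\<close>. The rest ensures that
    the substitution moves each parameter by at most \<open>r\<close>: the displacement to be
    divided by \<open>p $ m + q $ m\<close> is at most \<open>3 * D\<close>, namely
    \<open>2 * D\<close> from \<open>q $ m * \<sigma> $ i\<close> and \<open>D\<close> from
    \<open>q $ i\<close>.\<close>
  let ?Y = "D + 3 * D / r"
  have A': "?A' \<in> sets borel" by (auto intro!: borel_closed closed_Collect_le continuous_intros)
  \<comment> \<open>As \<open>\<epsilon> \<le> 1\<close>, a bounded image bounds
    \<open>p $ i + \<sigma> $ i * p $ m\<close>, and
    \<open>\<bar>\<sigma> $ i\<bar> \<le> 1\<close>; hence every coordinate of \<open>p\<close> is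
    controlled by \<open>p $ m\<close>. A distant \<open>p\<close> that still contributes must have
    a large coordinate \<open>m\<close>.\<close>
  have large: "\<bar>p $ m\<bar> \<ge> ?Y" if \<sigma>: "\<sigma> \<in> shear_box m \<theta> 0"
    and n: "norm (?E *v (col_shear m (set_one m \<sigma>) *v p)) \<le> 2 * \<rho>" for \<sigma>
  proof -
    have "\<bar>p $ i\<bar> \<le> 2 * \<rho> + \<bar>p $ m\<bar>" for i
    proof (cases "i = m")
      case False
      have "\<bar>(p $ i + \<sigma> $ i * p $ m) / \<epsilon>\<bar> \<le> 2 * \<rho>"
        using order_trans[OF component_le_norm_cart n, of i] False
        by (simp add: expand_nth col_shear_nth set_one_def)
      then have "\<bar>p $ i + \<sigma> $ i * p $ m\<bar> \<le> 2 * \<rho> * \<epsilon>" using \<epsilon> by (simp add: field_simps)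
      also have "\<dots> \<le> 2 * \<rho>" using \<epsilon> \<rho>(2) by (simp add: mult_left_le)
      finally have 1: "\<bar>p $ i + \<sigma> $ i * p $ m\<bar> \<le> 2 * \<rho>" .
      have "\<bar>\<sigma> $ i * p $ m\<bar> \<le> 1 * \<bar>p $ m\<bar>"
        unfolding abs_mult using \<sigma> False by (intro mult_right_mono) (auto simp: mem_shear_box)
      then show ?thesis using 1 by linarith
    qed (use \<rho>(2) in simp)
    then have "norm p \<le> (\<Sum>i\<in>(UNIV::'k set). 2 * \<rho> + \<bar>p $ m\<bar>)"
      by (intro order_trans[OF norm_le_l1_cart] sum_mono)
    then have "norm p \<le> real CARD('k) * (2 * \<rho> + \<bar>p $ m\<bar>)" by simp
    with p have "real CARD('k) * (2 * \<rho> + ?Y) \<le> real CARD('k) * (2 * \<rho> + \<bar>p $ m\<bar>)" by (rule order_trans)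
    then have "2 * \<rho> + ?Y \<le> 2 * \<rho> + \<bar>p $ m\<bar>" by (rule mult_left_le_imp_le) simp
    then show ?thesis by simp
  qed
  show ?thesis
  proof (cases "\<bar>p $ m\<bar> \<ge> ?Y")
    case False
    then have z: "indicator (shear_box m \<theta> 0) \<sigma> * overlap A A (?E *v (col_shear m (set_one m \<sigma>) *v p)) = 0" for \<sigma>
      using overlap_eq_0[OF \<rho>(1), of A "?E *v (col_shear m (set_one m \<sigma>) *v p)"] large[of \<sigma>]
      by (cases "norm (?E *v (col_shear m (set_one m \<sigma>) *v p)) \<le> 2 * \<rho>") (auto simp: indicator_def)
    show ?thesis unfolding z by simp
  next
    case True
    have qi: "\<bar>q $ i\<bar> \<le> D" for i using order_trans[OF component_le_norm_cart q(1)] .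
    have Dr: "3 * D / r > 0" using r q by simp
    have po: "\<bar>p $ m\<bar> > 0" using True q Dr by linarith
    have poq: "\<bar>p $ m + q $ m\<bar> \<ge> 3 * D / r" using True qi[of m] by linarith
    \<comment> \<open>The pair \<open>c\<close>, \<open>t\<close> solves \<open>col_shear m (t + c
      *\<^sub>R \<sigma>') *v p = col_shear m \<sigma>' *v (p + q)\<close>: coordinate
      \<open>m\<close> forces the scaling, the other coordinates the shift.\<close>
    define c where "c = (p $ m + q $ m) / p $ m"
    define t where "t = (\<chi> i. if i = m then 0 else q $ i / p $ m)"
    have c: "c \<noteq> 0" using po poq Dr by (auto simp: c_def)
    have cle: "\<bar>c\<bar> \<le> 1 + r"
    proof -
      have "3 * D / r \<le> \<bar>p $ m\<bar>" using True q by linarith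
      then have "D \<le> r * \<bar>p $ m\<bar>" using r q(2) by (simp add: field_simps)
      then have "\<bar>q $ m\<bar> \<le> r * \<bar>p $ m\<bar>" using qi[of m] by linarith
      then have "\<bar>p $ m + q $ m\<bar> \<le> (1 + r) * \<bar>p $ m\<bar>" using abs_triangle_ineq[of "p $ m" "q $ m"] by (simp add: algebra_simps)
      then show ?thesis using po by (simp add: c_def abs_divide field_simps)
    qed
    let ?f = "\<lambda>\<sigma>. indicator (shear_box m \<theta> 0) \<sigma> * overlap A ?A' (?E *v (col_shear m \<sigma> *v p))"
    have "?lhs \<le> (\<integral>\<^sup>+\<sigma>. ?f \<sigma> \<partial>lborel)"
    proof (rule nn_integral_mono)
      fix \<sigma> :: "real^'k"
      let ?x = "?E *v (col_shear m (set_one m \<sigma>) *v p)" and ?y = "?E *v (col_shear m \<sigma> *v p)"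
      show "indicator (shear_box m \<theta> 0) \<sigma> * overlap A A ?x \<le> ?f \<sigma>"
      proof (cases "\<sigma> \<in> shear_box m \<theta> 0 \<and> norm ?x \<le> 2 * \<rho>")
        case in_box: True
        \<comment> \<open>Freeing the entry \<open>m\<close> changes only coordinate
          \<open>m\<close>, by the factor \<open>\<sigma> $ m\<close>. That coordinate is at most
          \<open>2 * \<rho>\<close> and the factor is within \<theta> of \<open>1\<close>, which is
          the origin of the thickening radius.\<close>
        have "?y - ?x = axis m (?x $ m * (\<sigma> $ m - 1))"
          by (auto simp: vec_eq_iff expand_nth col_shear_nth set_one_def axis_def algebra_simps)
        then have "norm (?y - ?x) = \<bar>?x $ m\<bar> * \<bar>\<sigma> $ m - 1\<bar>" by (simp add: norm_eq_sqrt_inner inner_axis_axis abs_mult flip: power2_eq_square)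
        also have "\<dots> \<le> (2 * \<rho>) * \<theta>"
          using in_box order_trans[OF component_le_norm_cart, of ?x "2 * \<rho>" m]
          by (intro mult_mono) (auto simp: mem_shear_box)
        finally have "norm (?y - ?x) \<le> \<theta> * (2 * \<rho>)" by (simp add: mult.commute)
        then show ?thesis using in_box overlap_perturb[OF A] by (simp add: indicator_def)
      next
        case False
        then show ?thesis using overlap_eq_0[OF \<rho>(1), of A ?x] by (auto simp: indicator_def not_le)
      qed
    qed
    also have "\<dots> = ennreal (\<bar>c\<bar> ^ DIM(real^'k)) * (\<integral>\<^sup>+\<sigma>. ?f (t + c *\<^sub>R \<sigma>) \<partial>lborel)"
      using overlap_shear_measurable(3)[OF A A', where M="?E" and p=p and m=m]
      by (intro nn_integral_lborel_affine c) (auto intro!: borel_measurable_times_ennreal)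
    also have "\<dots> \<le> ennreal ((1 + r) ^ CARD('k)) * (\<integral>\<^sup>+\<sigma>. indicator (shear_box m \<theta> r) \<sigma> *
        overlap A ?A' (?E *v (col_shear m \<sigma> *v (p + q))) \<partial>lborel)"
    proof (rule mult_mono[OF _ nn_integral_mono])
      show "ennreal (\<bar>c\<bar> ^ DIM(real^'k)) \<le> ennreal ((1 + r) ^ CARD('k))"
        using cle by (auto intro!: ennreal_leI power_mono)
      fix \<sigma>' :: "real^'k"
      define \<sigma> where "\<sigma> = t + c *\<^sub>R \<sigma>'"
      have s: "p $ m * \<sigma> $ i = (if i = m then 0 else q $ i) + (p $ m + q $ m) * \<sigma>' $ i" for i
        using po by (simp add: \<sigma>_def t_def c_def field_simps)
      have "col_shear m \<sigma> *v p = col_shear m \<sigma>' *v (p + q)"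
        using s by (auto simp: vec_eq_iff col_shear_nth algebra_simps)
      moreover have "\<sigma>' \<in> shear_box m \<theta> r" if \<sigma>: "\<sigma> \<in> shear_box m \<theta> 0"
      proof -
        have d: "\<bar>\<sigma>' $ i - \<sigma> $ i\<bar> \<le> r" for i
        proof -
          have "\<bar>\<sigma> $ i\<bar> \<le> 2" using \<sigma> \<theta> by (cases "i = m") (auto simp: mem_shear_box intro: order_trans[of _ 1])
          then have "\<bar>q $ m * \<sigma> $ i\<bar> \<le> D * 2" unfolding abs_mult using qi q by (intro mult_mono) auto
          moreover have "(p $ m + q $ m) * (\<sigma>' $ i - \<sigma> $ i) = - (q $ m * \<sigma> $ i) - (if i = m then 0 else q $ i)"
            using s[of i] by (simp add: algebra_simps)
          ultimately have "\<bar>p $ m + q $ m\<bar> * \<bar>\<sigma>' $ i - \<sigma> $ i\<bar> \<le> 3 * D"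
            using qi[of i] q(2) by (simp only: abs_mult[symmetric]) (auto split: if_splits)
          moreover have "3 * D / r * \<bar>\<sigma>' $ i - \<sigma> $ i\<bar> \<le> \<bar>p $ m + q $ m\<bar> * \<bar>\<sigma>' $ i - \<sigma> $ i\<bar>"
            using poq by (intro mult_right_mono) auto
          ultimately have "3 * D / r * \<bar>\<sigma>' $ i - \<sigma> $ i\<bar> \<le> 3 * D / r * r" using r by simp
          then show ?thesis using Dr by (simp only: mult_le_cancel_left_pos)
        qed
        have "\<bar>\<sigma>' $ i\<bar> \<le> 1 + r" if "i \<noteq> m" for i
        proof -
          have "\<bar>\<sigma> $ i\<bar> \<le> 1" using \<sigma> that by (simp add: mem_shear_box)
          then show ?thesis using d[of i] by linarith
        qed
        then show ?thesis using \<sigma> d[of m] by (auto simp: mem_shear_box)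
      qed
      ultimately show "?f (t + c *\<^sub>R \<sigma>') \<le> indicator (shear_box m \<theta> r) \<sigma>' * overlap A ?A' (?E *v (col_shear m \<sigma>' *v (p + q)))"
        unfolding \<sigma>_def[symmetric] by (auto simp: indicator_def)
    qed simp_all
    finally show ?thesis .
  qed
qed

definition shear_average :: "'k::finite \<Rightarrow> real \<Rightarrow> (real^'k) set \<Rightarrow> nat \<Rightarrow> real^'k \<Rightarrow> ennreal"
  where "shear_average m \<theta> A j p = (\<integral>\<^sup>+\<sigma>. indicator (shear_box m \<theta> 0) \<sigma> *
    overlap A A (expand m (inverse (real (Suc j))) *v (col_shear m (set_one m \<sigma>) *v p)) \<partial>lborel)"

text \<open>For fixed \<sigma> the linear substitution in \<open>z\<close> has determinant
  \<open>\<sigma> $ m\<close>, at least \<open>1 - r\<close> on the box; this is the only loss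
  before the total integral of the overlap is used.\<close>

lemma nn_integral_sheared_overlap:
  fixes A A' :: "(real^'k) set"
  assumes A: "A \<in> sets borel" "A' \<in> sets borel" and \<epsilon>: "\<epsilon> > 0" and r: "r < 1"
  shows "(\<integral>\<^sup>+z. (\<integral>\<^sup>+\<sigma>. indicator (shear_box m \<theta> r) \<sigma> * overlap A A' (expand m \<epsilon> *v (col_shear m \<sigma> *v z)) \<partial>lborel) \<partial>lborel)
    \<le> emeasure lborel (shear_box m \<theta> r) * (ennreal (1 / (1 - r)) * (emeasure lborel A * emeasure lborel A'))"
    (is "?l \<le> _")
proof -
  let ?c = "ennreal (1 / (1 - r)) * (emeasure lborel A * emeasure lborel A')"
  note m = overlap_shear_measurable[OF A, where M="expand m \<epsilon>"]
  have "(\<lambda>x. indicator (shear_box m \<theta> r) (fst x) * overlap A A' (expand m \<epsilon> *v (col_shear m (fst x) *v snd x)))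
      \<in> borel_measurable (borel \<Otimes>\<^sub>M borel)"
    by (intro borel_measurable_times_ennreal m(2)[folded borel_prod]) measurable
  then have "?l = (\<integral>\<^sup>+\<sigma>. (\<integral>\<^sup>+z. indicator (shear_box m \<theta> r) \<sigma> * overlap A A' (expand m \<epsilon> *v (col_shear m \<sigma> *v z)) \<partial>lborel) \<partial>lborel)"
    by (intro lborel_pair.Fubini') (simp add: case_prod_unfold cong: measurable_cong_sets)
  also have "\<dots> \<le> (\<integral>\<^sup>+\<sigma>. indicator (shear_box m \<theta> r) \<sigma> * ?c \<partial>lborel)"
  proof (rule nn_integral_mono)
    fix \<sigma> :: "real^'k"
    let ?M = "expand m \<epsilon> ** col_shear m \<sigma>"
    have om: "overlap A A' \<in> borel_measurable borel" by (rule overlap_measurable[OF A])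
    show "(\<integral>\<^sup>+z. indicator (shear_box m \<theta> r) \<sigma> * overlap A A' (expand m \<epsilon> *v (col_shear m \<sigma> *v z)) \<partial>lborel)
        \<le> indicator (shear_box m \<theta> r) \<sigma> * ?c"
    proof (cases "\<sigma> \<in> shear_box m \<theta> r")
      case True
      then have s: "\<sigma> $ m \<ge> 1 - r" by (simp add: mem_shear_box)
      then have d: "det ?M = \<sigma> $ m" "det ?M \<noteq> 0" using \<epsilon> r by (auto simp: det_mul det_expand det_col_shear)
      let ?I = "\<integral>\<^sup>+z. overlap A A' (?M *v z) \<partial>lborel"
      have "emeasure lborel A * emeasure lborel A' = ennreal (\<sigma> $ m) * ?I"
        using nn_integral_lborel_matrix[OF d(2) om] s r by (simp add: nn_integral_overlap[OF A] d(1))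
      moreover have "ennreal (1 - r) * ?I \<le> ennreal (\<sigma> $ m) * ?I"
        using s by (intro mult_right_mono ennreal_leI) auto
      ultimately have "ennreal (1 / (1 - r)) * (ennreal (1 - r) * ?I) \<le> ?c"
        by (intro mult_left_mono) auto
      also have "ennreal (1 / (1 - r)) * (ennreal (1 - r) * ?I) = ?I"
        using r by (simp add: mult.assoc[symmetric] ennreal_mult[symmetric])
      finally show ?thesis using True by (simp add: matrix_vector_mul_assoc)
    qed simp
  qed
  also have "\<dots> = emeasure lborel (shear_box m \<theta> r) * ?c"
    by (simp add: nn_integral_multc)
  finally show ?thesis .
qed

text \<open>Near and far differences are treated separately. Only finitely many nonzero
  \<open>k\<close> are near, and their total \<open>s j\<close> tends to \<open>0\<close>. The far
  ones are bounded by an integral uniformly in \<open>j\<close>, since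
  \<open>shear_average_le\<close> asks of the expansion only that
  \<open>\<epsilon> \<le> 1\<close>.\<close>

lemma shear_average_sum_le:
  fixes A :: "(real^'k) set" and h :: "real^'k^'k"
  assumes A: "A \<in> sets borel" and \<rho>: "\<And>z. z \<in> A \<Longrightarrow> norm z \<le> \<rho>" "\<rho> \<ge> 0" and fin: "emeasure lborel A < \<infinity>"
    and \<theta>: "0 < \<theta>" "\<theta> \<le> 1" and r: "0 < r" "r \<le> 1/2"
    and det: "det h = 1" and card: "CARD('k) \<ge> 2"
  shows "\<exists>s. s \<longlonglongrightarrow> 0 \<and> (\<forall>j. (\<integral>\<^sup>+k. (if k = 0 then 0 else shear_average m \<theta> A j (h *v k)) \<partial>count_space int_lattice)
    \<le> s j + ennreal ((1 + r) ^ CARD('k)) * (emeasure lborel (shear_box m \<theta> r) *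
      (ennreal (1 / (1 - r)) * (emeasure lborel A * emeasure lborel {z. infdist z A \<le> \<theta> * (2 * \<rho>)}))))"
proof -
  let ?A' = "{z. infdist z A \<le> \<theta> * (2 * \<rho>)}"
  have A': "?A' \<in> sets borel" by (auto intro!: borel_closed closed_Collect_le continuous_intros)
  obtain D where D: "D > 0" "\<And>q. q \<in> unit_cell \<Longrightarrow> norm (h *v q) \<le> D" using norm_unit_cell[of h] by auto
  define Y where "Y = real CARD('k) * (2 * \<rho> + (D + 3 * D / r))"
  define F where "F = {k \<in> int_lattice. h *v k \<in> cball 0 Y} - {0}"
  have F: "finite F" using finite_lattice_points[OF det bounded_cball[of 0 Y], of 0] by (simp add: F_def)
  define s where "s j = (\<Sum>k\<in>F. shear_average m \<theta> A j (h *v k))" for j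
  have "s \<longlonglongrightarrow> (\<Sum>k\<in>F. 0)"
    unfolding s_def
  proof (rule tendsto_sum)
    fix k assume "k \<in> F"
    moreover have "h *v k = 0 \<Longrightarrow> k = 0" for k
      using det matrix_left_invertible_ker[of h] invertible_det_nz[of h] by (auto simp: invertible_left_inverse)
    ultimately have "h *v k \<noteq> 0" by (auto simp: F_def)
    then show "(\<lambda>j. shear_average m \<theta> A j (h *v k)) \<longlonglongrightarrow> 0"
      unfolding shear_average_def by (intro shear_overlap_tendsto_0[OF A \<rho>(1) fin _ card])
  qed
  then have s0: "s \<longlonglongrightarrow> 0" by simp
  let ?\<phi> = "\<lambda>j k. if norm (h *v k) \<le> Y then 0 else shear_average m \<theta> A j (h *v k)"
  have tail: "(\<integral>\<^sup>+k. ?\<phi> j k \<partial>count_space int_lattice) \<le> ennreal ((1 + r) ^ CARD('k)) * (emeasure lborel (shear_box m \<theta> r) *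
      (ennreal (1 / (1 - r)) * (emeasure lborel A * emeasure lborel ?A')))" for j
  proof -
    let ?E = "expand m (inverse (real (Suc j))) :: real^'k^'k"
    let ?g = "\<lambda>z. \<integral>\<^sup>+\<sigma>. indicator (shear_box m \<theta> r) \<sigma> * overlap A ?A' (?E *v (col_shear m \<sigma> *v z)) \<partial>lborel"
    have \<epsilon>: "0 < inverse (real (Suc j))" "inverse (real (Suc j)) \<le> 1" by (auto simp: field_simps)
    have "(\<lambda>x. indicator (shear_box m \<theta> r) (fst x) * overlap A ?A' (?E *v (col_shear m (fst x) *v snd x)))
      \<in> borel_measurable (borel \<Otimes>\<^sub>M borel)"
      by (intro borel_measurable_times_ennreal overlap_shear_measurable(2)[OF A A', folded borel_prod]) measurable
    then have "(\<lambda>x. indicator (shear_box m \<theta> r) (snd x) * overlap A ?A' (?E *v (col_shear m (snd x) *v fst x)))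
      \<in> borel_measurable (borel \<Otimes>\<^sub>M borel)"
      by (subst (asm) measurable_pair_swap_iff) (simp add: case_prod_unfold)
    then have gm: "?g \<in> borel_measurable borel"
      by (intro lborel.borel_measurable_nn_integral) (simp add: case_prod_unfold cong: measurable_cong_sets)
    have "(\<integral>\<^sup>+k. ?\<phi> j k \<partial>count_space int_lattice) \<le> (\<integral>\<^sup>+z. ennreal ((1 + r) ^ CARD('k)) * ?g z \<partial>lborel)"
    proof (rule lattice_sum_le[OF det, where b=0])
      show "(\<lambda>z. ennreal ((1 + r) ^ CARD('k)) * ?g z) \<in> borel_measurable borel"
        by (intro borel_measurable_times_ennreal gm) simp
      fix k q :: "real^'k" assume q: "q \<in> unit_cell"
      show "?\<phi> j k \<le> ennreal ((1 + r) ^ CARD('k)) * ?g (h *v k + 0 + h *v q)"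
        using shear_average_le[OF A \<rho> \<theta> r \<epsilon> D(2)[OF q] D(1), of "h *v k" m]
        by (auto simp: Y_def shear_average_def)
    qed
    also have "\<dots> = ennreal ((1 + r) ^ CARD('k)) * (\<integral>\<^sup>+z. ?g z \<partial>lborel)"
      by (rule nn_integral_cmult) (use gm in simp)
    also have "\<dots> \<le> ennreal ((1 + r) ^ CARD('k)) * (emeasure lborel (shear_box m \<theta> r) *
      (ennreal (1 / (1 - r)) * (emeasure lborel A * emeasure lborel ?A')))"
      using r by (intro mult_left_mono nn_integral_sheared_overlap A A' \<epsilon>) auto
    finally show ?thesis .
  qed
  have "(\<integral>\<^sup>+k. (if k = 0 then 0 else shear_average m \<theta> A j (h *v k)) \<partial>count_space int_lattice)
    \<le> s j + ennreal ((1 + r) ^ CARD('k)) * (emeasure lborel (shear_box m \<theta> r) *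
      (ennreal (1 / (1 - r)) * (emeasure lborel A * emeasure lborel ?A')))" for j
  proof -
    have "(\<integral>\<^sup>+k. (if k = 0 then 0 else shear_average m \<theta> A j (h *v k)) \<partial>count_space int_lattice)
      \<le> (\<integral>\<^sup>+k. shear_average m \<theta> A j (h *v k) * indicator F k + ?\<phi> j k \<partial>count_space int_lattice)"
      by (rule nn_integral_mono) (auto simp: F_def indicator_def)
    also have "\<dots> = (\<integral>\<^sup>+k. shear_average m \<theta> A j (h *v k) * indicator F k \<partial>count_space int_lattice)
        + (\<integral>\<^sup>+k. ?\<phi> j k \<partial>count_space int_lattice)"
      by (rule nn_integral_add) auto
    also have "(\<integral>\<^sup>+k. shear_average m \<theta> A j (h *v k) * indicator F k \<partial>count_space int_lattice) = s j"
    proof -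
      have "(\<integral>\<^sup>+k. shear_average m \<theta> A j (h *v k) * indicator F k \<partial>count_space int_lattice)
         = (\<Sum>k\<in>F. shear_average m \<theta> A j (h *v k) * indicator F k)"
        by (rule nn_integral_count_space'[OF F]) (auto simp: F_def)
      then show ?thesis by (simp add: s_def)
    qed
    finally show ?thesis using tail[of j] by (meson add_left_mono order_trans)
  qed
  then show ?thesis using s0 by blast
qed

text \<open>Inversion coordinate by coordinate, starting with \<open>m\<close>. The bound depends on
  \<epsilon> but not on \<sigma>, so one ball of translations can serve all shears of the same
  stage.\<close>

lemma norm_le_of_sheared:
  fixes x :: "real^'k"
  assumes \<sigma>: "\<sigma> \<in> shear_box m \<theta> 0" and \<epsilon>: "0 < \<epsilon>" "\<epsilon> \<le> 1"
    and x: "norm (expand m \<epsilon> *v (col_shear m (set_one m \<sigma>) *v x)) \<le> \<rho>"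
  shows "norm x \<le> real CARD('k) * (\<rho> + \<rho> / \<epsilon> ^ (CARD('k) - 1))"
proof -
  let ?x = "expand m \<epsilon> *v (col_shear m (set_one m \<sigma>) *v x)"
  have c: "\<bar>?x $ i\<bar> \<le> \<rho>" for i using order_trans[OF component_le_norm_cart x] .
  have \<rho>: "\<rho> \<ge> 0" using order_trans[OF norm_ge_zero x] .
  have xm: "\<bar>x $ m\<bar> \<le> \<rho> / \<epsilon> ^ (CARD('k) - 1)"
    using c[of m] \<epsilon> by (simp add: expand_nth col_shear_nth set_one_def abs_mult field_simps)
  have "\<bar>x $ i\<bar> \<le> \<rho> + \<rho> / \<epsilon> ^ (CARD('k) - 1)" for i
  proof (cases "i = m")
    case True
    then show ?thesis using xm \<rho> by simp
  next
    case False
    have "\<bar>(x $ i + \<sigma> $ i * x $ m) / \<epsilon>\<bar> \<le> \<rho>"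
      using c[of i] False by (simp add: expand_nth col_shear_nth set_one_def)
    then have "\<bar>x $ i + \<sigma> $ i * x $ m\<bar> \<le> \<rho> * \<epsilon>" using \<epsilon> by (simp add: field_simps)
    also have "\<dots> \<le> \<rho>" using \<epsilon> \<rho> by (simp add: mult_left_le)
    finally have 1: "\<bar>x $ i + \<sigma> $ i * x $ m\<bar> \<le> \<rho>" .
    have "\<bar>\<sigma> $ i * x $ m\<bar> \<le> 1 * \<bar>x $ m\<bar>"
      unfolding abs_mult using \<sigma> False by (intro mult_right_mono) (auto simp: mem_shear_box)
    then show ?thesis using 1 xm by linarith
  qed
  then have "norm x \<le> (\<Sum>i\<in>(UNIV::'k set). \<rho> + \<rho> / \<epsilon> ^ (CARD('k) - 1))"
    by (intro order_trans[OF norm_le_l1_cart] sum_mono)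
  then show ?thesis by simp
qed

lemma emeasure_shear_box:
  fixes m :: "'k::finite"
  assumes "0 < \<theta>" "0 \<le> r"
  shows "emeasure lborel (shear_box m \<theta> r) = ennreal ((2 + 2 * r) ^ (CARD('k) - 1) * (\<theta> + 2 * r))"
proof -
  let ?l = "(\<chi> i. if i = m then 1 - r else - 1 - r) :: real^'k" and ?u = "(\<chi> i. if i = m then 1 + \<theta> + r else 1 + r) :: real^'k"
  have "emeasure lborel (shear_box m \<theta> r) = ennreal (\<Prod>b\<in>Basis. (?u - ?l) \<bullet> b)"
    unfolding shear_box_def using assms by (intro emeasure_lborel_cbox) (auto simp: Basis_vec_def inner_axis)
  also have "(\<Prod>b\<in>Basis. (?u - ?l) \<bullet> b) = (\<Prod>i\<in>UNIV. if i = m then \<theta> + 2 * r else 2 + 2 * r)"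
    by (subst prod_Basis_cart) (auto simp: inner_axis intro!: prod.cong)
  also have "\<dots> = (2 + 2 * r) ^ (CARD('k) - 1) * (\<theta> + 2 * r)"
    by (subst prod.remove[of _ m]) (auto simp: card_Diff_singleton)
  finally show ?thesis .
qed

section \<open>The second moment\<close>

lemma shear_average_0:
  assumes "A \<in> sets borel"
  shows "shear_average m \<theta> A j 0 = emeasure lborel (shear_box m \<theta> 0) * emeasure lborel A"
  by (simp add: shear_average_def overlap_zero[OF assms] nn_integral_multc)

lemma sum_shear_average:
  fixes A :: "(real^'k) set" and h :: "real^'k^'k"
  assumes A: "A \<in> sets borel"
  shows "(\<integral>\<^sup>+\<sigma>. (\<integral>\<^sup>+k. overlap A A ((expand m (inverse (real (Suc j))) ** col_shear m (set_one m \<sigma>)) *v (h *v k)) \<partial>count_space int_lattice)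
      * indicator (shear_box m \<theta> 0) \<sigma> \<partial>lborel)
    = emeasure lborel (shear_box m \<theta> 0) * emeasure lborel A +
      (\<integral>\<^sup>+k. (if k = 0 then 0 else shear_average m \<theta> A j (h *v k)) \<partial>count_space int_lattice)"
proof -
  let ?E = "expand m (inverse (real (Suc j)))"
  have "(\<integral>\<^sup>+\<sigma>. (\<integral>\<^sup>+k. overlap A A ((?E ** col_shear m (set_one m \<sigma>)) *v (h *v k)) \<partial>count_space int_lattice)
      * indicator (shear_box m \<theta> 0) \<sigma> \<partial>lborel)
    = (\<integral>\<^sup>+\<sigma>. (\<integral>\<^sup>+k. indicator (shear_box m \<theta> 0) \<sigma> * overlap A A (?E *v (col_shear m (set_one m \<sigma>) *v (h *v k))) \<partial>count_space int_lattice) \<partial>lborel)"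
    by (simp add: nn_integral_multc[symmetric] mult.commute matrix_vector_mul_assoc[symmetric] nn_integral_cmult)
  also have "\<dots> = (\<integral>\<^sup>+k. shear_average m \<theta> A j (h *v k) \<partial>count_space int_lattice)"
    unfolding shear_average_def
    using overlap_shear_measurable(1)[OF A A]
    by (intro nn_integral_count_space_nn_integral countable_int_lattice borel_measurable_times_ennreal) auto
  also have "\<dots> = (\<integral>\<^sup>+k. shear_average m \<theta> A j 0 * indicator {0} k + (if k = 0 then 0 else shear_average m \<theta> A j (h *v k)) \<partial>count_space int_lattice)"
    by (rule nn_integral_cong) (auto simp: indicator_def)
  also have "\<dots> = (\<integral>\<^sup>+k. shear_average m \<theta> A j 0 * indicator {0} k \<partial>count_space (int_lattice :: (real^'k) set)) +
      (\<integral>\<^sup>+k. (if k = 0 then 0 else shear_average m \<theta> A j (h *v k)) \<partial>count_space int_lattice)"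
    by (rule nn_integral_add) auto
  also have "(\<integral>\<^sup>+k. shear_average m \<theta> A j 0 * indicator {0} k \<partial>count_space (int_lattice :: (real^'k) set)) = shear_average m \<theta> A j 0"
    by (subst nn_integral_count_space'[of "{0}"]) (auto simp: int_lattice_def)
  finally show ?thesis by (simp add: shear_average_0[OF A])
qed

text \<open>At stage \<open>j\<close> the group element is random through a uniform parameter in the
  shear box and an independent uniform translation in a large ball. The quantities depending on the
  individual lattice, namely \<open>s j\<close> and the ratio of ball volumes, disappear in the
  limit superior; only \<theta> and \<open>r\<close> survive.\<close>

lemma (in haar_affine_lattices) expected_num_points_square_le_approx:
  assumes U: "open U" "bounded U" "open U'" and card: "CARD('k) \<ge> 2"
    and \<rho>: "\<And>z. z \<in> U - U' \<Longrightarrow> norm z \<le> \<rho>" "\<rho> \<ge> 0"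
    and \<theta>: "0 < \<theta>" "\<theta> \<le> 1" and r: "0 < r" "r \<le> 1/2"
  shows "(\<integral>\<^sup>+L. (num_points L (U - U'))\<^sup>2 \<partial>\<nu>) \<le>
    (emeasure lborel (shear_box (m::'k) \<theta> 0) * emeasure lborel (U - U') +
      ennreal ((1 + r) ^ CARD('k)) * (emeasure lborel (shear_box m \<theta> r) *
      (ennreal (1 / (1 - r)) * (emeasure lborel (U - U') * emeasure lborel {z. infdist z (U - U') \<le> \<theta> * (2 * \<rho>)}))))
    * inverse (emeasure lborel (shear_box m \<theta> 0))" (is "_ \<le> ?bound")
proof -
  define A where "A = U - U'"
  have A: "A \<in> sets borel" using U by (auto simp: A_def)
  have "bounded A" unfolding A_def by (rule bounded_subset[OF U(2)]) auto
  then have fin: "emeasure lborel A < \<infinity>" by (rule emeasure_bounded_finite)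
  have \<rho>A: "\<And>z. z \<in> A \<Longrightarrow> norm z \<le> \<rho>" using \<rho>(1) by (simp add: A_def)
  let ?d = "CARD('k)"
  define \<epsilon> where "\<epsilon> j = inverse (real (Suc j))" for j
  have \<epsilon>: "0 < \<epsilon> j" "\<epsilon> j \<le> 1" for j by (auto simp: \<epsilon>_def field_simps)
  define \<rho>' where "\<rho>' j = real ?d * (\<rho> + \<rho> / \<epsilon> j ^ (?d - 1))" for j
  have \<rho>': "\<rho>' j \<ge> 0" for j unfolding \<rho>'_def using \<rho>(2) \<epsilon>[of j] by (intro mult_nonneg_nonneg add_nonneg_nonneg divide_nonneg_nonneg) auto
  \<comment> \<open>The preimage radius \<open>\<rho>' j\<close> may grow with \<open>j\<close> as
    the contraction strengthens. The factor \<open>real (Suc j)\<close> makes it, and any fixed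
    \<open>D\<close>, negligible against the radius of the ball, with relative error at most
    \<open>(1 + D) / real (Suc j)\<close>.\<close>
  define R where "R j = real (Suc j) * (\<rho>' j + 1)" for j
  have R: "R j > 0" for j unfolding R_def using \<rho>'[of j] by (intro mult_pos_pos) auto
  define G where "G j \<sigma> = expand m (\<epsilon> j) ** col_shear m (set_one m \<sigma>)" for j and \<sigma> :: "real^'k"
  have G: "det (G j \<sigma>) = 1" for j \<sigma> using \<epsilon>[of j] by (simp add: G_def det_mul det_expand det_set_one)
  \<comment> \<open>The translation acts before \<open>G\<close>. The cells of the lattice then keep
    a diameter independent of \<open>j\<close> and \<sigma>, and the distortion by \<open>G\<close>
    shows only in \<open>\<rho>' j\<close>.\<close>
  define \<Gamma> where "\<Gamma> j p = (G j (fst p), G j (fst p) *v snd p)" for j and p :: "(real^'k) \<times> (real^'k)"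
  have \<Gamma>: "\<Gamma> j p \<in> ASL" for j p by (simp add: \<Gamma>_def ASL_def G)
  have \<Gamma>c: "continuous_on UNIV (\<Gamma> j)" for j
    unfolding \<Gamma>_def G_def matrix_matrix_mult_def by (intro continuous_intros continuous_on_matrix_vector)
  let ?B = "shear_box m \<theta> 0"
  have Be: "emeasure lborel ?B = ennreal (2 ^ (?d - 1) * \<theta>)"
    using emeasure_shear_box[OF \<theta>(1), of 0 m] by simp
  have Bnz: "emeasure lborel ?B \<noteq> 0" "emeasure lborel ?B \<noteq> \<infinity>"
    unfolding Be using \<theta> by (auto simp: ennreal_eq_0_iff not_le)
  define \<mu>1 where "\<mu>1 = uniform_measure lborel ?B"
  define \<mu>2 where "\<mu>2 j = uniform_measure lborel (ball (0::real^'k) (R j))" for j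
  have p1: "prob_space \<mu>1" unfolding \<mu>1_def by (rule prob_space_uniform_measure) (fact Bnz)+
  have p2: "prob_space (\<mu>2 j)" for j
    unfolding \<mu>2_def by (rule prob_space_uniform_measure; rule emeasure_ball_finite_pos[OF R])
  have sets: "sets (\<mu>1 \<Otimes>\<^sub>M \<mu>2 j) = sets borel" for j
  proof -
    have "sets (\<mu>1 \<Otimes>\<^sub>M \<mu>2 j) = sets (borel \<Otimes>\<^sub>M borel)"
      by (rule sets_pair_measure_cong) (simp_all add: \<mu>1_def \<mu>2_def)
    then show ?thesis by (simp only: borel_prod)
  qed
  have nm: "(\<lambda>(L, p). num_points (aff_map (\<Gamma> j p) ` L) A) \<in> borel_measurable (\<nu> \<Otimes>\<^sub>M borel)" for j
    unfolding A_def by (rule num_points_measurable[OF \<Gamma>c \<Gamma> U])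
  have f2: "(\<lambda>(L, p). (num_points (aff_map (\<Gamma> j p) ` L) A)\<^sup>2) \<in> borel_measurable (\<nu> \<Otimes>\<^sub>M borel)" for j
    using nm[of j] by (auto simp: power2_eq_square case_prod_unfold intro!: borel_measurable_times_ennreal)
  let ?\<beta> = "ennreal ((1 + r) ^ ?d) * (emeasure lborel (shear_box m \<theta> r) *
      (ennreal (1 / (1 - r)) * (emeasure lborel A * emeasure lborel {z. infdist z A \<le> \<theta> * (2 * \<rho>)})))"
  have "(\<integral>\<^sup>+L. (num_points L A)\<^sup>2 \<partial>\<nu>) \<le> ?bound"
  proof (rule nn_integral_le_limsup_average[where \<Gamma>=\<Gamma> and \<mu>="\<lambda>j. \<mu>1 \<Otimes>\<^sub>M \<mu>2 j"])
    show "\<Gamma> j p \<in> ASL" for j p by (rule \<Gamma>)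
    show "prob_space (\<mu>1 \<Otimes>\<^sub>M \<mu>2 j)" for j by (rule prob_space_pair[OF p1 p2])
    show "sets (\<mu>1 \<Otimes>\<^sub>M \<mu>2 j) = sets borel" for j by (rule sets)
    show "(\<lambda>L. (num_points L A)\<^sup>2) \<in> borel_measurable \<nu>"
      unfolding A_def power2_eq_square by (intro borel_measurable_times_ennreal num_points_measurable1[OF U])
    show "(\<lambda>(L, p). (num_points (aff_map (\<Gamma> j p) ` L) A)\<^sup>2) \<in> borel_measurable (\<nu> \<Otimes>\<^sub>M borel)" for j by (rule f2)
    fix L :: "(real^'k) set" assume L': "L \<in> affine_lattices"
    then obtain h b where L: "L = affine_lattice (h, b)" "(h, b) \<in> ASL"
      by (auto simp: affine_lattices_def)
    then have det: "det h = 1" by (simp add: ASL_def)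
    obtain D where D: "D > 0" "\<And>q. q \<in> unit_cell \<Longrightarrow> norm (h *v q) \<le> D" using norm_unit_cell[of h] by auto
    obtain s where s: "s \<longlonglongrightarrow> 0" "\<And>j. (\<integral>\<^sup>+k. (if k = 0 then 0 else shear_average m \<theta> A j (h *v k)) \<partial>count_space int_lattice) \<le> s j + ?\<beta>"
      using shear_average_sum_le[OF A \<rho>A \<rho>(2) fin \<theta> r det card, of m] by blast
    let ?a = "\<lambda>j. \<integral>\<^sup>+p. (num_points (aff_map (\<Gamma> j p) ` L) A)\<^sup>2 \<partial>(\<mu>1 \<Otimes>\<^sub>M \<mu>2 j)"
    let ?c = "\<lambda>j. ennreal (((real (Suc j) + (1 + D)) / real (Suc j)) ^ ?d) *
      ((emeasure lborel ?B * emeasure lborel A + (s j + ?\<beta>)) * inverse (emeasure lborel ?B))"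
    have le: "?a j \<le> ?c j" for j
    proof -
      interpret \<mu>2: prob_space "\<mu>2 j" by (rule p2)
      let ?f = "\<lambda>p. (num_points (aff_map (\<Gamma> j p) ` L) A)\<^sup>2"
      have fm: "?f \<in> borel_measurable borel"
        using measurable_compose[OF measurable_Pair1' f2[of j], of L] L' by (simp add: space_nu)
      then have fm': "?f \<in> borel_measurable (\<mu>1 \<Otimes>\<^sub>M \<mu>2 j)" by (simp add: sets cong: measurable_cong_sets)
      let ?q = "ennreal (((real (Suc j) + (1 + D)) / real (Suc j)) ^ ?d)"
      let ?S = "\<lambda>\<sigma>. \<integral>\<^sup>+k. overlap A A (G j \<sigma> *v (h *v k)) \<partial>count_space int_lattice"
      have inner: "(\<integral>\<^sup>+t. ?f (\<sigma>, t) \<partial>\<mu>2 j) \<le> ?q * ?S \<sigma>" if \<sigma>: "\<sigma> \<in> ?B" for \<sigma>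
      proof -
        have "(\<integral>\<^sup>+t. ?f (\<sigma>, t) \<partial>\<mu>2 j) = (\<integral>\<^sup>+t. ?f (\<sigma>, t) * indicator (ball 0 (R j)) t \<partial>lborel) / emeasure lborel (ball (0::real^'k) (R j))"
          unfolding \<mu>2_def
        proof (rule nn_integral_uniform_measure)
          have "(\<lambda>t. (\<sigma>, t)) \<in> borel_measurable borel"
            by (intro borel_measurable_continuous_onI continuous_intros)
          from measurable_compose[OF this fm] show "(\<lambda>t. ?f (\<sigma>, t)) \<in> borel_measurable lborel" by simp
        qed auto
        also have "\<dots> \<le> (emeasure lborel (cball (0::real^'k) (R j + \<rho>' j + D)) * ?S \<sigma>) / emeasure lborel (ball (0::real^'k) (R j))"
          unfolding L \<Gamma>_def fst_conv snd_conv
        proof (intro divide_right_mono_ennreal translation_average_square_le L(2) G A D(2))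
          fix x assume "G j \<sigma> *v x \<in> A"
          then have "norm (G j \<sigma> *v x) \<le> \<rho>" by (rule \<rho>A)
          then show "norm x \<le> \<rho>' j"
            unfolding \<rho>'_def G_def matrix_vector_mul_assoc[symmetric] by (rule norm_le_of_sheared[OF \<sigma> \<epsilon>])
        qed
        also have "\<dots> = emeasure lborel (cball (0::real^'k) (R j + \<rho>' j + D)) / emeasure lborel (ball (0::real^'k) (R j)) * ?S \<sigma>"
          by (simp only: divide_ennreal_def ac_simps)
        also have "emeasure lborel (cball (0::real^'k) (R j + \<rho>' j + D)) / emeasure lborel (ball (0::real^'k) (R j))
            = ennreal (((R j + \<rho>' j + D) / R j) ^ ?d)"
          using R[of j] \<rho>'[of j] D(1) by (subst emeasure_cball_div_ball) auto
        also have "\<dots> \<le> ?q"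
        proof (intro ennreal_leI power_mono)
          have "\<rho>' j + D \<le> (1 + D) * (\<rho>' j + 1)" using \<rho>'[of j] D(1) by (simp add: algebra_simps)
          then have "(\<rho>' j + D) / R j \<le> (1 + D) * (\<rho>' j + 1) / R j" using R[of j] by (intro divide_right_mono) auto
          also have "\<dots> = (1 + D) / real (Suc j)" using \<rho>'[of j] by (simp add: R_def)
          finally show "(R j + \<rho>' j + D) / R j \<le> (real (Suc j) + (1 + D)) / real (Suc j)"
            using R[of j] by (simp add: add_divide_distrib add.assoc del: of_nat_Suc)
          show "0 \<le> (R j + \<rho>' j + D) / R j" using R[of j] \<rho>'[of j] D(1) by simp
        qed
        finally show ?thesis by (simp add: mult_right_mono)
      qed
      have Sm: "?S \<in> borel_measurable borel"
        unfolding G_def matrix_vector_mul_assoc[symmetric]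
        by (intro borel_measurable_nn_integral_count_space countable_int_lattice overlap_shear_measurable A)
      have "?a j = (\<integral>\<^sup>+\<sigma>. (\<integral>\<^sup>+t. ?f (\<sigma>, t) \<partial>\<mu>2 j) \<partial>\<mu>1)"
        by (rule \<mu>2.nn_integral_fst[OF fm', symmetric])
      also have "\<dots> \<le> (\<integral>\<^sup>+\<sigma>. ?q * ?S \<sigma> \<partial>\<mu>1)"
      proof (rule nn_integral_mono_AE)
        show "AE \<sigma> in \<mu>1. (\<integral>\<^sup>+t. ?f (\<sigma>, t) \<partial>\<mu>2 j) \<le> ?q * ?S \<sigma>"
          unfolding \<mu>1_def by (rule AE_uniform_measureI) (use inner in auto)
      qed
      also have "\<dots> = ?q * (\<integral>\<^sup>+\<sigma>. ?S \<sigma> \<partial>\<mu>1)"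
        by (rule nn_integral_cmult) (use Sm in \<open>simp add: \<mu>1_def\<close>)
      also have "(\<integral>\<^sup>+\<sigma>. ?S \<sigma> \<partial>\<mu>1) = (\<integral>\<^sup>+\<sigma>. ?S \<sigma> * indicator ?B \<sigma> \<partial>lborel) / emeasure lborel ?B"
        unfolding \<mu>1_def by (rule nn_integral_uniform_measure) (use Sm in auto)
      also have "(\<integral>\<^sup>+\<sigma>. ?S \<sigma> * indicator ?B \<sigma> \<partial>lborel) \<le> emeasure lborel ?B * emeasure lborel A + (s j + ?\<beta>)"
        unfolding G_def \<epsilon>_def sum_shear_average[OF A] by (intro add_left_mono s(2))
      finally show ?thesis by (simp add: divide_ennreal_def mult_left_mono mult_right_mono)
    qed
    have "(\<lambda>j. ?c j) \<longlonglongrightarrow> ennreal 1 * ((emeasure lborel ?B * emeasure lborel A + (0 + ?\<beta>)) * inverse (emeasure lborel ?B))"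
      using Bnz by (intro tendsto_mult_ennreal tendsto_ennrealI ratio_tendsto_1 tendsto_const tendsto_add s(1))
        (auto simp: )
    then have "limsup ?c = ?bound"
      by (simp add: lim_imp_Limsup A_def)
    moreover have "limsup ?a \<le> limsup ?c"
      using le by (intro Limsup_mono) auto
    ultimately show "limsup ?a \<le> ?bound" by simp
  qed
  then show ?thesis by (simp add: A_def)
qed

section \<open>Letting the thickening and the box margin tend to zero\<close>

lemma emeasure_thickening_tendsto:
  fixes A :: "'a::euclidean_space set"
  assumes "bounded A" "A \<noteq> {}" and s: "decseq s" "s \<longlonglongrightarrow> 0"
  shows "(\<lambda>n. emeasure lborel {z. infdist z A \<le> s n}) \<longlonglongrightarrow> emeasure lborel (closure A)"
proof -
  obtain \<rho> where \<rho>: "\<And>x. x \<in> A \<Longrightarrow> norm x \<le> \<rho>" using \<open>bounded A\<close> by (auto simp: bounded_iff)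
  have s0: "s n \<ge> 0" for n using decseq_ge[OF s] .
  have "(\<Inter>n. {z. infdist z A \<le> s n}) = closure A"
  proof -
    have "infdist z A = 0" if "\<And>n. infdist z A \<le> s n" for z
      using LIMSEQ_le_const[OF s(2), of "infdist z A"] that infdist_nonneg[of z A] by force
    then show ?thesis using s0 by (auto simp: in_closure_iff_infdist_zero[OF assms(2)])
  qed
  moreover have "(\<lambda>n. emeasure lborel {z. infdist z A \<le> s n}) \<longlonglongrightarrow> emeasure lborel (\<Inter>n. {z. infdist z A \<le> s n})"
  proof (rule Lim_emeasure_decseq)
    show "range (\<lambda>n. {z. infdist z A \<le> s n}) \<subseteq> sets lborel"
      by (auto intro!: borel_closed closed_Collect_le continuous_intros)
    show "decseq (\<lambda>n. {z. infdist z A \<le> s n})"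
      using s(1) by (auto simp: decseq_def intro: order_trans)
    fix n
    have "norm z - \<rho> \<le> infdist z A" for z
      unfolding infdist_notempty[OF assms(2)]
    proof (rule cINF_greatest[OF assms(2)])
      fix a assume "a \<in> A"
      then show "norm z - \<rho> \<le> dist z a" using \<rho>[of a] norm_triangle_ineq2[of z a] by (simp add: dist_norm)
    qed
    then have "norm z \<le> \<rho> + s n" if "infdist z A \<le> s n" for z using that by (smt (verit))
    then have "bounded {z. infdist z A \<le> s n}" by (auto simp: bounded_iff)
    then show "emeasure lborel {z. infdist z A \<le> s n} \<noteq> \<infinity>" using emeasure_bounded_finite by force
  qed
  ultimately show ?thesis by simp
qed

text \<open>The thickened sets decrease to the closure, so the limit of the approximate bound
  contains the volume of \<open>A\<close> times that of its closure; the hypothesis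
  \<open>cl\<close> makes this a square.\<close>

lemma (in haar_affine_lattices) expected_num_points_square_le:
  assumes U: "open U" "bounded U" "open U'" and card: "CARD('k) \<ge> 2"
    and cl: "emeasure lborel (closure (U - U')) = emeasure lborel (U - U')"
  shows "(\<integral>\<^sup>+L. (num_points L (U - U'))\<^sup>2 \<partial>\<nu>) \<le> emeasure lborel (U - U') + (emeasure lborel (U - U'))\<^sup>2"
proof (cases "U - U' = {}")
  case True
  then show ?thesis by (simp only: True) (simp add: num_points_def)
next
  case ne: False
  define A where "A = U - U'"
  have bA: "bounded A" unfolding A_def by (rule bounded_subset[OF U(2)]) auto
  then obtain \<rho> where \<rho>: "\<And>x. x \<in> A \<Longrightarrow> norm x \<le> \<rho>" by (auto simp: bounded_iff)
  then have \<rho>0: "\<rho> \<ge> 0" using ne norm_ge_zero order_trans unfolding A_def by blast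
  let ?d = "CARD('k)"
  obtain m :: 'k where True by simp
  define \<theta> where "\<theta> n = inverse (real (Suc n))" for n
  \<comment> \<open>The margin must shrink faster than the width: this choice gives
    \<open>\<theta> n + 2 * r n = \<theta> n * (1 + \<theta> n)\<close>, so the enlarged side of the
    box is asymptotic to the original one.\<close>
  define r where "r n = (\<theta> n)\<^sup>2 / 2" for n
  have \<theta>: "0 < \<theta> n" "\<theta> n \<le> 1" for n by (auto simp: \<theta>_def field_simps)
  have r: "0 < r n" "r n \<le> 1/2" for n using \<theta>[of n] by (auto simp: r_def power_le_one)
  have \<theta>0: "\<theta> \<longlonglongrightarrow> 0" unfolding \<theta>_def by (rule LIMSEQ_inverse_real_of_nat)
  have r0: "r \<longlonglongrightarrow> 0"
    unfolding r_def using tendsto_divide[OF tendsto_power[OF \<theta>0, of 2] tendsto_const[of 2]] by simp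
  let ?A' = "\<lambda>n. {z. infdist z A \<le> \<theta> n * (2 * \<rho>)}"
  let ?v = "emeasure lborel A"
  have fin: "?v < \<infinity>" using bA by (rule emeasure_bounded_finite)
  \<comment> \<open>The total distortion, with limit \<open>1\<close>: the scaling in the
    substitution, the ratio of the volumes of the two boxes (two factors), and the
    determinant.\<close>
  define g where "g n = (1 + r n) ^ ?d * (1 + r n) ^ (?d - 1) * (1 + \<theta> n) * (1 / (1 - r n))" for n
  have g1: "g \<longlonglongrightarrow> 1"
  proof -
    have "g \<longlonglongrightarrow> (1 + 0) ^ ?d * (1 + 0) ^ (?d - 1) * (1 + 0) * (1 / (1 - 0))"
      unfolding g_def by (intro tendsto_intros r0 \<theta>0) simp
    then show ?thesis by simp
  qed
  have bound: "(\<integral>\<^sup>+L. (num_points L A)\<^sup>2 \<partial>\<nu>) \<le> ?v + ennreal (g n) * (?v * emeasure lborel (?A' n))" for n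
  proof -
    let ?b0 = "2 ^ (?d - 1) * \<theta> n" and ?br = "(2 + 2 * r n) ^ (?d - 1) * (\<theta> n + 2 * r n)"
    have b0: "?b0 > 0" using \<theta> by simp
    have e0: "emeasure lborel (shear_box m (\<theta> n) 0) = ennreal ?b0"
      using emeasure_shear_box[OF \<theta>(1), of 0 m n] by simp
    have er: "emeasure lborel (shear_box m (\<theta> n) (r n)) = ennreal ?br"
      by (rule emeasure_shear_box[OF \<theta>(1)]) (use r[of n] in simp)
    have g: "g n = (1 + r n) ^ ?d * ?br * (1 / (1 - r n)) * (1 / ?b0)"
    proof -
      have "(2 + 2 * r n) ^ (?d - 1) = 2 ^ (?d - 1) * (1 + r n) ^ (?d - 1)"
        by (subst power_mult_distrib[symmetric]) (simp add: algebra_simps)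
      moreover have "\<theta> n + 2 * r n = \<theta> n * (1 + \<theta> n)" by (simp add: r_def power2_eq_square algebra_simps)
      ultimately show ?thesis using \<theta>(1)[of n] by (simp add: g_def)
    qed
    have alg: "(a * v + b * (c * (d * w))) * e = (a * e) * v + (b * c * d * e) * w" for a b c d e v w :: ennreal
      by (simp only: distrib_left distrib_right ac_simps)
    have "(\<integral>\<^sup>+L. (num_points L A)\<^sup>2 \<partial>\<nu>) \<le>
      (ennreal ?b0 * ?v + ennreal ((1 + r n) ^ ?d) * (ennreal ?br * (ennreal (1 / (1 - r n)) * (?v * emeasure lborel (?A' n)))))
      * inverse (ennreal ?b0)"
      using expected_num_points_square_le_approx[where m=m and \<theta>="\<theta> n" and r="r n", OF U card _ \<rho>0 \<theta> r] \<rho> unfolding A_def e0 er by simp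
    also have "inverse (ennreal ?b0) = ennreal (1 / ?b0)" using b0 by (simp add: inverse_ennreal inverse_eq_divide)
    also have "(ennreal ?b0 * ?v + ennreal ((1 + r n) ^ ?d) * (ennreal ?br * (ennreal (1 / (1 - r n)) * (?v * emeasure lborel (?A' n)))))
      * ennreal (1 / ?b0) = (ennreal ?b0 * ennreal (1 / ?b0)) * ?v +
        (ennreal ((1 + r n) ^ ?d) * ennreal ?br * ennreal (1 / (1 - r n)) * ennreal (1 / ?b0)) * (?v * emeasure lborel (?A' n))"
      by (rule alg)
    also have "ennreal ?b0 * ennreal (1 / ?b0) = 1"
      using b0 by (subst ennreal_mult[symmetric]) auto
    also have "ennreal ((1 + r n) ^ ?d) * ennreal ?br * ennreal (1 / (1 - r n)) * ennreal (1 / ?b0) = ennreal (g n)"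
      unfolding g using r[of n] \<theta>[of n] by (simp add: ennreal_mult[symmetric] del: ennreal_1)
    finally show ?thesis by simp
  qed
  have "(\<lambda>n. ?v + ennreal (g n) * (?v * emeasure lborel (?A' n))) \<longlonglongrightarrow> ?v + ennreal 1 * (?v * emeasure lborel (closure A))"
  proof (intro tendsto_add tendsto_const tendsto_mult_ennreal tendsto_ennrealI g1)
    show "(\<lambda>n. emeasure lborel (?A' n)) \<longlonglongrightarrow> emeasure lborel (closure A)"
    proof (rule emeasure_thickening_tendsto[OF bA])
      show "A \<noteq> {}" using ne by (simp add: A_def)
      show "decseq (\<lambda>n. \<theta> n * (2 * \<rho>))"
        using \<rho>0 by (auto simp: decseq_def \<theta>_def field_simps intro!: mult_left_mono)
      show "(\<lambda>n. \<theta> n * (2 * \<rho>)) \<longlonglongrightarrow> 0" using tendsto_mult[OF \<theta>0 tendsto_const[of "2 * \<rho>"]] by simp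
    qed
  qed (use fin cl in \<open>auto simp: A_def ennreal_mult_eq_top_iff less_top[symmetric]\<close>)
  then have "(\<integral>\<^sup>+L. (num_points L A)\<^sup>2 \<partial>\<nu>) \<le> ?v + ennreal 1 * (?v * emeasure lborel (closure A))"
    by (rule LIMSEQ_le_const) (use bound in auto)
  then show ?thesis using cl by (simp add: A_def power2_eq_square)
qed

text \<open>The expanded square is rearranged with the cross term on the left, since
  \<open>ennreal\<close> subtraction would not be faithful. The lower bound for the mean enters
  there, the upper bound for the second moment on the right, and the finite amount
  \<open>2 * v\<^sup>2\<close> cancels.\<close>

lemma (in haar_affine_lattices) variance_num_points_le:
  assumes U: "open U" "bounded U" "open U'" and card: "CARD('k) \<ge> 2"
    and cl: "emeasure lborel (closure (U - U')) = emeasure lborel (U - U')"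
    and v: "emeasure lborel (U - U') = ennreal v" "v \<ge> 0"
  shows "(\<integral>\<^sup>+L. ennreal ((real (card (L \<inter> (U - U'))) - v)\<^sup>2) \<partial>\<nu>) \<le> ennreal v"
    and "(\<lambda>L. real (card (L \<inter> (U - U')))) \<in> borel_measurable \<nu>"
proof -
  define A where "A = U - U'"
  have bA: "bounded A" unfolding A_def by (rule bounded_subset[OF U(2)]) auto
  let ?N = "\<lambda>L. real (card (L \<inter> A))"
  have N: "num_points L A = ennreal (?N L)" if "L \<in> space \<nu>" for L
    using finite_affine_lattice_Int[OF _ bA, of L] that
    by (simp add: num_points_def space_nu emeasure_count_space ennreal_of_nat_eq_real_of_nat)
  have m: "(\<lambda>L. num_points L A) \<in> borel_measurable \<nu>" unfolding A_def by (rule num_points_measurable1[OF U])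
  have "(\<lambda>L. enn2real (num_points L A)) \<in> borel_measurable \<nu>" using m by measurable
  then have mN: "?N \<in> borel_measurable \<nu>" by (rule measurable_cong[THEN iffD1, rotated]) (simp add: N)
  then show "(\<lambda>L. real (card (L \<inter> (U - U')))) \<in> borel_measurable \<nu>" by (simp add: A_def)
  have "(\<integral>\<^sup>+L. ennreal ((?N L - v)\<^sup>2) \<partial>\<nu>) + ennreal (2 * v) * (\<integral>\<^sup>+L. num_points L A \<partial>\<nu>)
      = (\<integral>\<^sup>+L. ennreal ((?N L - v)\<^sup>2) + ennreal (2 * v) * num_points L A \<partial>\<nu>)"
    using mN m by (simp add: nn_integral_add nn_integral_cmult)
  also have "\<dots> = (\<integral>\<^sup>+L. (num_points L A)\<^sup>2 + ennreal (v\<^sup>2) \<partial>\<nu>)"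
  proof (rule nn_integral_cong)
    fix L assume "L \<in> space \<nu>"
    have "ennreal ((?N L - v)\<^sup>2) + ennreal (2 * v) * ennreal (?N L) = ennreal ((?N L - v)\<^sup>2 + 2 * v * ?N L)"
      using v(2) by (simp add: ennreal_mult ennreal_plus)
    also have "(?N L - v)\<^sup>2 + 2 * v * ?N L = (?N L)\<^sup>2 + v\<^sup>2" by (simp add: power2_eq_square algebra_simps)
    also have "ennreal \<dots> = (ennreal (?N L))\<^sup>2 + ennreal (v\<^sup>2)" by (simp add: ennreal_power)
    finally show "ennreal ((?N L - v)\<^sup>2) + ennreal (2 * v) * num_points L A = (num_points L A)\<^sup>2 + ennreal (v\<^sup>2)"
      by (simp add: N[OF \<open>L \<in> space \<nu>\<close>])
  qed
  also have "\<dots> = (\<integral>\<^sup>+L. (num_points L A)\<^sup>2 \<partial>\<nu>) + ennreal (v\<^sup>2)"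
    using m by (subst nn_integral_add) (auto simp: power2_eq_square emeasure_space_1)
  also have "\<dots> \<le> (ennreal v + (ennreal v)\<^sup>2) + ennreal (v\<^sup>2)"
    using expected_num_points_square_le[OF U card cl] by (intro add_right_mono) (simp add: A_def v(1))
  also have "\<dots> = ennreal (v + 2 * v\<^sup>2)"
    using v(2) by (simp add: ennreal_power ennreal_plus[symmetric] del: ennreal_plus)
  finally have 1: "(\<integral>\<^sup>+L. ennreal ((?N L - v)\<^sup>2) \<partial>\<nu>) + ennreal (2 * v) * (\<integral>\<^sup>+L. num_points L A \<partial>\<nu>) \<le> ennreal (v + 2 * v\<^sup>2)" .
  have "ennreal (2 * v\<^sup>2) = ennreal (2 * v) * ennreal v" using v(2) by (simp add: ennreal_mult[symmetric] power2_eq_square)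
  also have "\<dots> \<le> ennreal (2 * v) * (\<integral>\<^sup>+L. num_points L A \<partial>\<nu>)"
    using expected_num_points_ge[OF U] by (intro mult_left_mono) (auto simp: A_def v(1))
  finally have "(\<integral>\<^sup>+L. ennreal ((?N L - v)\<^sup>2) \<partial>\<nu>) + ennreal (2 * v\<^sup>2) \<le> ennreal (v + 2 * v\<^sup>2)"
    using 1 by (meson add_left_mono order_trans)
  also have "ennreal (v + 2 * v\<^sup>2) = ennreal v + ennreal (2 * v\<^sup>2)" using v(2) by (simp add: ennreal_plus)
  finally show "(\<integral>\<^sup>+L. ennreal ((real (card (L \<inter> (U - U'))) - v)\<^sup>2) \<partial>\<nu>) \<le> ennreal v"
    by (simp add: A_def ennreal_add_left_cancel_le add.commute[of _ "ennreal (2 * v\<^sup>2)"])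
qed

section \<open>The volume of the regions\<close>

definition join_vec :: "(real^'m) \<times> (real^'n) \<Rightarrow> real^('m::finite+'n::finite)"
  where "join_vec p = (\<chi> i. case i of Inl a \<Rightarrow> fst p $ a | Inr b \<Rightarrow> snd p $ b)"

lemma xpart_join [simp]: "xpart (join_vec p) = fst p" and ypart_join [simp]: "ypart (join_vec p) = snd p"
  by (simp_all add: xpart_def ypart_def join_vec_def vec_eq_iff)

lemma continuous_on_join_vec:
  fixes S :: "((real^'m::finite) \<times> (real^'n::finite)) set"
  shows "continuous_on S join_vec"
  unfolding join_vec_def
proof (rule continuous_on_vec_lambda)
  fix i :: "'m + 'n"
  show "continuous_on S (\<lambda>p. case i of Inl a \<Rightarrow> fst p $ a | Inr b \<Rightarrow> snd p $ b)"
    by (cases i) (auto intro!: continuous_intros)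
qed

lemma join_vec_measurable [measurable]:
  "join_vec \<in> borel_measurable ((lborel :: (real^'m::finite) measure) \<Otimes>\<^sub>M (lborel :: (real^'n::finite) measure))"
proof -
  have "(join_vec :: (real^'m) \<times> (real^'n) \<Rightarrow> _) \<in> borel_measurable borel"
    by (intro borel_measurable_continuous_onI continuous_on_join_vec)
  then show ?thesis by (simp add: borel_prod[symmetric] cong: measurable_cong_sets)
qed

lemma continuous_on_xpart [continuous_intros]: "continuous_on S f \<Longrightarrow> continuous_on S (\<lambda>x. xpart (f x))"
  and continuous_on_ypart [continuous_intros]: "continuous_on S f \<Longrightarrow> continuous_on S (\<lambda>x. ypart (f x))"
  unfolding xpart_def ypart_def by (intro continuous_intros; assumption)+

lemma prod_UNIV_sum: "(\<Prod>i\<in>(UNIV :: ('m::finite+'n::finite) set). f i) = (\<Prod>i\<in>UNIV. f (Inl i)) * (\<Prod>i\<in>UNIV. f (Inr i))"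
  using prod.Plus[of "UNIV :: 'm set" "UNIV :: 'n set" f] by (simp add: UNIV_Plus_UNIV)

lemma lborel_join_vec:
  "(lborel :: (real^('m::finite+'n::finite)) measure) = distr (lborel \<Otimes>\<^sub>M lborel) borel join_vec"
proof (rule lborel_eqI)
  fix l u :: "real^('m+'n)" assume le: "\<And>b. b \<in> Basis \<Longrightarrow> l \<bullet> b \<le> u \<bullet> b"
  have le': "l $ i \<le> u $ i" for i using le[of "axis i 1"] by (simp add: cart_eq_inner_axis)
  have "join_vec -` box l u = box (xpart l) (xpart u) \<times> box (ypart l) (ypart u)"
    by (auto simp: mem_box_cart join_vec_def xpart_def ypart_def split: sum.splits)
  moreover have "emeasure (lborel \<Otimes>\<^sub>M lborel) (box (xpart l) (xpart u) \<times> box (ypart l) (ypart u)) =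
      emeasure lborel (box (xpart l) (xpart u)) * emeasure lborel (box (ypart l) (ypart u))"
    by (rule lborel.emeasure_pair_measure_Times) auto
  moreover have "emeasure lborel (box (xpart l) (xpart u)) = ennreal (\<Prod>i\<in>UNIV. u $ Inl i - l $ Inl i)"
  proof (subst emeasure_lborel_box)
    show "xpart l \<bullet> b \<le> xpart u \<bullet> b" if "b \<in> Basis" for b
      using that le' by (auto simp: Basis_vec_def inner_axis xpart_def)
  qed (simp add: prod_Basis_cart inner_axis xpart_def)
  moreover have "emeasure lborel (box (ypart l) (ypart u)) = ennreal (\<Prod>i\<in>UNIV. u $ Inr i - l $ Inr i)"
  proof (subst emeasure_lborel_box)
    show "ypart l \<bullet> b \<le> ypart u \<bullet> b" if "b \<in> Basis" for b
      using that le' by (auto simp: Basis_vec_def inner_axis ypart_def)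
  qed (simp add: prod_Basis_cart inner_axis ypart_def)
  moreover have "(\<Prod>b\<in>Basis. (u - l) \<bullet> b) = (\<Prod>i\<in>UNIV. u $ Inl i - l $ Inl i) * (\<Prod>i\<in>UNIV. u $ Inr i - l $ Inr i)"
    by (simp add: prod_Basis_cart inner_axis prod_UNIV_sum)
  ultimately show "emeasure (distr (lborel \<Otimes>\<^sub>M lborel) borel join_vec) (box l u) = ennreal (\<Prod>b\<in>Basis. (u - l) \<bullet> b)"
    using le' by (subst emeasure_distr) (auto simp: space_pair_measure ennreal_mult[symmetric] prod_nonneg)
qed simp

text \<open>The lower end is free, so that the difference of two regions is again of this kind, and
  the half-open range of \<open>norm (ypart v)\<close> makes adjacent slices disjoint without losing
  points.\<close>

definition slice :: "real \<Rightarrow> real \<Rightarrow> real \<Rightarrow> (real^('m::finite+'n::finite)) set"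
  where "slice a b c = {v. norm (xpart v) ^ CARD('m) * norm (ypart v) ^ CARD('n) \<le> c \<and>
        a \<le> norm (ypart v) \<and> norm (ypart v) < b}"

lemma region_eq_slice: "region T c = slice 1 T c"
  by (simp add: region_def slice_def)

lemma slice_eq_Diff_open:
  fixes c :: real
  assumes "a > 0"
  obtains U U' :: "(real^('m::finite+'n::finite)) set"
  where "open U" "bounded U" "open U'" "slice a b c = U - U'"
proof -
  \<comment> \<open>A norm above \<open>1\<close> is at most its own power and hence at most
    \<open>c / a ^ CARD('n)\<close>; the maximum covers the other case, and adding \<open>1\<close>
    makes the bound strict, as an open set requires.\<close>
  define K where "K = max 1 (c / a ^ CARD('n)) + 1"
  let ?U = "{v. norm (ypart v :: real^'n) < b \<and> norm (xpart v :: real^'m) < K}"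
  let ?U' = "{v. c < norm (xpart v :: real^'m) ^ CARD('m) * norm (ypart v :: real^'n) ^ CARD('n) \<or> norm (ypart v) < a}"
  have "open ?U" "open ?U'"
    by (intro open_Collect_conj open_Collect_disj open_Collect_less continuous_intros)+
  moreover have "bounded ?U"
  proof -
    have "norm v \<le> (\<Sum>i\<in>(UNIV :: ('m+'n) set). max K b)" if v: "v \<in> ?U" for v
    proof -
      have "\<bar>v $ i\<bar> \<le> max K b" for i
      proof (cases i)
        case (Inl j)
        then have "\<bar>v $ i\<bar> \<le> norm (xpart v :: real^'m)" using component_le_norm_cart[of "xpart v :: real^'m" j] by (simp add: xpart_def)
        then have "\<bar>v $ i\<bar> \<le> K" using v by simp
        then show ?thesis by simp
      next
        case (Inr j)
        then have "\<bar>v $ i\<bar> \<le> norm (ypart v :: real^'n)" using component_le_norm_cart[of "ypart v :: real^'n" j] by (simp add: ypart_def)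
        then have "\<bar>v $ i\<bar> \<le> b" using v by simp
        then show ?thesis by simp
      qed
      then show ?thesis by (intro order_trans[OF norm_le_l1_cart] sum_mono)
    qed
    then show ?thesis unfolding bounded_iff by blast
  qed
  moreover have "slice a b c = ?U - ?U'"
  proof -
    have "norm (xpart v :: real^'m) < K" if "norm (xpart v :: real^'m) ^ CARD('m) * norm (ypart v :: real^'n) ^ CARD('n) \<le> c"
      "a \<le> norm (ypart v :: real^'n)" for v
    proof (cases "norm (xpart v :: real^'m) \<le> 1")
      case False
      then have "norm (xpart v :: real^'m) \<le> norm (xpart v :: real^'m) ^ CARD('m)"
        using self_le_power[of "norm (xpart v :: real^'m)" "CARD('m)"] by simp
      moreover have "norm (xpart v :: real^'m) ^ CARD('m) * a ^ CARD('n) \<le> norm (xpart v :: real^'m) ^ CARD('m) * norm (ypart v :: real^'n) ^ CARD('n)"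
        using that(2) assms by (intro mult_left_mono power_mono) auto
      ultimately have "norm (xpart v :: real^'m) * a ^ CARD('n) \<le> c"
        using that(1) assms by (meson mult_right_mono order_trans zero_le_power less_imp_le)
      then have "norm (xpart v :: real^'m) \<le> c / a ^ CARD('n)" using assms by (simp add: pos_le_divide_eq)
      then show ?thesis by (simp add: K_def)
    qed (simp add: K_def)
    then show ?thesis by (auto simp: slice_def not_less)
  qed
  ultimately show ?thesis using that by blast
qed

lemma slice_borel [measurable]:
  assumes "a > 0"
  shows "(slice a b c :: (real^('m::finite+'n::finite)) set) \<in> sets borel"
proof -
  obtain U U' :: "(real^('m+'n)) set" where "open U" "open U'" "slice a b c = U - U'"
    by (rule slice_eq_Diff_open[OF assms])
  then show ?thesis by (simp add: sets.Diff borel_open)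
qed

section \<open>Radial integrals and the volume of a slice\<close>

lemma nn_integral_power_diff:
  assumes a: "0 < a" "a \<le> b" and n: "n > 0"
  shows "(\<integral>\<^sup>+r. ennreal (real n / r ^ (n + 1) * (r ^ n - a ^ n)) * indicator {a..b} r \<partial>lborel)
    = ennreal (real n * ln (b / a) - 1 + (a / b) ^ n)"
proof -
  \<comment> \<open>An antiderivative of the integrand. Its second term produces the correction
    \<open>(a / b) ^ n - 1\<close>, which cancels against the boundary term of the layer-cake
    formula.\<close>
  let ?F = "\<lambda>r. real n * ln r + a ^ n * inverse r ^ n"
  have "(\<integral>\<^sup>+r. ennreal (real n / r ^ (n + 1) * (r ^ n - a ^ n)) * indicator {a..b} r \<partial>lborel) = ennreal (?F b - ?F a)"
  proof (rule nn_integral_FTC_Icc)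
    fix r assume "r \<in> {a..b}"
    then have r: "a \<le> r" "r \<le> b" by auto
    then have r0: "r > 0" using a by simp
    have "(?F has_real_derivative (real n * inverse r + a ^ n * (real n * inverse r ^ (n - 1) * (- (inverse r ^ 2))))) (at r)"
      using r0 by (auto intro!: derivative_eq_intros simp: power2_eq_square inverse_eq_divide)
    moreover have "real n * inverse r + a ^ n * (real n * inverse r ^ (n - 1) * (- (inverse r ^ 2))) = real n / r ^ (n + 1) * (r ^ n - a ^ n)"
      using r0 n by (cases n) (simp_all add: field_simps power2_eq_square)
    ultimately show "(?F has_real_derivative real n / r ^ (n + 1) * (r ^ n - a ^ n)) (at r)" by simp
    show "0 \<le> real n / r ^ (n + 1) * (r ^ n - a ^ n)"
      using r a r0 by (intro mult_nonneg_nonneg divide_nonneg_nonneg) (auto intro: power_mono)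
  qed (use a in auto)
  also have "?F b - ?F a = real n * ln (b / a) - 1 + (a / b) ^ n"
    using a by (simp add: ln_div power_divide field_simps)
  finally show ?thesis .
qed

lemma nn_integral_inverse_power:
  assumes a: "0 < a" "a \<le> b" and n: "n > 0"
  shows "(\<integral>\<^sup>+r. ennreal (real n / r ^ (n + 1)) * indicator {a..b} r \<partial>lborel) = ennreal (1 / a ^ n - 1 / b ^ n)"
proof -
  have "(\<integral>\<^sup>+r. ennreal (real n / r ^ (n + 1)) * indicator {a..b} r \<partial>lborel) = ennreal (- (inverse b ^ n) - - (inverse a ^ n))"
  proof (rule nn_integral_FTC_Icc)
    fix r assume "r \<in> {a..b}"
    then have r: "a \<le> r" "r \<le> b" by auto
    then have r0: "r > 0" using a by simp
    have "((\<lambda>r. - (inverse r ^ n)) has_real_derivative (- (real n * inverse r ^ (n - 1) * (- (inverse r ^ 2))))) (at r)"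
      using r0 by (auto intro!: derivative_eq_intros simp: power2_eq_square inverse_eq_divide)
    moreover have "- (real n * inverse r ^ (n - 1) * (- (inverse r ^ 2))) = real n / r ^ (n + 1)"
      using r0 n by (cases n) (simp_all add: field_simps power2_eq_square)
    ultimately show "((\<lambda>r. - (inverse r ^ n)) has_real_derivative real n / r ^ (n + 1)) (at r)" by simp
    show "0 \<le> real n / r ^ (n + 1)" using r0 by simp
  qed (use a in auto)
  then show ?thesis by (simp add: inverse_eq_divide power_one_over)
qed

lemma emeasure_annulus:
  assumes "0 < a" "a \<le> b"
  shows "emeasure lborel {y::'a::euclidean_space. a \<le> norm y \<and> norm y < b} = ennreal (unit_ball_vol DIM('a) * (b ^ DIM('a) - a ^ DIM('a)))"
proof -
  have "{y::'a. a \<le> norm y \<and> norm y < b} = ball 0 b - ball 0 a" by auto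
  also have "emeasure lborel (ball 0 b - ball (0::'a) a) = emeasure lborel (ball (0::'a) b) - emeasure lborel (ball (0::'a) a)"
    using assms emeasure_lborel_ball_finite[of "0::'a" a] by (intro emeasure_Diff) (auto simp: subset_ball)
  also have "\<dots> = ennreal (unit_ball_vol DIM('a) * (b ^ DIM('a) - a ^ DIM('a)))"
    using assms by (simp add: emeasure_ball ennreal_minus right_diff_distrib)
  finally show ?thesis .
qed

text \<open>Layer cake: \<open>1 / t ^ n = 1 / b ^ n + (\<integral>r\<in>[t,b]. n / r ^ (n + 1))\<close> with \<open>t = norm y\<close>.\<close>

lemma nn_integral_radial:
  assumes a: "0 < a" "a \<le> b"
  shows "(\<integral>\<^sup>+y. ennreal (1 / norm y ^ DIM('a)) * indicator {y::'a::euclidean_space. a \<le> norm y \<and> norm y < b} y \<partial>lborel)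
    = ennreal (real DIM('a) * unit_ball_vol DIM('a) * ln (b / a))"
proof -
  let ?n = "DIM('a)" and ?S = "{y::'a. a \<le> norm y \<and> norm y < b}"
  have n: "?n > 0" by simp
  have [measurable]: "?S \<in> sets borel" by measurable
  have u: "unit_ball_vol ?n \<ge> 0" by simp
  define J where "J y r = (if a \<le> norm y \<and> norm y < r then 1 else 0 :: ennreal)" for y :: 'a and r :: real
  let ?k = "\<lambda>y r. ennreal (real ?n / r ^ (?n + 1)) * indicator {a..b} r * J y r"
  have [measurable]: "(\<lambda>p. J (fst p) (snd p)) \<in> borel_measurable (borel \<Otimes>\<^sub>M borel)"
    "(\<lambda>p. J (snd p) (fst p)) \<in> borel_measurable (borel \<Otimes>\<^sub>M borel)"
    unfolding J_def by measurable
  have [measurable]: "(\<lambda>y. J y r) \<in> borel_measurable borel" "J y \<in> borel_measurable borel" for y r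
    unfolding J_def[abs_def] by measurable
  have J: "(\<integral>\<^sup>+y. J y r \<partial>lborel) = emeasure lborel {y::'a. a \<le> norm y \<and> norm y < r}" for r
  proof -
    have "(\<integral>\<^sup>+y. J y r \<partial>lborel) = (\<integral>\<^sup>+y. indicator {y::'a. a \<le> norm y \<and> norm y < r} y \<partial>lborel)"
      by (rule nn_integral_cong) (simp add: J_def indicator_def)
    also have "\<dots> = emeasure lborel {y::'a. a \<le> norm y \<and> norm y < r}"
      by (rule nn_integral_indicator) measurable
    finally show ?thesis .
  qed
  have "(\<integral>\<^sup>+y. ennreal (1 / norm y ^ ?n) * indicator ?S y \<partial>lborel) =
     (\<integral>\<^sup>+y. ennreal (1 / b ^ ?n) * indicator ?S y +
       (\<integral>\<^sup>+r. ?k y r \<partial>lborel) * indicator ?S y \<partial>lborel)"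
  proof (rule nn_integral_cong)
    fix y :: 'a
    show "ennreal (1 / norm y ^ ?n) * indicator ?S y = ennreal (1 / b ^ ?n) * indicator ?S y +
       (\<integral>\<^sup>+r. ?k y r \<partial>lborel) * indicator ?S y"
    proof (cases "y \<in> ?S")
      case True
      then have y: "0 < norm y" "norm y \<le> b" "a \<le> norm y" using a by auto
      have "(\<integral>\<^sup>+r. ?k y r \<partial>lborel)
        = (\<integral>\<^sup>+r. ennreal (real ?n / r ^ (?n + 1)) * indicator {norm y..b} r \<partial>lborel)"
      proof (rule nn_integral_cong_AE)
        \<comment> \<open>The two integrands differ only at \<open>r = norm y\<close>, where the
          strict inequality in \<open>J\<close> meets the closed end of the interval.\<close>
        have "AE r in lborel. r \<noteq> norm y" by (rule AE_lborel_singleton)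
        then show "AE r in lborel. ?k y r
          = ennreal (real ?n / r ^ (?n + 1)) * indicator {norm y..b} r"
          by eventually_elim (use y in \<open>auto simp: indicator_def J_def\<close>)
      qed
      also have "\<dots> = ennreal (1 / norm y ^ ?n - 1 / b ^ ?n)" by (rule nn_integral_inverse_power[OF y(1,2) n])
      finally show ?thesis
        using True y a by (simp add: ennreal_plus[symmetric] divide_left_mono power_mono frac_le del: ennreal_plus)
    qed simp
  qed
  also have "\<dots> = ennreal (1 / b ^ ?n) * emeasure lborel ?S +
     (\<integral>\<^sup>+y. (\<integral>\<^sup>+r. ?k y r \<partial>lborel) * indicator ?S y \<partial>lborel)"
    by (subst nn_integral_add) (measurable, simp add: nn_integral_cmult)
  also have "(\<integral>\<^sup>+y. (\<integral>\<^sup>+r. ?k y r \<partial>lborel) * indicator ?S y \<partial>lborel)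
    = (\<integral>\<^sup>+y. (\<integral>\<^sup>+r. ?k y r \<partial>lborel) \<partial>(lborel :: 'a measure))"
  proof (rule nn_integral_cong)
    fix y :: 'a
    have "?k y r = 0" if "y \<notin> ?S" for r
      using that by (auto simp: indicator_def J_def)
    note z = this
    show "(\<integral>\<^sup>+r. ?k y r \<partial>lborel) * indicator ?S y
      = (\<integral>\<^sup>+r. ?k y r \<partial>lborel)"
    proof (cases "y \<in> ?S")
      case False
      show ?thesis unfolding z[OF False] by simp
    qed (simp only: indicator_simps mult_1_right)
  qed
  also have "\<dots> = (\<integral>\<^sup>+r. (\<integral>\<^sup>+y. ?k y r \<partial>(lborel :: 'a measure)) \<partial>lborel)"
    by (rule lborel_pair.Fubini') (unfold case_prod_unfold, measurable)
  also have "\<dots> = (\<integral>\<^sup>+r. ennreal (unit_ball_vol ?n) * (ennreal (real ?n / r ^ (?n + 1) * (r ^ ?n - a ^ ?n)) * indicator {a..b} r) \<partial>lborel)"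
  proof (rule nn_integral_cong)
    fix r :: real
    have "(\<integral>\<^sup>+y. ?k y r \<partial>(lborel :: 'a measure))
      = ennreal (real ?n / r ^ (?n + 1)) * indicator {a..b} r * emeasure lborel {y::'a. a \<le> norm y \<and> norm y < r}"
      by (subst nn_integral_cmult) (simp_all add: J)
    also have "\<dots> = ennreal (unit_ball_vol ?n) * (ennreal (real ?n / r ^ (?n + 1) * (r ^ ?n - a ^ ?n)) * indicator {a..b} r)"
    proof (cases "r \<in> {a..b}")
      case True
      define P Q where "P = real ?n / r ^ (?n + 1)" and "Q = r ^ ?n - a ^ ?n"
      have "0 \<le> P" "0 \<le> Q" using True a by (auto intro!: power_mono divide_nonneg_nonneg simp: P_def Q_def)
      moreover have "emeasure lborel {y::'a. a \<le> norm y \<and> norm y < r} = ennreal (unit_ball_vol ?n * Q)"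
        unfolding Q_def by (rule emeasure_annulus) (use True a in auto)
      ultimately show ?thesis
        unfolding P_def[symmetric] Q_def[symmetric] using True u by (simp add: ennreal_mult mult.left_commute)
    qed simp
    finally show "(\<integral>\<^sup>+y. ?k y r \<partial>(lborel :: 'a measure))
      = ennreal (unit_ball_vol ?n) * (ennreal (real ?n / r ^ (?n + 1) * (r ^ ?n - a ^ ?n)) * indicator {a..b} r)" .
  qed
  also have "\<dots> = ennreal (unit_ball_vol ?n) * ennreal (real ?n * ln (b / a) - 1 + (a / b) ^ ?n)"
    unfolding nn_integral_power_diff[OF a n, symmetric] by (rule nn_integral_cmult) measurable
  also have "ennreal (1 / b ^ ?n) * emeasure lborel ?S = ennreal (unit_ball_vol ?n * (1 - (a / b) ^ ?n))"
    using a u by (subst emeasure_annulus[OF a])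
      (simp add: ennreal_mult[symmetric] power_mono power_divide field_simps)
  also have "ennreal (unit_ball_vol ?n) * ennreal (real ?n * ln (b / a) - 1 + (a / b) ^ ?n) = ennreal (unit_ball_vol ?n * (real ?n * ln (b / a) - 1 + (a / b) ^ ?n))"
    using u by (simp add: ennreal_mult')
  also have "ennreal (unit_ball_vol ?n * (1 - (a / b) ^ ?n)) + \<dots> = ennreal (real ?n * unit_ball_vol ?n * ln (b / a))"
  proof (subst ennreal_plus[symmetric])
    have "(a / b) ^ ?n \<le> 1" using a by (intro power_le_one) auto
    then show "0 \<le> unit_ball_vol ?n * (1 - (a / b) ^ ?n)" using u by (intro mult_nonneg_nonneg) auto
    \<comment> \<open>Adding two \<open>ennreal\<close> values as reals needs both nonnegative; for
      the logarithmic one this is \<open>ln u \<le> u - 1\<close> at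
      \<open>u = (a / b) ^ ?n\<close>.\<close>
    have b0: "a / b > 0" using a by simp
    have "ln ((a / b) ^ ?n) \<le> (a / b) ^ ?n - 1" using b0 by (intro ln_le_minus_one) simp
    moreover have "ln ((a / b) ^ ?n) = - (real ?n * ln (b / a))"
      using b0 a by (simp add: ln_realpow ln_div algebra_simps)
    ultimately show "0 \<le> unit_ball_vol ?n * (real ?n * ln (b / a) - 1 + (a / b) ^ ?n)"
      using u by (intro mult_nonneg_nonneg) auto
  qed (simp add: algebra_simps)
  finally show ?thesis .
qed


lemma power_mult_le_iff_le_root:
  assumes "k > 0" "t > 0" "x \<ge> 0"
  shows "x ^ k * t \<le> c \<longleftrightarrow> x \<le> root k (c / t)"
proof -
  have "x ^ k * t \<le> c \<longleftrightarrow> x ^ k \<le> c / t" using assms by (simp add: pos_le_divide_eq)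
  also have "\<dots> \<longleftrightarrow> root k (x ^ k) \<le> root k (c / t)" using assms by simp
  finally show ?thesis using assms by (simp add: real_root_power_cancel)
qed

text \<open>For fixed \<open>y\<close> the section in \<open>x\<close> is a ball whose volume is
  \<open>c * unit_ball_vol CARD('m)\<close> divided by \<open>norm y ^ CARD('n)\<close>. The power
  in the definition of the region is thus what makes the remaining radial integral
  logarithmic.\<close>

lemma emeasure_slice:
  assumes a: "0 < a" "a \<le> b" and c: "c > 0"
  shows "emeasure lborel (slice a b c :: (real^('m::finite+'n::finite)) set) =
    ennreal (c * unit_ball_vol CARD('m) * (real CARD('n) * unit_ball_vol CARD('n)) * ln (b / a))"
proof -
  let ?S = "{y::real^'n. a \<le> norm y \<and> norm y < b}"
  let ?W = "join_vec -` (slice a b c :: (real^('m+'n)) set)"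
  note jm = join_vec_measurable[where 'm='m and 'n='n]
  have Wm: "?W \<in> sets (lborel \<Otimes>\<^sub>M lborel)"
    using measurable_sets[OF jm slice_borel[OF a(1)], of b c] by (simp add: space_pair_measure)
  have "emeasure lborel (slice a b c :: (real^('m+'n)) set) = emeasure (distr (lborel \<Otimes>\<^sub>M lborel) borel join_vec) (slice a b c :: (real^('m+'n)) set)"
    by (rule arg_cong[OF lborel_join_vec])
  also have "\<dots> = emeasure (lborel \<Otimes>\<^sub>M lborel) ?W"
    by (subst emeasure_distr[OF jm slice_borel[OF a(1)]]) (simp add: space_pair_measure)
  also have "\<dots> = (\<integral>\<^sup>+y. emeasure lborel ((\<lambda>x. (x, y)) -` ?W) \<partial>lborel)"
    by (rule lborel_pair.emeasure_pair_measure_alt2[OF Wm])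
  also have "\<dots> = (\<integral>\<^sup>+y. ennreal (c * unit_ball_vol CARD('m)) * (ennreal (1 / norm y ^ CARD('n)) * indicator ?S y) \<partial>lborel)"
  proof (rule nn_integral_cong)
    fix y :: "real^'n"
    show "emeasure lborel ((\<lambda>x. (x, y)) -` ?W) = ennreal (c * unit_ball_vol CARD('m)) * (ennreal (1 / norm y ^ CARD('n)) * indicator ?S y)"
    proof (cases "y \<in> ?S")
      case True
      then have y: "norm y > 0" using a by auto
      let ?q = "c / norm y ^ CARD('n)"
      have q: "?q \<ge> 0" using c by simp
      have "(\<lambda>x. (x, y)) -` ?W = cball (0::real^'m) (root CARD('m) ?q)"
        using True y by (auto simp: slice_def power_mult_le_iff_le_root)
      also have "emeasure lborel \<dots> = ennreal (unit_ball_vol CARD('m) * root CARD('m) ?q ^ CARD('m))"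
        using q by (subst emeasure_cball) auto
      also have "root CARD('m) ?q ^ CARD('m) = ?q" using q by simp
      also have "ennreal (unit_ball_vol CARD('m) * ?q) = ennreal (c * unit_ball_vol CARD('m)) * ennreal (1 / norm y ^ CARD('n))"
        using c by (subst ennreal_mult[symmetric]) (auto simp: field_simps)
      finally show ?thesis using True by simp
    next
      case False
      then have "(\<lambda>x. (x, y)) -` ?W = {}" by (auto simp: slice_def)
      then show ?thesis using False by simp
    qed
  qed
  also have "\<dots> = ennreal (c * unit_ball_vol CARD('m)) * (\<integral>\<^sup>+y. ennreal (1 / norm y ^ CARD('n)) * indicator ?S y \<partial>lborel)"
    by (rule nn_integral_cmult) measurable
  also have "(\<integral>\<^sup>+y. ennreal (1 / norm y ^ CARD('n)) * indicator ?S y \<partial>lborel) = ennreal (real CARD('n) * unit_ball_vol CARD('n) * ln (b / a))"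
    using nn_integral_radial[OF a, where 'a="real^'n"] by simp
  finally show ?thesis
    using a c by (simp add: ennreal_mult[symmetric] mult.assoc)
qed

text \<open>The closure is contained in every slice with a larger outer radius, and the explicit
  volume is continuous in that radius; no description of the boundary is required.\<close>

lemma emeasure_closure_slice:
  assumes a: "0 < a" "a \<le> b" and c: "c > 0"
  shows "emeasure lborel (closure (slice a b c :: (real^('m::finite+'n::finite)) set)) =
    emeasure lborel (slice a b c :: (real^('m+'n)) set)"
proof (rule antisym)
  let ?C = "{v. norm (xpart v :: real^'m) ^ CARD('m) * norm (ypart v :: real^'n) ^ CARD('n) \<le> c \<and>
    a \<le> norm (ypart v) \<and> norm (ypart v) \<le> b}"
  let ?\<kappa> = "c * unit_ball_vol CARD('m) * (real CARD('n) * unit_ball_vol CARD('n))"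
  have "closed ?C" by (intro closed_Collect_conj closed_Collect_le continuous_intros)
  then have "closure (slice a b c) \<subseteq> ?C" by (intro closure_minimal) (auto simp: slice_def)
  moreover have "?C \<subseteq> slice a b' c" if "b' > b" for b' using that by (auto simp: slice_def)
  ultimately have "emeasure lborel (closure (slice a b c :: (real^('m+'n)) set)) \<le> ennreal (?\<kappa> * ln (b' / a))" if "b' > b" for b'
    using emeasure_mono[of "closure (slice a b c)" "slice a b' c :: (real^('m+'n)) set" lborel] that a c slice_borel[OF a(1)]
    by (subst emeasure_slice[symmetric]) auto
  then have le: "emeasure lborel (closure (slice a b c :: (real^('m+'n)) set)) \<le> ennreal (?\<kappa> * ln ((b + inverse (real (Suc n))) / a))" for n
    by simp
  have "(\<lambda>n. ennreal (?\<kappa> * ln ((b + inverse (real (Suc n))) / a))) \<longlonglongrightarrow> ennreal (?\<kappa> * ln ((b + 0) / a))"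
    using a by (intro tendsto_ennrealI tendsto_intros LIMSEQ_inverse_real_of_nat) auto
  then have "emeasure lborel (closure (slice a b c :: (real^('m+'n)) set)) \<le> ennreal (?\<kappa> * ln ((b + 0) / a))"
    by (rule LIMSEQ_le_const) (use le in auto)
  then show "emeasure lborel (closure (slice a b c :: (real^('m+'n)) set)) \<le> emeasure lborel (slice a b c :: (real^('m+'n)) set)"
    using emeasure_slice[OF a c, where 'm='m and 'n='n] by simp
  show "emeasure lborel (slice a b c :: (real^('m+'n)) set) \<le> emeasure lborel (closure (slice a b c :: (real^('m+'n)) set))"
    by (rule emeasure_mono) (auto simp: closure_subset intro: borel_closed)
qed

section \<open>Almost sure growth of processes with linear variance\<close>

text \<open>Cauchy condensation leaves a series dominated by a multiple of the sum of
  \<open>n powr (- \<delta>)\<close>. The summand \<open>1\<close> keeps the base positive at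
  \<open>s = 1\<close>.\<close>

lemma summable_log_powr:
  assumes "\<delta> > 1"
  shows "summable (\<lambda>s. 1 / (real s * (1 + ln (real s)) powr \<delta>))"
proof (subst condensation_test)
  fix m :: nat assume m: "0 < m"
  have "real m * (1 + ln (real m)) powr \<delta> \<le> real (Suc m) * (1 + ln (real (Suc m))) powr \<delta>"
    using m assms by (intro mult_mono powr_mono2) auto
  moreover have "real m * (1 + ln (real m)) powr \<delta> > 0"
  proof -
    have "ln (real m) \<ge> 0" using m by simp
    then have "1 + ln (real m) > 0" by linarith
    then have "(1 + ln (real m)) powr \<delta> > 0" by (metis powr_gt_zero less_irrefl)
    then show ?thesis using m by (intro mult_pos_pos) auto
  qed
  ultimately show "1 / (real (Suc m) * (1 + ln (real (Suc m))) powr \<delta>) \<le> 1 / (real m * (1 + ln (real m)) powr \<delta>)"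
    by (intro frac_le) auto
next
  show "summable (\<lambda>n. 2 ^ n * (1 / (real (2 ^ n) * (1 + ln (real (2 ^ n))) powr \<delta>)))"
  proof (rule summable_comparison_test')
    show "summable (\<lambda>n. (ln 2) powr (- \<delta>) * real n powr (- \<delta>))"
      using assms by (intro summable_mult) (simp add: summable_real_powr_iff)
    fix n :: nat assume n: "n \<ge> 1"
    have "(real n * ln 2) powr \<delta> \<le> (1 + real n * ln 2) powr \<delta>" using assms by (intro powr_mono2) auto
    moreover have "(real n * ln 2) powr \<delta> > 0" using n by simp
    ultimately have "1 / (1 + real n * ln 2) powr \<delta> \<le> 1 / (real n * ln 2) powr \<delta>"
      by (intro frac_le) auto
    also have "\<dots> = (ln 2) powr (- \<delta>) * real n powr (- \<delta>)"
      by (simp add: powr_mult powr_minus field_simps)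
    finally show "norm (2 ^ n * (1 / (real (2 ^ n) * (1 + ln (real (2 ^ n))) powr \<delta>))) \<le> (ln 2) powr (- \<delta>) * real n powr (- \<delta>)"
      by (simp add: ln_realpow)
  qed
qed simp

text \<open>Squared increments over all dyadic intervals inside \<open>[0, 2 ^ s]\<close>, level by
  level; a single such quantity controls every index below \<open>2 ^ s\<close> at once.\<close>

definition dyadic_square_sum :: "(nat \<Rightarrow> real) \<Rightarrow> nat \<Rightarrow> real"
  where "dyadic_square_sum S s = (\<Sum>p<s. \<Sum>a<2 ^ (s - p). (S ((a + 1) * 2 ^ p) - S (a * 2 ^ p))\<^sup>2)"

text \<open>The binary expansion of \<open>N\<close> writes \<open>[0, N)\<close> as a union of at most \<open>s\<close> dyadic intervals.\<close>

lemma square_le_dyadic_square_sum: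
  fixes S :: "nat \<Rightarrow> real"
  assumes N: "N < 2 ^ s"
  shows "(S N - S 0)\<^sup>2 \<le> real s * dyadic_square_sum S s"
proof -
  \<comment> \<open>\<open>n p\<close> is \<open>N\<close> with its last \<open>p\<close> binary
    digits cleared. Passing from \<open>n (Suc p)\<close> to \<open>n p\<close> therefore adds
    nothing or one dyadic interval of length \<open>2 ^ p\<close>, according to digit
    \<open>p\<close>, which is the parity of \<open>q\<close> below.\<close>
  define n where "n p = (N div 2 ^ p) * 2 ^ p" for p
  have n0: "n 0 = N" and ns: "n s = 0" using N by (simp_all add: n_def)
  have "S N - S 0 = (\<Sum>p<s. S (n p) - S (n (Suc p)))"
    using sum_lessThan_telescope'[of "\<lambda>p. S (n p)" s] by (simp add: n0 ns)
  then have "(S N - S 0)\<^sup>2 = (\<Sum>p<s. S (n p) - S (n (Suc p)))\<^sup>2" by simp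
  also have "\<dots> \<le> (\<Sum>p<s. (S (n p) - S (n (Suc p)))\<^sup>2) * real (card {..<s})"
    by (rule sum_squared_le_sum_of_squares)
  also have "(\<Sum>p<s. (S (n p) - S (n (Suc p)))\<^sup>2) \<le> dyadic_square_sum S s"
    unfolding dyadic_square_sum_def
  proof (rule sum_mono)
    fix p assume "p \<in> {..<s}"
    then have p: "p < s" by simp
    define q where "q = N div 2 ^ p"
    have nS: "n (Suc p) = (q div 2) * 2 * 2 ^ p"
      by (simp only: n_def q_def power_Suc2 div_mult2_eq)
    show "(S (n p) - S (n (Suc p)))\<^sup>2 \<le> (\<Sum>a<2 ^ (s - p). (S ((a + 1) * 2 ^ p) - S (a * 2 ^ p))\<^sup>2)"
    proof (cases "even q")
      case True
      then have "n (Suc p) = n p" unfolding nS by (simp add: n_def q_def)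
      then show ?thesis by (simp add: sum_nonneg)
    next
      case False
      then have a': "q = q div 2 * 2 + 1" by (simp add: odd_two_times_div_two_succ mult.commute)
      define a where "a = q div 2 * 2"
      have a: "q = a + 1" using a' by (simp only: a_def)
      have "q < 2 ^ (s - p)"
      proof -
        have "N < 2 ^ (s - p) * 2 ^ p" using N p by (simp flip: power_add)
        then show ?thesis unfolding q_def by (simp add: less_mult_imp_div_less)
      qed
      then have "a \<in> {..<2 ^ (s - p)}" unfolding a by simp
      then have "(S ((a + 1) * 2 ^ p) - S (a * 2 ^ p))\<^sup>2 \<le> (\<Sum>a<2 ^ (s - p). (S ((a + 1) * 2 ^ p) - S (a * 2 ^ p))\<^sup>2)"
        by (intro member_le_sum) auto
      moreover have "n p = (a + 1) * 2 ^ p" by (simp only: n_def q_def[symmetric] a)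
      moreover have "n (Suc p) = a * 2 ^ p" by (simp only: nS a_def)
      ultimately show ?thesis by simp
    qed
  qed
  finally have "(S N - S 0)\<^sup>2 \<le> dyadic_square_sum S s * real (card {..<s})" by (simp add: mult_right_mono)
  then show ?thesis by (simp add: mult.commute)
qed

text \<open>The intervals of one level have total length \<open>2 ^ s\<close>, so linear variance
  gives \<open>C * 2 ^ s\<close> whatever the level, and there are \<open>s\<close> levels.\<close>

lemma nn_integral_dyadic_square_sum:
  fixes S :: "nat \<Rightarrow> 'a \<Rightarrow> real"
  assumes meas: "\<And>n. S n \<in> borel_measurable M"
    and var: "\<And>a b. a \<le> b \<Longrightarrow> (\<integral>\<^sup>+x. ennreal ((S b x - S a x)\<^sup>2) \<partial>M) \<le> ennreal (C * real (b - a))" and C: "C \<ge> 0"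
  shows "(\<integral>\<^sup>+x. ennreal (dyadic_square_sum (\<lambda>n. S n x) s) \<partial>M) \<le> ennreal (real s * (C * 2 ^ s))"
proof -
  note [measurable] = meas
  have "(\<integral>\<^sup>+x. ennreal (dyadic_square_sum (\<lambda>n. S n x) s) \<partial>M)
    = (\<Sum>p<s. \<Sum>a<2 ^ (s - p). \<integral>\<^sup>+x. ennreal ((S ((a + 1) * 2 ^ p) x - S (a * 2 ^ p) x)\<^sup>2) \<partial>M)"
  proof -
    have "ennreal (dyadic_square_sum (\<lambda>n. S n x) s) =
        (\<Sum>p<s. \<Sum>a<2 ^ (s - p). ennreal ((S ((a + 1) * 2 ^ p) x - S (a * 2 ^ p) x)\<^sup>2))" for x
      unfolding dyadic_square_sum_def by (subst sum_ennreal[symmetric], simp add: sum_nonneg) (simp add: sum_ennreal)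
    then show ?thesis by (simp add: nn_integral_sum del: sum_ennreal)
  qed
  also have "\<dots> \<le> (\<Sum>p<s. \<Sum>a<(2::nat) ^ (s - p). ennreal (C * 2 ^ p))"
  proof (intro sum_mono)
    fix p a :: nat
    show "(\<integral>\<^sup>+x. ennreal ((S ((a + 1) * 2 ^ p) x - S (a * 2 ^ p) x)\<^sup>2) \<partial>M) \<le> ennreal (C * 2 ^ p)"
      using var[of "a * 2 ^ p" "(a + 1) * 2 ^ p"] by simp
  qed
  also have "\<dots> = (\<Sum>p<s. ennreal (C * 2 ^ s))"
  proof (rule sum.cong)
    fix p assume "p \<in> {..<s}"
    then have "(2::real) ^ s = 2 ^ (s - p) * 2 ^ p" by (simp flip: power_add)
    moreover have "(\<Sum>a<(2::nat) ^ (s - p). ennreal (C * 2 ^ p)) = ennreal (2 ^ (s - p) * (C * 2 ^ p))"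
      using C by (simp add: ennreal_mult ennreal_of_nat_eq_real_of_nat)
    ultimately show "(\<Sum>a<(2::nat) ^ (s - p). ennreal (C * 2 ^ p)) = ennreal (C * 2 ^ s)" by (simp add: ac_simps)
  qed simp
  also have "\<dots> = ennreal (real s * (C * 2 ^ s))"
    using C by (simp add: ennreal_mult ennreal_of_nat_eq_real_of_nat)
  finally show ?thesis .
qed

text \<open>The normalised sums have a summable series of expectations. Hence the series itself is
  finite almost everywhere, and its value at \<open>x\<close> bounds each of its nonnegative terms;
  this value is the constant \<open>K\<close>.\<close>

lemma AE_dyadic_square_sum:
  fixes S :: "nat \<Rightarrow> 'a \<Rightarrow> real"
  assumes meas: "\<And>n. S n \<in> borel_measurable M"
    and var: "\<And>a b. a \<le> b \<Longrightarrow> (\<integral>\<^sup>+x. ennreal ((S b x - S a x)\<^sup>2) \<partial>M) \<le> ennreal (C * real (b - a))" and C: "C \<ge> 0"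
    and \<delta>: "\<delta> > 1"
  shows "AE x in M. \<exists>K\<ge>0. \<forall>s\<ge>1. dyadic_square_sum (\<lambda>n. S n x) s \<le> K * (2 ^ s * (real s)\<^sup>2 * (1 + ln (real s)) powr \<delta>)"
proof -
  note [measurable] = meas
  \<comment> \<open>One factor \<open>real s\<close> offsets the number of levels; what remains
    makes the expected quotient at most
    \<open>C / (real s * (1 + ln (real s)) powr \<delta>)\<close>.\<close>
  define h where "h s = 2 ^ s * (real s)\<^sup>2 * (1 + ln (real s)) powr \<delta>" for s
  have h: "h s > 0" if "s \<ge> 1" for s
  proof -
    have "ln (real s) \<ge> 0" using that by simp
    then have "1 + ln (real s) > 0" by linarith
    then have "(1 + ln (real s)) powr \<delta> > 0" by (metis powr_gt_zero less_irrefl)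
    then show ?thesis using that unfolding h_def by (intro mult_pos_pos) auto
  qed
  let ?Z = "\<lambda>s x. dyadic_square_sum (\<lambda>n. S n x) s"
  have [measurable]: "?Z s \<in> borel_measurable M" for s unfolding dyadic_square_sum_def by measurable
  have Z0: "?Z s x \<ge> 0" for s x unfolding dyadic_square_sum_def by (intro sum_nonneg) auto
  let ?f = "\<lambda>s x. ennreal (inverse (h s)) * ennreal (?Z s x)"
  have "(\<integral>\<^sup>+x. (\<Sum>s. ?f (Suc s) x) \<partial>M) = (\<Sum>s. \<integral>\<^sup>+x. ?f (Suc s) x \<partial>M)"
    by (rule nn_integral_suminf) measurable
  also have "\<dots> \<le> (\<Sum>s. ennreal (C * (1 / (real (Suc s) * (1 + ln (real (Suc s))) powr \<delta>))))"
  proof (rule suminf_le[OF _ summableI summableI])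
    fix s' :: nat
    define s where "s = Suc s'"
    have s: "s \<ge> 1" by (simp add: s_def)
    have "(\<integral>\<^sup>+x. ?f s x \<partial>M) = ennreal (inverse (h s)) * (\<integral>\<^sup>+x. ennreal (?Z s x) \<partial>M)"
      by (rule nn_integral_cmult) measurable
    also have "\<dots> \<le> ennreal (inverse (h s)) * ennreal (real s * (C * 2 ^ s))"
      by (intro mult_left_mono nn_integral_dyadic_square_sum meas var C) auto
    also have "\<dots> = ennreal (inverse (h s) * (real s * (C * 2 ^ s)))"
      using h[OF s] C by (subst ennreal_mult[symmetric]) auto
    also have "inverse (h s) * (real s * (C * 2 ^ s)) = C * (1 / (real s * (1 + ln (real s)) powr \<delta>))"
      using s by (simp add: h_def field_simps power2_eq_square)
    finally show "(\<integral>\<^sup>+x. ?f (Suc s') x \<partial>M) \<le> ennreal (C * (1 / (real (Suc s') * (1 + ln (real (Suc s'))) powr \<delta>)))"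
      by (simp only: s_def)
  qed
  also have "\<dots> < \<infinity>"
  proof -
    have "summable (\<lambda>s. C * (1 / (real (Suc s) * (1 + ln (real (Suc s))) powr \<delta>)))"
      using summable_log_powr[OF \<delta>] by (intro summable_mult) (subst summable_Suc_iff)
    then show ?thesis using C by (subst suminf_ennreal2) auto
  qed
  finally have "(\<integral>\<^sup>+x. (\<Sum>s. ?f (Suc s) x) \<partial>M) \<noteq> \<infinity>" by simp
  then have "AE x in M. (\<Sum>s. ?f (Suc s) x) \<noteq> \<infinity>"
    by (intro nn_integral_noteq_infinite) auto
  then show ?thesis
  proof eventually_elim
    case (elim x)
    define K where "K = enn2real (\<Sum>s. ?f (Suc s) x)"
    have K: "ennreal K = (\<Sum>s. ?f (Suc s) x)" using elim by (simp add: K_def less_top)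
    have "?Z s x \<le> K * h s" if s: "s \<ge> 1" for s
    proof -
      obtain s' where s': "s = Suc s'" using s by (cases s) auto
      have "?f (Suc s') x \<le> (\<Sum>s. ?f (Suc s) x)"
        using sum_le_suminf[of "\<lambda>s. ?f (Suc s) x" "{s'}"] by simp
      then have "ennreal (inverse (h s) * ?Z s x) \<le> ennreal K"
        using h[OF s] Z0[of x s] unfolding K s' by (subst ennreal_mult) auto
      then have "inverse (h s) * ?Z s x \<le> K" by (simp add: K_def ennreal_le_iff)
      then show ?thesis using h[OF s] by (simp add: field_simps)
    qed
    then show ?case unfolding h_def using K_def by (intro exI[of _ K]) auto
  qed
qed

lemma AE_gal_koksma:
  fixes S :: "nat \<Rightarrow> 'a \<Rightarrow> real"
  assumes meas: "\<And>n. S n \<in> borel_measurable M" and S0: "\<And>x. x \<in> space M \<Longrightarrow> S 0 x = 0"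
    and var: "\<And>a b. a \<le> b \<Longrightarrow> (\<integral>\<^sup>+x. ennreal ((S b x - S a x)\<^sup>2) \<partial>M) \<le> ennreal (C * real (b - a))" and C: "C \<ge> 0"
    and \<epsilon>: "\<epsilon> > 0"
  shows "AE x in M. \<exists>K\<ge>0. \<forall>N\<ge>1. \<bar>S N x\<bar> \<le> K * (sqrt (real N) * (1 + ln (real N)) powr (3/2) *
    (1 + ln (1 + ln (real N))) powr (1/2 + \<epsilon>))"
proof -
  \<comment> \<open>Any exponent above \<open>1\<close> gives summability; this one becomes
    \<open>1/2 + \<epsilon>\<close> under the square root.\<close>
  define \<delta> where "\<delta> = 1 + 2 * \<epsilon>"
  have \<delta>: "\<delta> > 1" using \<epsilon> by (simp add: \<delta>_def)
  have "AE x in M. x \<in> space M" by (rule AE_space)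
  moreover have "AE x in M. \<exists>K\<ge>0. \<forall>s\<ge>1. dyadic_square_sum (\<lambda>n. S n x) s \<le> K * (2 ^ s * (real s)\<^sup>2 * (1 + ln (real s)) powr \<delta>)"
    using meas var C \<delta> by (rule AE_dyadic_square_sum)
  ultimately show ?thesis
  proof eventually_elim
    case (elim x)
    then obtain K where K: "K \<ge> 0"
      "\<And>s. s \<ge> 1 \<Longrightarrow> dyadic_square_sum (\<lambda>n. S n x) s \<le> K * (2 ^ s * (real s)\<^sup>2 * (1 + ln (real s)) powr \<delta>)" by blast
    let ?g = "\<lambda>N. sqrt (real N) * (1 + ln (real N)) powr (3/2) * (1 + ln (1 + ln (real N))) powr (1/2 + \<epsilon>)"
    have "\<bar>S N x\<bar> \<le> sqrt (K * (16 * 2 powr \<delta>)) * ?g N" if N: "N \<ge> 1" for N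
    proof -
      \<comment> \<open>The least dyadic scale above \<open>N\<close>, so that
        \<open>N < 2 ^ s \<le> 2 * N\<close>. Passing to it costs a factor \<open>2\<close> in the
        length and, since \<open>s \<le> 2 * l\<close>, a factor \<open>2 ^ 3\<close> in the cubed
        logarithm: together the \<open>16\<close> below.\<close>
      define s where "s = Suc (floor_log N)"
      define l where "l = 1 + ln (real N)"
      define m where "m = 1 + ln l"
      have l: "l \<ge> 1" using N by (simp add: l_def)
      then have m: "m \<ge> 1" by (simp add: m_def)
      have s: "s \<ge> 1" "N < 2 ^ s" "2 ^ s \<le> 2 * N"
        using N floor_log_exp2_gt[of N] floor_log_exp2_le[of N] by (auto simp: s_def)
      have "real s \<le> 2 * l"
      proof -
        have "(2::real) ^ s \<le> 2 * real N" using s(3) by (metis of_nat_le_iff of_nat_mult of_nat_numeral of_nat_power)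
        then have "ln ((2::real) ^ s) \<le> ln (2 * real N)" using N by (subst ln_le_cancel_iff) auto
        then have "real s * ln 2 \<le> ln 2 + ln (real N)" using N by (simp add: ln_realpow ln_mult)
        moreover have "real s * (1/2) \<le> real s * ln 2" using ln2_ge_two_thirds by (intro mult_left_mono) auto
        moreover have "ln (2::real) \<le> 1" using ln_le_minus_one[of 2] by simp
        ultimately show ?thesis by (simp add: l_def)
      qed
      moreover have "1 + ln (real s) \<le> 2 * m"
      proof -
        have "ln (real s) \<le> ln (2 * l)" using s l \<open>real s \<le> 2 * l\<close> by (subst ln_le_cancel_iff) auto
        also have "\<dots> = ln 2 + ln l" using l by (simp add: ln_mult)
        finally show ?thesis using ln_le_minus_one[of 2] m by (simp add: m_def)
      qed
      moreover have "ln (real s) \<ge> 0" using s by simp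
      ultimately have b: "(real s) ^ 3 \<le> (2 * l) ^ 3" "(1 + ln (real s)) powr \<delta> \<le> (2 * m) powr \<delta>"
      proof -
        assume s2l: "real s \<le> 2 * l" and s2m: "1 + ln (real s) \<le> 2 * m" and ln0: "ln (real s) \<ge> 0"
        show "(real s) ^ 3 \<le> (2 * l) ^ 3" by (rule power_mono[OF s2l]) simp
        show "(1 + ln (real s)) powr \<delta> \<le> (2 * m) powr \<delta>"
          by (rule powr_mono2[OF _ _ s2m]) (use \<delta> ln0 in linarith)+
      qed
      have "(S N x)\<^sup>2 \<le> real s * dyadic_square_sum (\<lambda>n. S n x) s"
        using square_le_dyadic_square_sum[OF s(2), of "\<lambda>n. S n x"] S0 elim(1) by simp
      also have "\<dots> \<le> real s * (K * (2 ^ s * (real s)\<^sup>2 * (1 + ln (real s)) powr \<delta>))"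
        using K(2)[OF s(1)] by (intro mult_left_mono) auto
      also have "\<dots> = K * (2 ^ s * (real s) ^ 3 * (1 + ln (real s)) powr \<delta>)"
        by (simp add: power2_eq_square power3_eq_cube ac_simps)
      also have "\<dots> \<le> K * (2 * real N * (2 * l) ^ 3 * (2 * m) powr \<delta>)"
      proof (intro mult_left_mono mult_mono b K(1))
        show "(2::real) ^ s \<le> 2 * real N" using s(3) by (metis of_nat_le_iff of_nat_mult of_nat_numeral of_nat_power)
      qed (use l in auto)
      also have "\<dots> = K * (16 * 2 powr \<delta>) * (real N * l ^ 3 * m powr \<delta>)"
        using m by (simp add: powr_mult power_mult_distrib)
      finally have "\<bar>S N x\<bar> \<le> sqrt (K * (16 * 2 powr \<delta>) * (real N * l ^ 3 * m powr \<delta>))"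
        by (intro real_le_rsqrt) simp
      also have "\<dots> = sqrt (K * (16 * 2 powr \<delta>)) * (sqrt (real N) * sqrt (l ^ 3) * sqrt (m powr \<delta>))"
        by (simp add: real_sqrt_mult)
      also have "sqrt (l ^ 3) = l powr (3/2)"
      proof -
        have "sqrt (l ^ 3) = (l powr 3) powr (1/2)" using l by (simp add: powr_half_sqrt powr_numeral)
        then show ?thesis by (simp add: powr_powr)
      qed
      also have "sqrt (m powr \<delta>) = m powr (1/2 + \<epsilon>)"
      proof -
        have "sqrt (m powr \<delta>) = (m powr \<delta>) powr (1/2)" using m by (simp add: powr_half_sqrt)
        then show ?thesis by (simp add: powr_powr \<delta>_def add_divide_distrib)
      qed
      finally show ?thesis by (simp add: l_def m_def)
    qed
    then show ?case using K(1) by (intro exI[of _ "sqrt (K * (16 * 2 powr \<delta>))"]) auto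
  qed
qed

section \<open>The counting theorem\<close>

text \<open>The shifts by \<open>1\<close> keep the iterated logarithms nonnegative from
  \<open>y = 1\<close> on, so the rate is monotone there and equals \<open>1\<close> at the
  start.\<close>

definition gk_rate :: "real \<Rightarrow> real \<Rightarrow> real"
  where "gk_rate \<epsilon> y = sqrt y * (1 + ln y) powr (3/2) * (1 + ln (1 + ln y)) powr (1/2 + \<epsilon>)"

lemma gk_rate_mono:
  assumes "\<epsilon> > 0" "1 \<le> x" "x \<le> y"
  shows "gk_rate \<epsilon> x \<le> gk_rate \<epsilon> y"
proof -
  have 1: "0 \<le> ln x" "ln x \<le> ln y" using assms by auto
  then have 2: "0 \<le> ln (1 + ln x)" "ln (1 + ln x) \<le> ln (1 + ln y)" by auto
  show ?thesis
    unfolding gk_rate_def using assms 1 2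
    by (intro mult_mono powr_mono2) (auto intro!: mult_nonneg_nonneg)
qed

text \<open>Neither the shifts inside the logarithms nor the step from \<open>x\<close> to
  \<open>x + 1\<close> affects the leading order, and the constant \<kappa> is of lower order.
  Raising \<open>K\<close> to \<open>K + 1\<close> leaves room for the strict inequality.\<close>

lemma gk_rate_asymp:
  fixes K \<kappa> \<epsilon> :: real
  assumes \<epsilon>: "\<epsilon> > 0"
  shows "eventually (\<lambda>x. (K * gk_rate \<epsilon> (x + 1) + \<kappa>) / x <
    (K + 1) * x powr (- 1 / 2) * ln x powr (3 / 2) * ln (ln x) powr (1 / 2 + \<epsilon>)) at_top"
proof -
  let ?r = "\<lambda>x. x powr (- 1 / 2) * ln x powr (3 / 2) * ln (ln x) powr (1 / 2 + \<epsilon>)"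
  have 1: "((\<lambda>x. gk_rate \<epsilon> (x + 1) / x / ?r x) \<longlongrightarrow> 1) at_top"
    unfolding gk_rate_def using \<epsilon> by real_asymp
  have 2: "((\<lambda>x. 1 / x / ?r x) \<longlongrightarrow> 0) at_top"
    using \<epsilon> by real_asymp
  have "((\<lambda>x. K * (gk_rate \<epsilon> (x + 1) / x / ?r x) + \<kappa> * (1 / x / ?r x)) \<longlongrightarrow> K * 1 + \<kappa> * 0) at_top"
    by (intro tendsto_intros 1 2)
  then have "eventually (\<lambda>x. K * (gk_rate \<epsilon> (x + 1) / x / ?r x) + \<kappa> * (1 / x / ?r x) < K + 1) at_top"
    by (rule order_tendstoD) simp
  moreover have "eventually (\<lambda>x. ?r x > 0) at_top" using \<epsilon> by real_asymp
  ultimately show ?thesis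
  proof eventually_elim
    case (elim x)
    define r where "r = ?r x"
    have r: "r > 0" using elim(2) by (simp only: r_def)
    have "(K * gk_rate \<epsilon> (x + 1) + \<kappa>) / x = (K * (gk_rate \<epsilon> (x + 1) / x / r) + \<kappa> * (1 / x / r)) * r"
      using r by (simp add: distrib_right add_divide_distrib)
    also have "\<dots> < (K + 1) * r" using elim(1) r unfolding r_def[symmetric] by (intro mult_strict_right_mono)
    finally show ?case by (simp only: r_def mult.assoc)
  qed
qed

lemma card_slice_split:
  fixes L :: "(real^('m::finite+'n::finite)) set"
  assumes L: "L \<in> affine_lattices" and a: "0 < a" "a \<le> a'" "a' \<le> b"
  shows "card (L \<inter> slice a b c) = card (L \<inter> slice a a' c) + card (L \<inter> slice a' b c)"
proof -
  have fin: "finite (L \<inter> slice s t c)" if s: "s > 0" for s t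
  proof -
    obtain U U' :: "(real^('m+'n)) set" where U: "bounded U" "slice s t c = U - U'"
      by (rule slice_eq_Diff_open[OF s])
    then have "bounded (slice s t c :: (real^('m+'n)) set)" by (metis bounded_subset Diff_subset)
    then show ?thesis by (rule finite_affine_lattice_Int[OF L])
  qed
  have "L \<inter> slice a b c = (L \<inter> slice a a' c) \<union> (L \<inter> slice a' b c)" using a by (auto simp: slice_def)
  moreover have "(L \<inter> slice a a' c) \<inter> (L \<inter> slice a' b c) = {}" by (auto simp: slice_def)
  ultimately show ?thesis using fin a by (simp add: card_Un_disjoint)
qed

theorem theorem1p8:
  fixes c \<epsilon> :: real
    and \<nu> :: "(real^('m::finite+'n::finite)) set measure"
  assumes "c > 0" and "\<epsilon> > 0" and "haar_probability \<nu>"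
  shows "AE L in \<nu>. \<exists>C>0. \<exists>T\<^sub>0>1. \<forall>T>T\<^sub>0.
    \<bar>real (card (L \<inter> region T c)) / ln T
       - c * measure lborel (ball (0::real^'m) 1) * surface_area (sphere (0::real^'n) 1)\<bar>
    < C * ln T powr (- 1 / 2) * ln (ln T) powr (3 / 2) * ln (ln (ln T)) powr (1 / 2 + \<epsilon>)"
proof -
  interpret haar_affine_lattices \<nu> by standard fact
  \<comment> \<open>The volume of a region per unit of \<open>ln T\<close>; the sphere's area
    appears as dimension times ball volume.\<close>
  define \<kappa> where "\<kappa> = c * unit_ball_vol CARD('m) * (real CARD('n) * unit_ball_vol CARD('n))"
  have \<kappa>: "c * measure lborel (ball (0::real^'m) 1) * surface_area (sphere (0::real^'n) 1) = \<kappa>"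
    by (simp add: \<kappa>_def content_ball surface_area_unit_sphere)
  have \<kappa>0: "\<kappa> \<ge> 0" using \<open>c > 0\<close> by (simp add: \<kappa>_def)
  have card2: "CARD('m + 'n) \<ge> 2"
  proof -
    have "CARD('m) > 0" "CARD('n) > 0" by simp_all
    then show ?thesis unfolding card_sum by linarith
  qed
  define Q where "Q a b L = real (card (L \<inter> slice a b c))" for a b and L :: "(real^('m+'n)) set"
  have var: "(\<integral>\<^sup>+L. ennreal ((Q a b L - \<kappa> * ln (b / a))\<^sup>2) \<partial>\<nu>) \<le> ennreal (\<kappa> * ln (b / a))"
    and Qm: "Q a b \<in> borel_measurable \<nu>" if a: "0 < a" "a \<le> b" for a b
  proof -
    obtain U U' :: "(real^('m+'n)) set" where U: "open U" "bounded U" "open U'" "slice a b c = U - U'"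
      by (rule slice_eq_Diff_open[OF a(1)])
    have cl: "emeasure lborel (closure (U - U')) = emeasure lborel (U - U')"
      using emeasure_closure_slice[OF a \<open>c > 0\<close>, where 'm='m and 'n='n] by (simp only: U(4))
    have v: "emeasure lborel (U - U') = ennreal (\<kappa> * ln (b / a))"
      using emeasure_slice[OF a \<open>c > 0\<close>, where 'm='m and 'n='n] by (simp only: U(4) \<kappa>_def)
    have v0: "\<kappa> * ln (b / a) \<ge> 0" using \<kappa>0 a by (intro mult_nonneg_nonneg) auto
    note V = variance_num_points_le[OF U(1-3) card2 cl v v0]
    show "(\<integral>\<^sup>+L. ennreal ((Q a b L - \<kappa> * ln (b / a))\<^sup>2) \<partial>\<nu>) \<le> ennreal (\<kappa> * ln (b / a))"
      using V(1) by (simp only: Q_def U(4))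
    show "Q a b \<in> borel_measurable \<nu>" using V(2) by (simp only: Q_def[abs_def] U(4))
  qed
  \<comment> \<open>The volume of a slice depends only on the ratio of its radii, so exponential
    spacing gives a block of \<open>b - a\<close> indices the volume
    \<open>\<kappa> * real (b - a)\<close>, hence linear variance.\<close>
  define S where "S n L = Q 1 (exp (real n)) L - \<kappa> * real n" for n :: nat and L
  have "AE L in \<nu>. \<exists>K\<ge>0. \<forall>N\<ge>1. \<bar>S N L\<bar> \<le> K * (sqrt (real N) * (1 + ln (real N)) powr (3/2) *
    (1 + ln (1 + ln (real N))) powr (1/2 + \<epsilon>))"
  proof (rule AE_gal_koksma[where C=\<kappa>])
    show "S n \<in> borel_measurable \<nu>" for n unfolding S_def[abs_def] using Qm[of 1 "exp (real n)"] by simp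
    show "S 0 L = 0" if "L \<in> space \<nu>" for L
    proof -
      have "slice 1 (exp (real 0)) c = ({} :: (real^('m+'n)) set)" by (auto simp: slice_def)
      then show ?thesis by (simp only: S_def Q_def) simp
    qed
    show "(\<integral>\<^sup>+L. ennreal ((S b L - S a L)\<^sup>2) \<partial>\<nu>) \<le> ennreal (\<kappa> * real (b - a))" if "a \<le> b" for a b
    proof -
      have ln: "ln (exp (real b) / exp (real a)) = real (b - a)" using that by (simp add: ln_div of_nat_diff)
      have "(\<integral>\<^sup>+L. ennreal ((S b L - S a L)\<^sup>2) \<partial>\<nu>) = (\<integral>\<^sup>+L. ennreal ((Q (exp (real a)) (exp (real b)) L - \<kappa> * real (b - a))\<^sup>2) \<partial>\<nu>)"
      proof (rule nn_integral_cong)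
        fix L assume "L \<in> space \<nu>"
        then have "Q 1 (exp (real b)) L = Q 1 (exp (real a)) L + Q (exp (real a)) (exp (real b)) L"
          unfolding Q_def using that by (subst card_slice_split[where a'="exp (real a)"]) (auto simp: space_nu)
        then have "S b L - S a L = Q (exp (real a)) (exp (real b)) L - \<kappa> * real (b - a)"
          using that by (simp add: S_def of_nat_diff algebra_simps)
        then show "ennreal ((S b L - S a L)\<^sup>2) = ennreal ((Q (exp (real a)) (exp (real b)) L - \<kappa> * real (b - a))\<^sup>2)" by simp
      qed
      also have "\<dots> \<le> ennreal (\<kappa> * real (b - a))"
        using var[of "exp (real a)" "exp (real b)"] that unfolding ln by simp
      finally show ?thesis .
    qed
  qed (use \<kappa>0 \<open>\<epsilon> > 0\<close> in auto)
  moreover have "AE L in \<nu>. L \<in> space \<nu>" by (rule AE_space)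
  ultimately show ?thesis
    unfolding \<kappa>
  proof eventually_elim
    case (elim L)
    then obtain K where K: "K \<ge> 0" "\<And>N. N \<ge> 1 \<Longrightarrow> \<bar>S N L\<bar> \<le> K * gk_rate \<epsilon> (real N)"
      unfolding gk_rate_def by blast
    have L: "L \<in> affine_lattices" using elim by (simp add: space_nu)
    have mono: "Q 1 s L \<le> Q 1 t L" if "1 \<le> s" "s \<le> t" for s t
      unfolding Q_def using card_slice_split[OF L, of 1 s t c] that by simp
    obtain x0 where x0: "\<And>x. x \<ge> x0 \<Longrightarrow> (K * gk_rate \<epsilon> (x + 1) + \<kappa>) / x <
      (K + 1) * x powr (- 1 / 2) * ln x powr (3 / 2) * ln (ln x) powr (1 / 2 + \<epsilon>)"
      using gk_rate_asymp[OF \<open>\<epsilon> > 0\<close>, of K \<kappa>] by (auto simp: eventually_at_top_linorder)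
    \<comment> \<open>The maximum with \<open>1\<close> gives \<open>T0 > 1\<close> and makes the
      integer part \<open>N\<close> of \<open>ln T\<close> at least \<open>1\<close>.\<close>
    define T0 where "T0 = exp (max x0 1)"
    have "\<bar>real (card (L \<inter> region T c)) / ln T - \<kappa>\<bar>
      < (K + 1) * ln T powr (- 1 / 2) * ln (ln T) powr (3 / 2) * ln (ln (ln T)) powr (1 / 2 + \<epsilon>)" if T: "T > T0" for T
    proof -
      define x where "x = ln T"
      have "T > 0" using T exp_gt_zero[of "max x0 1"] unfolding T0_def by linarith
      then have Tx: "T = exp x" by (simp add: x_def)
      have x: "x \<ge> x0" "x \<ge> 1" using T unfolding T0_def Tx by auto
      define N where "N = nat \<lfloor>x\<rfloor>"
      have N: "N \<ge> 1" "real N \<le> x" "x \<le> real (Suc N)" using x(2) unfolding N_def by linarith+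
      have S: "\<bar>S n L\<bar> \<le> K * gk_rate \<epsilon> (x + 1)" if "n \<ge> 1" "real n \<le> x + 1" for n
      proof -
        have "gk_rate \<epsilon> (real n) \<le> gk_rate \<epsilon> (x + 1)" using that by (intro gk_rate_mono \<open>\<epsilon> > 0\<close>) auto
        then show ?thesis using K(2)[OF that(1)] mult_left_mono[OF _ K(1)] by (meson order_trans)
      qed
      \<comment> \<open>Counts increase with \<open>T\<close>, so \<open>T\<close> is enclosed
        between consecutive exponentials. The main term changes by at most \<kappa>, and the rate at
        \<open>x + 1\<close> bounds the errors at both ends.\<close>
      have "Q 1 T L \<le> Q 1 (exp (real (Suc N))) L" unfolding Tx using N x by (intro mono) (auto simp del: of_nat_Suc)
      also have "\<dots> = S (Suc N) L + \<kappa> * real (Suc N)" by (simp add: S_def)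
      also have "\<dots> \<le> K * gk_rate \<epsilon> (x + 1) + \<kappa> * (x + 1)"
        using S[of "Suc N"] N \<kappa>0 by (intro add_mono mult_left_mono) auto
      finally have up: "Q 1 T L - \<kappa> * x \<le> K * gk_rate \<epsilon> (x + 1) + \<kappa>" by (simp add: algebra_simps)
      have "\<kappa> * (x - 1) - K * gk_rate \<epsilon> (x + 1) \<le> S N L + \<kappa> * real N"
        using S[of N] N \<kappa>0 mult_left_mono[of "x - 1" "real N" \<kappa>] by auto
      also have "\<dots> = Q 1 (exp (real N)) L" by (simp add: S_def)
      also have "\<dots> \<le> Q 1 T L" unfolding Tx using N by (intro mono) auto
      finally have "- (Q 1 T L - \<kappa> * x) \<le> K * gk_rate \<epsilon> (x + 1) + \<kappa>" by (simp add: algebra_simps)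
      with up have "\<bar>Q 1 T L - \<kappa> * x\<bar> \<le> K * gk_rate \<epsilon> (x + 1) + \<kappa>" by linarith
      then have "\<bar>Q 1 T L - \<kappa> * x\<bar> / x \<le> (K * gk_rate \<epsilon> (x + 1) + \<kappa>) / x"
        using x(2) by (intro divide_right_mono) auto
      moreover have "\<bar>Q 1 T L / x - \<kappa>\<bar> = \<bar>Q 1 T L - \<kappa> * x\<bar> / x"
      proof -
        have "Q 1 T L / x - \<kappa> = (Q 1 T L - \<kappa> * x) / x" using x(2) by (simp add: diff_divide_distrib)
        then show ?thesis using x(2) by (simp add: abs_divide)
      qed
      ultimately show ?thesis
        using x0[OF x(1)] by (simp add: x_def Q_def region_eq_slice)
    qed
    moreover have "T0 > 1" by (simp add: T0_def)
    ultimately show ?case using K(1) by (intro exI[of _ "K + 1"] conjI exI[of _ T0]) auto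
  qed
qed

end
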